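(* Let $n\ge1$ be an integer and let $(C,A)$, $A\in\mathcal{L}(\mathcal{X})$, $C\in\mathcal{L}(\mathcal{X},\mathcal{Y})$, be an $n$-output-stable, exactly $n$-observable pair with $A$ strongly stable. Let $\mathcal{M}=(\operatorname{Ran}\mathcal{O}_{n,C,A})^\perp\subset\mathcal{A}_n(\mathcal{Y})$ (a closed $S_n$-invariant subspace) and $\mathcal{E}=\mathcal{M}\ominus S_n\mathcal{M}$, with reproducing kernel $k_{\mathcal{E}}$ (in the $\mathcal{A}_n(\mathcal{Y})$-inner product). Then there exist a Hilbert space $\mathcal{U}$ and operators $B\in\mathcal{L}(\mathcal{U},\mathcal{X})$, $D\in\mathcal{L}(\mathcal{U},\mathcal{Y})$, with $\begin{bmatrix} B \\ D \end{bmatrix}$ injective, which solve the Cholesky factorization problem $$\begin{bmatrix} B \\ D \end{bmatrix}\begin{bmatrix} B^* & D^* \end{bmatrix}=\begin{bmatrix} \mathfrak{G}_{n,1,C,A}^{-1} & 0 \\ 0 & I_{\mathcal{Y}} \end{bmatrix}-\begin{bmatrix} A \\ C \end{bmatrix}\mathcal{G}_{n,C,A}^{-1}\begin{bmatrix} A^* & C^* \end{bmatrix}.$$ Moreover, if $\Theta(z)=D+zC\sum_{j=1}^n(I-zA)^{-j}B$ for such $B$, $D$, then: (1) $k_{\mathcal{E}}(z,\zeta)=\Theta(z)\Theta(\zeta)^*$, and therefore the multiplication operator $M_\Theta:u\mapsto\Theta(\cdot)u$ maps $\mathcal{U}$ onto $\mathcal{E}$ unitarily. (2) $\mathcal{E}$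 is orthogonal to $S_n^k\Theta\cdot\mathcal{U}$ for every $k\ge1$. (3) $M_\Theta$ is a contractive multiplier from the Hardy space $H^2(\mathcal{U})$ into $\mathcal{A}_n(\mathcal{Y})$. Hence, if $\mathcal{M}$ has the wandering subspace property, then $\mathcal{M}$ is the $\mathcal{A}_n(\mathcal{Y})$-closure of $M_\Theta H^2(\mathcal{U})$.
   Context: $\mathcal{A}_n(\mathcal{Y})$ is the Hilbert space of $\mathcal{Y}$-valued functions $f(z)=\sum_{j\ge0}f_jz^j$ analytic on the open unit disk with $\|f\|^2=\sum_{j\ge0}\mu_{n,j}\|f_j\|^2<\infty$, $\mu_{n,j}=1/\binom{n+j-1}{j}$; $S_n:f(z)\mapsto zf(z)$; $H^2(\mathcal{U})=\mathcal{A}_1(\mathcal{U})$. The $n$-observability operator is $\mathcal{O}_{n,C,A}:x\mapsto C(I-zA)^{-n}x=\sum_{j\ge0}\binom{n+j-1}{j}(CA^jx)z^j$. The pair $(C,A)$ is $n$-output-stable if $\mathcal{O}_{n,C,A}$ is bounded from $\mathcal{X}$ to $\mathcal{A}_n(\mathcal{Y})$. The gramian is $\mathcal{G}_{n,C,A}=\mathcal{O}_{n,C,A}^*\mathcal{O}_{n,C,A}=\sum_{j\ge0}\binom{n+j-1}{j}A^{*j}C^*CA^j$, and the pair is exactly $n$-observable if this gramian is bounded and bounded below. $\mathfrak{G}_{n,1,C,A}=\sum_{j\ge0}\binom{n+j}{j+1}A^{*j}C^*CA^j$ (also bounded and bounded below under exact $n$-observability). $A$ is strongly stable if $\|A^kx\|\to0$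 for every $x$. An $S_n$-invariant closed subspace $\mathcal{M}$ has the wandering subspace property if $\mathcal{M}=\overline{\operatorname{span}}\{S_n^k(\mathcal{M}\ominus S_n\mathcal{M}):k\ge0\}$. *)

theory Defs
  imports "HOL-Analysis.Analysis"
begin

section \<open>Complex Hilbert spaces\<close>

text \<open>
  A complex Hilbert space is a real Hilbert space (with the topology and norm of the library classes)
  together with a complex scalar multiplication extending the real one and a sesquilinear form,
  linear in the first argument, whose real part is the real inner product. Definiteness and
  \<open>norm x ^ 2 = Re (cinner x x)\<close> are inherited from \<^class>\<open>real_inner\<close>.
\<close>

class complex_hilbert = real_inner + banach +
  fixes scaleC :: "complex \<Rightarrow> 'a \<Rightarrow> 'a" (infixr "*\<^sub>C" 75)
    and cinner :: "'a \<Rightarrow> 'a \<Rightarrow> complex"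
  assumes scaleR_scaleC: "scaleR r x = complex_of_real r *\<^sub>C x"
    and scaleC_add_right: "a *\<^sub>C (x + y) = a *\<^sub>C x + a *\<^sub>C y"
    and scaleC_add_left: "(a + b) *\<^sub>C x = a *\<^sub>C x + b *\<^sub>C x"
    and scaleC_scaleC: "a *\<^sub>C (b *\<^sub>C x) = (a * b) *\<^sub>C x"
    and inner_eq_Re_cinner: "inner x y = Re (cinner x y)"
    and cinner_commute: "cinner x y = cnj (cinner y x)"
    and cinner_add_left: "cinner (x + y) z = cinner x z + cinner y z"
    and cinner_scaleC_left: "cinner (a *\<^sub>C x) y = a * cinner x y"

instantiation complex :: complex_hilbert
begin

definition scaleC_complex :: "complex \<Rightarrow> complex \<Rightarrow> complex" where
  "scaleC_complex a x = a * x"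

definition cinner_complex :: "complex \<Rightarrow> complex \<Rightarrow> complex" where
  "cinner_complex x y = x * cnj y"

instance
  by standard
    (auto simp: scaleC_complex_def cinner_complex_def inner_complex_def algebra_simps
      scaleR_conv_of_real)

end

text \<open>The Hilbert space direct sum.\<close>

instantiation prod :: (complex_hilbert, complex_hilbert) complex_hilbert
begin

definition scaleC_prod :: "complex \<Rightarrow> 'a \<times> 'b \<Rightarrow> 'a \<times> 'b" where
  "scaleC_prod a x = (a *\<^sub>C fst x, a *\<^sub>C snd x)"

definition cinner_prod :: "'a \<times> 'b \<Rightarrow> 'a \<times> 'b \<Rightarrow> complex" where
  "cinner_prod x y = cinner (fst x) (fst y) + cinner (snd x) (snd y)"

instance
proof
  fix x y :: "'a \<times> 'b"
  show "cinner x y = cnj (cinner y x)"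
    unfolding cinner_prod_def complex_cnj_add
    using cinner_commute[of "fst x" "fst y"] cinner_commute[of "snd x" "snd y"] by simp
qed (auto simp: scaleC_prod_def cinner_prod_def prod_eq_iff scaleR_scaleC scaleC_add_right
      scaleC_add_left scaleC_scaleC inner_prod_def inner_eq_Re_cinner cinner_add_left
      cinner_scaleC_left algebra_simps)

end

text \<open>
  Closed subspaces of a \<^class>\<open>complex_hilbert\<close> type serve as Hilbert spaces whose existence can be
  asserted inside a formula; a space given by a whole type is \<^const>\<open>UNIV\<close>.
\<close>

definition hilbert_subspace :: "'a::complex_hilbert set \<Rightarrow> bool" where
  "hilbert_subspace V \<longleftrightarrow> closed V \<and> 0 \<in> V \<and> (\<forall>x\<in>V. \<forall>y\<in>V. x + y \<in> V) \<and>
     (\<forall>a. \<forall>x\<in>V. a *\<^sub>C x \<in> V)"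

definition bounded_op_on :: "'a::complex_hilbert set \<Rightarrow> ('a \<Rightarrow> 'b::complex_hilbert) \<Rightarrow> bool" where
  "bounded_op_on V T \<longleftrightarrow> (\<forall>x\<in>V. \<forall>y\<in>V. T (x + y) = T x + T y) \<and>
     (\<forall>a. \<forall>x\<in>V. T (a *\<^sub>C x) = a *\<^sub>C T x) \<and> (\<exists>K. \<forall>x\<in>V. norm (T x) \<le> K * norm x)"

text \<open>Adjoint of an operator whose domain is the Hilbert space \<open>V\<close>; its values lie in \<open>V\<close>.\<close>

definition adj_on :: "'a::complex_hilbert set \<Rightarrow> ('a \<Rightarrow> 'b::complex_hilbert) \<Rightarrow> 'b \<Rightarrow> 'a" where
  "adj_on V T y = (THE v. v \<in> V \<and> (\<forall>u\<in>V. cinner (T u) y = cinner u v))"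

abbreviation adj :: "('a::complex_hilbert \<Rightarrow> 'b::complex_hilbert) \<Rightarrow> 'b \<Rightarrow> 'a" where
  "adj T \<equiv> adj_on UNIV T"

definition strongly_stable :: "('x::complex_hilbert \<Rightarrow> 'x) \<Rightarrow> bool" where
  "strongly_stable A \<longleftrightarrow> (\<forall>x. (\<lambda>k. norm ((A ^^ k) x)) \<longlonglongrightarrow> 0)"


section \<open>The weighted Bergman spaces\<close>

text \<open>
  Functions on the open unit disk are represented by total functions that vanish off the disk, so
  that equality of functions is equality on the disk.
\<close>

definition power_series :: "(nat \<Rightarrow> 'y::complex_hilbert) \<Rightarrow> complex \<Rightarrow> 'y" where
  "power_series a z = (if norm z < 1 then (\<Sum>j. z ^ j *\<^sub>C a j) else 0)"

definition taylor :: "(complex \<Rightarrow> 'y::complex_hilbert) \<Rightarrow> nat \<Rightarrow> 'y" where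
  "taylor f = (THE a. \<forall>z. norm z < 1 \<longrightarrow> (\<lambda>j. z ^ j *\<^sub>C a j) sums f z)"

definition weight :: "nat \<Rightarrow> nat \<Rightarrow> real" where
  "weight n j = 1 / real ((n + j - 1) choose j)"

text \<open>
  \<open>bergman n V\<close> is the space of \<open>V\<close>-valued functions; the weights decay at most polynomially for
  \<open>n \<ge> 1\<close>, so the summability condition forces the series to converge in the whole disk.
\<close>

definition bergman :: "nat \<Rightarrow> 'y::complex_hilbert set \<Rightarrow> (complex \<Rightarrow> 'y) set" where
  "bergman n V = {power_series a | a. (\<forall>j. a j \<in> V) \<and>
     summable (\<lambda>j. weight n j * (norm (a j))\<^sup>2)}"

abbreviation hardy :: "'y::complex_hilbert set \<Rightarrow> (complex \<Rightarrow> 'y) set" where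
  "hardy V \<equiv> bergman 1 V"

definition bergman_norm :: "nat \<Rightarrow> (complex \<Rightarrow> 'y::complex_hilbert) \<Rightarrow> real" where
  "bergman_norm n f = sqrt (\<Sum>j. weight n j * (norm (taylor f j))\<^sup>2)"

definition bergman_inner ::
    "nat \<Rightarrow> (complex \<Rightarrow> 'y::complex_hilbert) \<Rightarrow> (complex \<Rightarrow> 'y) \<Rightarrow> complex" where
  "bergman_inner n f g = (\<Sum>j. complex_of_real (weight n j) * cinner (taylor f j) (taylor g j))"

definition shift :: "(complex \<Rightarrow> 'y::complex_hilbert) \<Rightarrow> complex \<Rightarrow> 'y" where
  "shift f z = z *\<^sub>C f z"

definition bergman_closure ::
    "nat \<Rightarrow> (complex \<Rightarrow> 'y::complex_hilbert) set \<Rightarrow> (complex \<Rightarrow> 'y) set" where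
  "bergman_closure n F =
     {f \<in> bergman n UNIV. \<forall>e>0. \<exists>g\<in>F. bergman_norm n (\<lambda>z. f z - g z) < e}"

definition closed_invariant_subspace ::
    "nat \<Rightarrow> (complex \<Rightarrow> 'y::complex_hilbert) set \<Rightarrow> bool" where
  "closed_invariant_subspace n M \<longleftrightarrow> M \<subseteq> bergman n UNIV \<and> (\<lambda>z. 0) \<in> M \<and>
     (\<forall>f\<in>M. \<forall>g\<in>M. (\<lambda>z. f z + g z) \<in> M) \<and> (\<forall>a. \<forall>f\<in>M. (\<lambda>z. a *\<^sub>C f z) \<in> M) \<and>
     bergman_closure n M = M \<and> shift ` M \<subseteq> M"

definition wandering :: "nat \<Rightarrow> (complex \<Rightarrow> 'y::complex_hilbert) set \<Rightarrow> (complex \<Rightarrow> 'y) set" where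
  "wandering n M = {f \<in> M. \<forall>g\<in>M. bergman_inner n f (shift g) = 0}"

definition fun_span :: "(complex \<Rightarrow> 'y::complex_hilbert) set \<Rightarrow> (complex \<Rightarrow> 'y) set" where
  "fun_span F = {\<lambda>z. \<Sum>f\<in>T. c f *\<^sub>C f z | T c. finite T \<and> T \<subseteq> F}"

definition wandering_subspace_property ::
    "nat \<Rightarrow> (complex \<Rightarrow> 'y::complex_hilbert) set \<Rightarrow> bool" where
  "wandering_subspace_property n M \<longleftrightarrow> closed_invariant_subspace n M \<and>
     M = bergman_closure n (fun_span (\<Union>k. (shift ^^ k) ` wandering n M))"

text \<open>
  \<open>k z \<zeta>\<close> is an operator on the coefficient space; its columns \<open>k (\<cdot>) \<zeta> y\<close> lie in \<open>E\<close> and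
  reproduce evaluation at \<open>\<zeta>\<close>.
\<close>

definition reproducing_kernel ::
    "nat \<Rightarrow> (complex \<Rightarrow> 'y::complex_hilbert) set \<Rightarrow> (complex \<Rightarrow> complex \<Rightarrow> 'y \<Rightarrow> 'y) \<Rightarrow> bool" where
  "reproducing_kernel n E k \<longleftrightarrow> (\<forall>\<zeta>. norm \<zeta> < 1 \<longrightarrow> (\<forall>y. (\<lambda>z. k z \<zeta> y) \<in> E \<and>
     (\<forall>f\<in>E. bergman_inner n f (\<lambda>z. k z \<zeta> y) = cinner (f \<zeta>) y)))"

definition kernel_of ::
    "nat \<Rightarrow> (complex \<Rightarrow> 'y::complex_hilbert) set \<Rightarrow> complex \<Rightarrow> complex \<Rightarrow> 'y \<Rightarrow> 'y" where
  "kernel_of n E z \<zeta> y = (THE h. h \<in> E \<and> (\<forall>f\<in>E. bergman_inner n f h = cinner (f \<zeta>) y)) z"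

definition mult_op ::
    "(complex \<Rightarrow> 'u::complex_hilbert \<Rightarrow> 'y::complex_hilbert) \<Rightarrow> (complex \<Rightarrow> 'u) \<Rightarrow> complex \<Rightarrow> 'y" where
  "mult_op \<Theta> f z = (if norm z < 1 then \<Theta> z (f z) else 0)"


section \<open>Output pairs\<close>

text \<open>
  \<open>C (I - z A)\<^sup>-\<^sup>n x\<close> is taken through its power series, which needs no assumption on the spectrum
  of \<open>A\<close>.
\<close>

definition observability ::
    "nat \<Rightarrow> ('x::complex_hilbert \<Rightarrow> 'y::complex_hilbert) \<Rightarrow> ('x \<Rightarrow> 'x) \<Rightarrow> 'x \<Rightarrow> complex \<Rightarrow> 'y" where
  "observability n C A x =
     power_series (\<lambda>j. of_nat ((n + j - 1) choose j) *\<^sub>C C ((A ^^ j) x))"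

definition output_stable ::
    "nat \<Rightarrow> ('x::complex_hilbert \<Rightarrow> 'y::complex_hilbert) \<Rightarrow> ('x \<Rightarrow> 'x) \<Rightarrow> bool" where
  "output_stable n C A \<longleftrightarrow> (\<exists>K. \<forall>x. observability n C A x \<in> bergman n UNIV \<and>
     bergman_norm n (observability n C A x) \<le> K * norm x)"

definition gramian_term ::
    "('x::complex_hilbert \<Rightarrow> 'y::complex_hilbert) \<Rightarrow> ('x \<Rightarrow> 'x) \<Rightarrow> nat \<Rightarrow> 'x \<Rightarrow> 'x" where
  "gramian_term C A j x = (adj A ^^ j) (adj C (C ((A ^^ j) x)))"

text \<open>The operator series converge in the strong operator topology.\<close>

definition gramian ::
    "nat \<Rightarrow> ('x::complex_hilbert \<Rightarrow> 'y::complex_hilbert) \<Rightarrow> ('x \<Rightarrow> 'x) \<Rightarrow> 'x \<Rightarrow> 'x" where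
  "gramian n C A x = (\<Sum>j. of_nat ((n + j - 1) choose j) *\<^sub>C gramian_term C A j x)"

definition shifted_gramian ::
    "nat \<Rightarrow> ('x::complex_hilbert \<Rightarrow> 'y::complex_hilbert) \<Rightarrow> ('x \<Rightarrow> 'x) \<Rightarrow> 'x \<Rightarrow> 'x" where
  "shifted_gramian n C A x = (\<Sum>j. of_nat ((n + j) choose (j + 1)) *\<^sub>C gramian_term C A j x)"

definition exactly_observable ::
    "nat \<Rightarrow> ('x::complex_hilbert \<Rightarrow> 'y::complex_hilbert) \<Rightarrow> ('x \<Rightarrow> 'x) \<Rightarrow> bool" where
  "exactly_observable n C A \<longleftrightarrow>
     (\<forall>x. summable (\<lambda>j. of_nat ((n + j - 1) choose j) *\<^sub>C gramian_term C A j x)) \<and>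
     bounded_op_on UNIV (gramian n C A) \<and>
     (\<exists>\<epsilon>>0. \<forall>x. \<epsilon> * norm x \<le> norm (gramian n C A x))"

definition observability_complement ::
    "nat \<Rightarrow> ('x::complex_hilbert \<Rightarrow> 'y::complex_hilbert) \<Rightarrow> ('x \<Rightarrow> 'x) \<Rightarrow> (complex \<Rightarrow> 'y) set" where
  "observability_complement n C A =
     {f \<in> bergman n UNIV. \<forall>x. bergman_inner n f (observability n C A x) = 0}"

text \<open>
  The block-operator identity, applied to an arbitrary vector \<open>(x, y)\<close> of the direct sum, for
  operators \<open>B\<close> and \<open>D\<close> on the Hilbert space \<open>U\<close>.
\<close>

definition cholesky_solution ::
    "nat \<Rightarrow> ('x::complex_hilbert \<Rightarrow> 'y::complex_hilbert) \<Rightarrow> ('x \<Rightarrow> 'x) \<Rightarrow>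
     'u::complex_hilbert set \<Rightarrow> ('u \<Rightarrow> 'x) \<Rightarrow> ('u \<Rightarrow> 'y) \<Rightarrow> bool" where
  "cholesky_solution n C A U B D \<longleftrightarrow>
     bounded_op_on U B \<and> bounded_op_on U D \<and> inj_on (\<lambda>u. (B u, D u)) U \<and>
     (\<forall>x y. let u = adj_on U B x + adj_on U D y;
                w = inv (gramian n C A) (adj A x + adj C y)
            in (B u, D u) = (inv (shifted_gramian n C A) x, y) - (A w, C w))"

definition resolvent :: "('x::complex_hilbert \<Rightarrow> 'x) \<Rightarrow> complex \<Rightarrow> 'x \<Rightarrow> 'x" where
  "resolvent A z = inv (\<lambda>x. x - z *\<^sub>C A x)"

definition theta ::
    "nat \<Rightarrow> ('x::complex_hilbert \<Rightarrow> 'y::complex_hilbert) \<Rightarrow> ('x \<Rightarrow> 'x) \<Rightarrow>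
     ('u::complex_hilbert \<Rightarrow> 'x) \<Rightarrow> ('u \<Rightarrow> 'y) \<Rightarrow> complex \<Rightarrow> 'u \<Rightarrow> 'y" where
  "theta n C A B D z u = D u + z *\<^sub>C C (\<Sum>j=1..n. (resolvent A z ^^ j) (B u))"

end

theory Submission
  imports Defs
begin

text \<open>
  Write \<open>N\<^sub>j\<close> for the coefficients of \<open>(1 - t)\<^sup>-\<^sup>n\<close>, so that the space has the weights \<open>1 / N\<^sub>j\<close>,
  let \<open>G\<close> and \<open>H\<close> be the gramians with coefficients \<open>N\<^sub>j\<close> and \<open>N\<^sub>j\<^sub>+\<^sub>1\<close>, let \<open>O\<close> be the observability
  operator, \<open>S\<close> the shift and \<open>M\<close> the orthogonal complement of the range of \<open>O\<close>. Comparing coefficients,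
  \<open>S\<^sup>* O = O A\<close>, so \<open>M\<close> is invariant, and \<open>G = C\<^sup>* C + A\<^sup>* H A\<close>, the Stein identity.

  \<^item> A function \<open>f\<close> in \<open>M\<close> is orthogonal to \<open>S M\<close> iff \<open>S\<^sup>* f\<close> is orthogonal to \<open>M\<close>, hence iff \<open>S\<^sup>* f = O x\<close>
    for some \<open>x\<close>: the range of \<open>O\<close> is closed because \<open>G\<close> is invertible. This says that \<open>f\<close> has the
    coefficients \<open>y, N\<^sub>1 C x, N\<^sub>2 C A x, \<dots>\<close>; such an \<open>f\<close> lies in \<open>M\<close> iff \<open>C\<^sup>* y + A\<^sup>* H x = 0\<close>, and
    \<open>\<parallel>f\<parallel>\<^sup>2 = \<parallel>y\<parallel>\<^sup>2 + \<langle>H x, x\<rangle>\<close>. So the wandering subspace \<open>E\<close> (\<open>wandering_eq\<close>) is isometric to the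
    orthogonal complement of the vectors \<open>(A w, C w)\<close> for the inner product of \<open>diag (H, 1)\<close>.

  \<^item> By the Stein identity the right-hand side of the Cholesky problem is \<open>diag (H\<^sup>-\<^sup>1, 1)\<close> followed by the
    orthogonal projection onto that complement. A factorization with an injective factor \<open>u \<mapsto> (B u, D u)\<close>
    is therefore the same as a unitary map from \<open>U\<close> onto the complement (\<open>T_orthogonal\<close>, \<open>T_onto\<close>,
    \<open>T_isometry\<close>); one exists because \<open>H\<close> has an invertible square root (\<open>cholesky_solution_exists\<close>).
    Since \<open>(1 - t)\<^sup>-\<^sup>1 + \<cdots> + (1 - t)\<^sup>-\<^sup>n\<close> has the coefficients \<open>N\<^sub>j\<^sub>+\<^sub>1\<close>, the function \<open>\<Theta>(\<cdot>) u\<close> is exactly the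
    element of \<open>E\<close> with \<open>x = B u\<close> and \<open>y = D u\<close>. So \<open>u \<mapsto> \<Theta>(\<cdot>) u\<close> is unitary from \<open>U\<close> onto \<open>E\<close>, which
    gives the kernel formula.

  \<^item> The multiplier is contractive because \<open>\<Theta> h = \<Theta> h\<^sub>0 + S (\<Theta> h')\<close> when \<open>h = h\<^sub>0 + z h'\<close>: the first term
    lies in \<open>E\<close> and the second in \<open>S M\<close>, so they are orthogonal, and \<open>S\<close> is a contraction. Induction
    on the degree treats polynomials (\<open>conv_finite\<close>), and a limit all of the Hardy space. The image of the
    Hardy space lies in \<open>M\<close> and contains every \<open>S\<^sup>k E\<close>, hence is dense in \<open>M\<close> as soon as these spaces
    span a dense subspace of \<open>M\<close>.
\<close>

section \<open>Operators between complex Hilbert spaces\<close>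

lemma cinner_add_right: "cinner x (y + z) = cinner x y + cinner x z"
  by (metis cinner_commute cinner_add_left complex_cnj_add)

lemma cinner_scaleC_right: "cinner x (a *\<^sub>C y) = cnj a * cinner x y"
  by (metis cinner_commute cinner_scaleC_left complex_cnj_mult)

lemma cinner_self: "cinner x x = complex_of_real ((norm x)\<^sup>2)"
proof (rule complex_eqI)
  show "Re (cinner x x) = Re (complex_of_real ((norm x)\<^sup>2))"
    by (simp add: power2_norm_eq_inner inner_eq_Re_cinner)
  have "Im (cinner x x) = - Im (cinner x x)"
    by (metis cinner_commute cnj.simps(2))
  then show "Im (cinner x x) = Im (complex_of_real ((norm x)\<^sup>2))"
    by simp
qed

lemma norm_scaleC: "norm (a *\<^sub>C x) = norm a * norm x"
proof -
  have "complex_of_real ((norm (a *\<^sub>C x))\<^sup>2) = (a * cnj a) * cinner x x"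
    by (simp add: cinner_self[symmetric] cinner_scaleC_left cinner_scaleC_right del: of_real_power)
  also have "\<dots> = complex_of_real ((norm a * norm x)\<^sup>2)"
    by (simp add: cinner_self power_mult_distrib complex_norm_square[of a] del: of_real_power)
  finally have "(norm (a *\<^sub>C x))\<^sup>2 = (norm a * norm x)\<^sup>2"
    using of_real_eq_iff by blast
  then show ?thesis
    by (simp add: power2_eq_iff_nonneg)
qed

text \<open>Rotating \<open>x\<close> by a phase makes the sesquilinear form real, so that the real inequality applies.\<close>

lemma norm_cinner_le: "norm (cinner x y) \<le> norm x * norm y"
proof -
  define c where "c = cnj (sgn (cinner x y))"
  have "complex_of_real (norm (cinner x y)) = c * cinner x y"
    unfolding c_def by (simp add: sgn_div_norm complex_norm_square[symmetric] power2_eq_square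
        scaleR_conv_of_real divide_simps mult.commute)
  then have "norm (cinner x y) = inner (c *\<^sub>C x) y"
    by (metis Re_complex_of_real cinner_scaleC_left inner_eq_Re_cinner)
  also have "\<dots> \<le> norm (c *\<^sub>C x) * norm y"
    by (rule norm_cauchy_schwarz)
  also have "\<dots> \<le> norm x * norm y"
    by (auto simp: norm_scaleC c_def norm_sgn intro!: mult_right_mono)
  finally show ?thesis .
qed

interpretation scaleC: bounded_bilinear "scaleC :: complex \<Rightarrow> 'a::complex_hilbert \<Rightarrow> 'a"
proof
  show "\<exists>K. \<forall>(a::complex) (b::'a). norm (a *\<^sub>C b) \<le> norm a * norm b * K"
    by (intro exI[of _ 1]) (simp add: norm_scaleC)
  fix r :: real and a :: complex and b :: 'a
  show "(r *\<^sub>R a) *\<^sub>C b = r *\<^sub>R (a *\<^sub>C b)" "a *\<^sub>C (r *\<^sub>R b) = r *\<^sub>R (a *\<^sub>C b)"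
    by (simp_all add: scaleR_scaleC[where 'a='a] scaleC_scaleC scaleR_conv_of_real mult.commute)
qed (simp_all add: scaleC_add_left scaleC_add_right)

interpretation cinner: bounded_bilinear "cinner :: 'a::complex_hilbert \<Rightarrow> 'a \<Rightarrow> complex"
proof
  show "\<exists>K. \<forall>(a::'a) b. norm (cinner a b) \<le> norm a * norm b * K"
    by (intro exI[of _ 1]) (simp add: norm_cinner_le)
  fix r :: real and a b :: 'a
  show "cinner (r *\<^sub>R a) b = r *\<^sub>R cinner a b" "cinner a (r *\<^sub>R b) = r *\<^sub>R cinner a b"
    by (simp_all add: scaleR_scaleC[where 'a='a] cinner_scaleC_left cinner_scaleC_right
        scaleR_conv_of_real)
qed (simp_all add: cinner_add_left cinner_add_right)

lemma scaleC_one: "1 *\<^sub>C x = x"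
  by (metis of_real_1 scaleR_one scaleR_scaleC)

lemma cinner_extensionality: "x = y" if "\<And>z. cinner x z = cinner y z"
proof -
  have "cinner (x - y) (x - y) = 0"
    using that by (simp add: cinner.diff_left)
  then show ?thesis
    by (simp add: cinner_self)
qed

lemma bounded_op_onD:
  assumes "bounded_op_on V T"
  shows "\<And>x y. x \<in> V \<Longrightarrow> y \<in> V \<Longrightarrow> T (x + y) = T x + T y"
    and "\<And>a x. x \<in> V \<Longrightarrow> T (a *\<^sub>C x) = a *\<^sub>C T x"
  using assms by (auto simp: bounded_op_on_def)

lemma bounded_op_on_bound:
  assumes "bounded_op_on V T"
  obtains K where "K > 0" "\<And>x. x \<in> V \<Longrightarrow> norm (T x) \<le> K * norm x"
proof -
  obtain K where "\<forall>x\<in>V. norm (T x) \<le> K * norm x"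
    using assms by (auto simp: bounded_op_on_def)
  then have "norm (T x) \<le> (\<bar>K\<bar> + 1) * norm x" if "x \<in> V" for x
    using that by (smt (verit) mult_right_mono norm_ge_zero)
  then show ?thesis
    by (intro that[of "\<bar>K\<bar> + 1"]) auto
qed

lemma bounded_op_on_UNIV_bounded_linear:
  assumes "bounded_op_on UNIV T"
  shows "bounded_linear T"
proof
  obtain K where "\<And>x. norm (T x) \<le> K * norm x"
    using assms by (auto simp: bounded_op_on_def)
  then show "\<exists>K. \<forall>x. norm (T x) \<le> norm x * K"
    by (auto simp: mult.commute)
qed (use assms in \<open>auto simp: bounded_op_on_def scaleR_scaleC\<close>)

lemma hilbert_subspaceD:
  assumes "hilbert_subspace V"
  shows "closed V" "0 \<in> V" "\<And>x y. x \<in> V \<Longrightarrow> y \<in> V \<Longrightarrow> x + y \<in> V"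
    "\<And>a x. x \<in> V \<Longrightarrow> a *\<^sub>C x \<in> V" "\<And>r x. x \<in> V \<Longrightarrow> r *\<^sub>R x \<in> V"
    "\<And>x y. x \<in> V \<Longrightarrow> y \<in> V \<Longrightarrow> x - y \<in> V"
proof -
  show *: "closed V" "0 \<in> V" "\<And>x y. x \<in> V \<Longrightarrow> y \<in> V \<Longrightarrow> x + y \<in> V"
    "\<And>a x. x \<in> V \<Longrightarrow> a *\<^sub>C x \<in> V" "\<And>r x. x \<in> V \<Longrightarrow> r *\<^sub>R x \<in> V"
    using assms by (auto simp: hilbert_subspace_def scaleR_scaleC)
  show "x - y \<in> V" if "x \<in> V" "y \<in> V" for x y
    using *(3)[OF that(1) *(5)[OF that(2), of "-1"]] by simp
qed

lemma hilbert_subspace_UNIV: "hilbert_subspace UNIV"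
  by (simp add: hilbert_subspace_def)

lemma hilbert_subspace_sum:
  assumes "hilbert_subspace V" "\<And>j. j \<in> I \<Longrightarrow> f j \<in> V"
  shows "sum f I \<in> V"
  using assms(2)
  by (induction I rule: infinite_finite_induct)
    (simp_all add: hilbert_subspaceD(2)[OF assms(1)] hilbert_subspaceD(3)[OF assms(1)])

lemma bounded_op_on_compose:
  assumes "bounded_op_on V S" "bounded_op_on UNIV T"
  shows "bounded_op_on V (\<lambda>x. T (S x))"
proof -
  obtain K where K: "K > 0" "\<And>x. x \<in> V \<Longrightarrow> norm (S x) \<le> K * norm x"
    using bounded_op_on_bound[OF assms(1)] by blast
  obtain L where L: "L > 0" "\<And>x. norm (T x) \<le> L * norm x"
    using bounded_op_on_bound[OF assms(2)] by auto
  have "norm (T (S x)) \<le> (L * K) * norm x" if "x \<in> V" for x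
  proof -
    have "norm (T (S x)) \<le> L * norm (S x)" by (rule L)
    also have "\<dots> \<le> L * (K * norm x)" using L K that by (intro mult_left_mono) auto
    finally show ?thesis by simp
  qed
  then show ?thesis
    using bounded_op_onD[OF assms(1)] bounded_op_onD[OF assms(2)]
    unfolding bounded_op_on_def by auto
qed

lemma bounded_op_on_funpow:
  fixes T :: "'a::complex_hilbert \<Rightarrow> 'a"
  assumes "bounded_op_on UNIV T"
  shows "bounded_op_on UNIV (T ^^ j)"
proof (induction j)
  case 0
  show ?case by (auto simp: bounded_op_on_def intro!: exI[of _ 1])
next
  case (Suc j)
  show ?case using bounded_op_on_compose[OF Suc assms] by (simp add: comp_def)
qed

text \<open>
  The representing vector minimizes \<open>\<parallel>v\<parallel>\<^sup>2 - 2 Re f(v)\<close> over \<open>V\<close>. By the parallelogram identity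
  every minimizing sequence is Cauchy, and the vanishing of the first variation at the minimum
  says that the real part of \<open>f\<close> is the real inner product with the minimizer.
\<close>

theorem riesz_representation:
  assumes V: "hilbert_subspace V" and f: "bounded_op_on V (f :: 'a::complex_hilbert \<Rightarrow> complex)"
  obtains v where "v \<in> V" "\<And>u. u \<in> V \<Longrightarrow> f u = cinner u v"
proof -
  note [simp] = hilbert_subspaceD(2-)[OF V]
  obtain K where K: "K > 0" "\<And>x. x \<in> V \<Longrightarrow> norm (f x) \<le> K * norm x"
    using bounded_op_on_bound[OF f] by blast
  define J where "J v = (norm v)\<^sup>2 - 2 * Re (f v)" for v
  have fadd: "f (x + y) = f x + f y" if "x \<in> V" "y \<in> V" for x y
    using bounded_op_onD(1)[OF f that] .
  have fR: "f (r *\<^sub>R x) = r *\<^sub>R f x" if "x \<in> V" for x r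
    using bounded_op_onD(2)[OF f that] by (simp add: scaleR_scaleC scaleC_complex_def)
  have fdiff: "f (x - y) = f x - f y" if "x \<in> V" "y \<in> V" for x y
    using fadd[of "x - y" y] that by simp
  have lower: "J v \<ge> - K\<^sup>2" if "v \<in> V" for v
  proof -
    have "Re (f v) \<le> K * norm v"
      using K(2)[OF that] complex_Re_le_cmod order_trans by blast
    moreover have "(norm v)\<^sup>2 - 2 * (K * norm v) + K\<^sup>2 = (norm v - K)\<^sup>2"
      by (simp add: power2_eq_square algebra_simps)
    ultimately show ?thesis
      unfolding J_def using zero_le_power2[of "norm v - K"] by linarith
  qed
  define m where "m = Inf (J ` V)"
  have bdd: "bdd_below (J ` V)"
    using lower by (auto intro!: bdd_belowI[of _ "- K\<^sup>2"])
  have m_le: "m \<le> J v" if "v \<in> V" for v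
    unfolding m_def using bdd that by (auto intro: cInf_lower)
  have "\<exists>v\<in>V. J v < m + inverse (real (Suc k))" for k
  proof -
    have "m < m + inverse (real (Suc k))" by simp
    moreover have "J ` V \<noteq> {}" using hilbert_subspaceD(2)[OF V] by blast
    ultimately show ?thesis
      unfolding m_def using cInf_less_iff[OF _ bdd] by (metis (no_types, lifting) imageE)
  qed
  then obtain v where vV: "\<And>k. v k \<in> V" and vJ: "\<And>k. J (v k) < m + inverse (real (Suc k))"
    by metis
  \<comment> \<open>The midpoint of \<open>x\<close> and \<open>y\<close> also lies in \<open>V\<close>, so \<open>J\<close> is at least \<open>m\<close> there.\<close>
  have par: "(norm (x - y))\<^sup>2 \<le> 2 * (J x - m) + 2 * (J y - m)" if "x \<in> V" "y \<in> V" for x y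
  proof -
    define w where "w = (1/2) *\<^sub>R (x + y)"
    have "w \<in> V" using that by (simp add: w_def)
    have "Re (f w) = (Re (f x) + Re (f y)) / 2"
      using that by (simp add: w_def fR fadd)
    moreover have "4 * (norm w)\<^sup>2 + (norm (x - y))\<^sup>2 = 2 * (norm x)\<^sup>2 + 2 * (norm y)\<^sup>2"
      by (simp add: w_def power2_norm_eq_inner inner_diff inner_add inner_commute algebra_simps)
    ultimately show ?thesis
      using m_le[OF \<open>w \<in> V\<close>] unfolding J_def by argo
  qed
  have "Cauchy v"
  proof (rule CauchyI)
    fix e :: real assume "e > 0"
    obtain N where N: "inverse (real (Suc N)) < e\<^sup>2 / 4"
      using reals_Archimedean[of "e\<^sup>2 / 4"] \<open>e > 0\<close> by auto
    have "norm (v p - v q) < e" if "p \<ge> N" "q \<ge> N" for p q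
    proof -
      have "inverse (real (Suc p)) \<le> inverse (real (Suc N))"
        "inverse (real (Suc q)) \<le> inverse (real (Suc N))"
        using that by (auto intro!: le_imp_inverse_le)
      then have "(norm (v p - v q))\<^sup>2 < e\<^sup>2"
        using par[OF vV vV, of p q] vJ[of p] vJ[of q] N by argo
      then show ?thesis
        using \<open>e > 0\<close> by (simp add: power2_less_imp_less)
    qed
    then show "\<exists>M. \<forall>p\<ge>M. \<forall>q\<ge>M. norm (v p - v q) < e" by blast
  qed
  then obtain v0 where lim: "v \<longlonglongrightarrow> v0"
    using Cauchy_convergent convergent_def by blast
  have v0: "v0 \<in> V"
    using hilbert_subspaceD(1)[OF V] vV lim closed_sequentially by blast
  have "(\<lambda>k. f (v k) - f v0) \<longlonglongrightarrow> 0"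
  proof (rule Lim_null_comparison)
    show "\<forall>\<^sub>F k in sequentially. norm (f (v k) - f v0) \<le> K * norm (v k - v0)"
      using K(2)[of "v _ - v0"] by (simp add: vV v0 fdiff)
    show "(\<lambda>k. K * norm (v k - v0)) \<longlonglongrightarrow> 0"
      by (intro tendsto_mult_right_zero tendsto_norm_zero LIM_zero lim)
  qed
  then have "(\<lambda>k. f (v k)) \<longlonglongrightarrow> f v0"
    by (rule LIM_zero_cancel)
  then have "(\<lambda>k. J (v k)) \<longlonglongrightarrow> J v0"
    unfolding J_def by (intro tendsto_diff tendsto_power tendsto_norm lim tendsto_mult_left tendsto_Re)
  moreover have "(\<lambda>k. m + inverse (real (Suc k))) \<longlonglongrightarrow> m + 0"
    by (intro tendsto_intros LIMSEQ_inverse_real_of_nat)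
  ultimately have "J v0 \<le> m + 0"
    by (rule LIMSEQ_le) (use vJ less_imp_le in blast)
  then have Jv0: "J v0 \<le> m" by simp
  have re: "inner u v0 = Re (f u)" if "u \<in> V" for u
  proof -
    define d where "d = inner u v0 - Re (f u)"
    have quad: "0 \<le> 2 * t * d + t\<^sup>2 * (norm u)\<^sup>2" for t
    proof -
      have "J v0 \<le> J (v0 + t *\<^sub>R u)"
        using Jv0 m_le[of "v0 + t *\<^sub>R u"] that v0 by simp
      then show ?thesis
        using that v0 unfolding J_def power2_norm_eq_inner
        by (simp add: d_def fadd fR inner_add inner_commute algebra_simps power2_eq_square)
    qed
    show ?thesis
    proof (cases "u = 0")
      case True
      then show ?thesis using fR[of 0 0] by simp
    next
      case False
      \<comment> \<open>\<open>t = - d / \<parallel>u\<parallel>\<^sup>2\<close> minimizes the quadratic.\<close>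
      have "0 \<le> 2 * (- d / (norm u)\<^sup>2) * d + (- d / (norm u)\<^sup>2)\<^sup>2 * (norm u)\<^sup>2"
        by (rule quad)
      also have "\<dots> = - (d\<^sup>2 / (norm u)\<^sup>2)"
        using False by (simp add: power2_eq_square field_simps)
      finally have "d = 0"
        using False by (simp add: divide_le_0_iff)
      then show ?thesis by (simp add: d_def)
    qed
  qed
  have "f u = cinner u v0" if "u \<in> V" for u
  proof (rule complex_eqI)
    show "Re (f u) = Re (cinner u v0)"
      using re[OF that] by (simp add: inner_eq_Re_cinner)
    have "Re (cinner (\<i> *\<^sub>C u) v0) = Re (f (\<i> *\<^sub>C u))"
      using re[of "\<i> *\<^sub>C u"] that by (simp add: inner_eq_Re_cinner)
    then show "Im (f u) = Im (cinner u v0)"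
      using bounded_op_onD(2)[OF f that] by (simp add: cinner_scaleC_left scaleC_complex_def)
  qed
  then show ?thesis
    using that v0 by blast
qed

lemma adj_on_eqI:
  assumes V: "hilbert_subspace V" and "v \<in> V" "\<And>u. u \<in> V \<Longrightarrow> cinner (T u) y = cinner u v"
  shows "adj_on V T y = v"
  unfolding adj_on_def
proof (rule the_equality)
  fix w assume w: "w \<in> V \<and> (\<forall>u\<in>V. cinner (T u) y = cinner u w)"
  then have "cinner (w - v) (w - v) = 0"
    using assms hilbert_subspaceD(6)[OF V] by (metis cinner.diff_right eq_iff_diff_eq_0)
  then show "w = v" by (simp add: cinner_self)
qed (use assms in auto)

lemma
  assumes V: "hilbert_subspace V" and T: "bounded_op_on V T"
  shows adj_on_in: "adj_on V T y \<in> V"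
    and cinner_adj_on: "\<And>u. u \<in> V \<Longrightarrow> cinner u (adj_on V T y) = cinner (T u) y"
proof -
  obtain K where K: "K > 0" "\<And>x. x \<in> V \<Longrightarrow> norm (T x) \<le> K * norm x"
    using bounded_op_on_bound[OF T] by blast
  have "norm (cinner (T u) y) \<le> (K * norm y) * norm u" if "u \<in> V" for u
  proof -
    have "norm (cinner (T u) y) \<le> norm (T u) * norm y" by (rule norm_cinner_le)
    also have "\<dots> \<le> (K * norm u) * norm y" using K(2)[OF that] by (intro mult_right_mono) auto
    finally show ?thesis by (simp add: algebra_simps)
  qed
  then have "bounded_op_on V (\<lambda>u. cinner (T u) y)"
    unfolding bounded_op_on_def
    using bounded_op_onD[OF T]
    by (auto simp: cinner_add_left cinner_scaleC_left scaleC_complex_def)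
  then obtain v where v: "v \<in> V" "\<And>u. u \<in> V \<Longrightarrow> cinner (T u) y = cinner u v"
    using riesz_representation[OF V] by blast
  then have "adj_on V T y = v"
    by (rule adj_on_eqI[OF V])
  with v show "adj_on V T y \<in> V" "\<And>u. u \<in> V \<Longrightarrow> cinner u (adj_on V T y) = cinner (T u) y"
    by simp_all
qed

lemma cinner_adj_left:
  assumes "bounded_op_on UNIV T"
  shows "cinner (adj T y) x = cinner y (T x)"
  using cinner_adj_on[OF hilbert_subspace_UNIV assms, of x y]
  by (metis UNIV_I cinner_commute)

section \<open>Positive invertible operators\<close>

text \<open>
  The form need not be definite, so the minimizer \<open>t = - b / a\<close> of the usual argument is replaced by
  the homogeneous choice \<open>(s, t) = (b, - a)\<close>, and \<open>a = 0\<close> is treated apart.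
\<close>

lemma positive_form_cauchy_schwarz:
  fixes Q :: "'a::real_inner \<Rightarrow> 'a"
  assumes "linear Q" and sym: "\<And>x y. inner (Q x) y = inner x (Q y)"
    and pos: "\<And>x. 0 \<le> inner (Q x) x"
  shows "(inner (Q x) y)\<^sup>2 \<le> inner (Q x) x * inner (Q y) y"
proof -
  interpret linear Q by fact
  define a b c where "a = inner (Q x) x" and "b = inner (Q x) y" and "c = inner (Q y) y"
  have quad: "0 \<le> a * s\<^sup>2 + 2 * b * s * t + c * t\<^sup>2" for s t
    using pos[of "s *\<^sub>R x + t *\<^sub>R y"] sym[of y x]
    by (simp add: a_def b_def c_def add scaleR inner_add algebra_simps power2_eq_square inner_commute)
  have "a \<ge> 0" "c \<ge> 0" by (auto simp: a_def c_def pos)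
  have "b\<^sup>2 \<le> a * c"
  proof (cases "a = 0")
    case True
    have "b = 0"
    proof (rule ccontr)
      assume "b \<noteq> 0"
      then show False
        using quad[of "- (c + 1) / (2 * b)" 1] True by simp
    qed
    then show ?thesis using True by simp
  next
    case False
    have "0 \<le> a * b\<^sup>2 + 2 * b * b * (- a) + c * (- a)\<^sup>2"
      using quad[of b "-a"] by simp
    also have "\<dots> = a * (a * c - b\<^sup>2)" by (simp add: power2_eq_square algebra_simps)
    finally show ?thesis
      using False \<open>a \<ge> 0\<close> by (simp add: zero_le_mult_iff)
  qed
  then show ?thesis by (simp add: a_def b_def c_def)
qed

text \<open>Cauchy--Schwarz for the form of \<open>Q\<close>, applied to \<open>x\<close> and \<open>Q x\<close>.\<close>

lemma positive_operator_norm_square_le: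
  fixes Q :: "'a::real_inner \<Rightarrow> 'a"
  assumes "linear Q" and sym: "\<And>x y. inner (Q x) y = inner x (Q y)"
    and pos: "\<And>x. 0 \<le> inner (Q x) x" and le: "\<And>x. inner (Q x) x \<le> q * (norm x)\<^sup>2"
  shows "(norm (Q x))\<^sup>2 \<le> q * inner (Q x) x"
proof (cases "Q x = 0")
  case False
  have "((norm (Q x))\<^sup>2)\<^sup>2 \<le> inner (Q x) x * inner (Q (Q x)) (Q x)"
    using positive_form_cauchy_schwarz[OF assms(1-3), of x "Q x"] by (simp add: power2_norm_eq_inner)
  also have "\<dots> \<le> inner (Q x) x * (q * (norm (Q x))\<^sup>2)"
    by (intro mult_left_mono le pos)
  finally have "(norm (Q x))\<^sup>2 * (norm (Q x))\<^sup>2 \<le> (q * inner (Q x) x) * (norm (Q x))\<^sup>2"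
    by (simp add: power2_eq_square algebra_simps)
  then show ?thesis
    using False by (metis mult_le_cancel_right_pos zero_less_norm_iff zero_less_power2 norm_eq_zero)
qed simp

lemma positive_operator_norm_le:
  fixes Q :: "'a::real_inner \<Rightarrow> 'a"
  assumes "linear Q" and sym: "\<And>x y. inner (Q x) y = inner x (Q y)"
    and pos: "\<And>x. 0 \<le> inner (Q x) x" and le: "\<And>x. inner (Q x) x \<le> q * (norm x)\<^sup>2"
    and "q \<ge> 0"
  shows "norm (Q x) \<le> q * norm x"
proof (rule power2_le_imp_le)
  have "(norm (Q x))\<^sup>2 \<le> q * inner (Q x) x"
    by (rule positive_operator_norm_square_le[OF assms(1-4)])
  also have "\<dots> \<le> q * (q * (norm x)\<^sup>2)"
    by (intro mult_left_mono le \<open>q \<ge> 0\<close>)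
  finally show "(norm (Q x))\<^sup>2 \<le> (q * norm x)\<^sup>2"
    by (simp add: power2_eq_square algebra_simps)
qed (use assms in simp)

definition positive_definite :: "('a::complex_hilbert \<Rightarrow> 'a) \<Rightarrow> bool" where
  "positive_definite P \<longleftrightarrow> bounded_op_on UNIV P \<and> (\<forall>x y. cinner (P x) y = cinner x (P y)) \<and>
     (\<exists>\<epsilon>>0. \<forall>x. \<epsilon> * (norm x)\<^sup>2 \<le> Re (cinner (P x) x))"

text \<open>
  If \<open>\<epsilon> \<le> P \<le> K\<close>, then \<open>1 - P / K\<close> lies between \<open>0\<close> and \<open>1 - \<epsilon> / K\<close>, hence is a strict
  contraction.
\<close>

lemma positive_definite_contraction:
  assumes P: "positive_definite P"
  obtains K q where "K > 0" "0 \<le> q" "q < 1" "\<And>x. norm (x - (1 / K) *\<^sub>R P x) \<le> q * norm x"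
proof -
  have Pb: "bounded_op_on UNIV P" and sym: "\<And>x y. cinner (P x) y = cinner x (P y)"
    using P by (auto simp: positive_definite_def)
  obtain \<epsilon> where \<epsilon>: "\<epsilon> > 0" "\<And>x. \<epsilon> * (norm x)\<^sup>2 \<le> inner (P x) x"
    using P by (auto simp: positive_definite_def inner_eq_Re_cinner)
  interpret P: bounded_linear P by (rule bounded_op_on_UNIV_bounded_linear[OF Pb])
  obtain K0 where K0: "K0 > 0" "\<And>x. norm (P x) \<le> K0 * norm x"
    using bounded_op_on_bound[OF Pb] by auto
  \<comment> \<open>Enlarging the bound by \<open>\<epsilon>\<close> guarantees \<open>\<epsilon> \<le> K\<close>, also on the zero space.\<close>
  define K where "K = K0 + \<epsilon>"
  have K: "K > 0" "\<epsilon> \<le> K" using K0 \<epsilon> by (auto simp: K_def)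
  have up: "inner (P x) x \<le> K * (norm x)\<^sup>2" for x
  proof -
    have "inner (P x) x \<le> norm (P x) * norm x" by (rule norm_cauchy_schwarz)
    also have "\<dots> \<le> (K0 * norm x) * norm x" by (intro mult_right_mono K0) simp
    also have "\<dots> \<le> K * (norm x)\<^sup>2" using \<epsilon> by (simp add: K_def power2_eq_square algebra_simps)
    finally show ?thesis .
  qed
  define Q where "Q x = x - (1 / K) *\<^sub>R P x" for x
  have "linear Q"
    by (rule linearI) (simp_all add: Q_def P.add P.scaleR algebra_simps)
  moreover have "inner (Q x) y = inner x (Q y)" for x y
    using sym[of x y] by (simp add: Q_def inner_diff) (simp add: inner_eq_Re_cinner)
  moreover have eq: "inner (Q x) x = (norm x)\<^sup>2 - inner (P x) x / K" for x
    by (simp add: Q_def inner_diff power2_norm_eq_inner)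
  moreover have "0 \<le> inner (Q x) x" for x
    using up[of x] K by (simp add: eq field_simps)
  moreover have "inner (Q x) x \<le> (1 - \<epsilon> / K) * (norm x)\<^sup>2" for x
    using \<epsilon>(2)[of x] K by (simp add: eq field_simps)
  ultimately have "norm (Q x) \<le> (1 - \<epsilon> / K) * norm x" for x
    using K by (intro positive_operator_norm_le) auto
  then show ?thesis
    using K \<epsilon> by (intro that[of K "1 - \<epsilon> / K"]) (auto simp: Q_def)
qed

text \<open>The equation \<open>P x = y\<close> is the fixed point equation \<open>x = (1 - P / K) x + y / K\<close>.\<close>

lemma positive_definite_bij:
  assumes P: "positive_definite P"
  shows "bij P"
proof (rule bijI)
  have Pb: "bounded_op_on UNIV P"
    using P by (auto simp: positive_definite_def)
  interpret P: bounded_linear P by (rule bounded_op_on_UNIV_bounded_linear[OF Pb])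
  obtain K q where K: "K > 0" and q: "0 \<le> q" "q < 1"
    and contr: "\<And>x. norm (x - (1 / K) *\<^sub>R P x) \<le> q * norm x"
    using positive_definite_contraction[OF P] by blast
  show "inj P"
  proof (rule injI)
    fix x y assume "P x = P y"
    then have "norm (x - y) \<le> q * norm (x - y)"
      using contr[of "x - y"] by (simp add: P.diff)
    then show "x = y"
      using q by (smt (verit) mult_le_cancel_right1 norm_ge_zero norm_eq_zero eq_iff_diff_eq_0)
  qed
  show "surj P"
  proof (rule surjI[of P "\<lambda>y. SOME x. P x = y"])
    fix y
    have "\<exists>!x\<in>UNIV. x - (1 / K) *\<^sub>R P x + (1 / K) *\<^sub>R y = x"
    proof (rule Banach_fix[OF complete_UNIV _ q])
      show "dist (u - (1 / K) *\<^sub>R P u + (1 / K) *\<^sub>R y)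
          (v - (1 / K) *\<^sub>R P v + (1 / K) *\<^sub>R y) \<le> q * dist u v" for u v
      proof -
        have "dist (u - (1 / K) *\<^sub>R P u + (1 / K) *\<^sub>R y) (v - (1 / K) *\<^sub>R P v + (1 / K) *\<^sub>R y)
          = norm ((u - v) - (1 / K) *\<^sub>R P (u - v))"
          by (simp add: dist_norm P.diff algebra_simps)
        then show "dist (u - (1 / K) *\<^sub>R P u + (1 / K) *\<^sub>R y) (v - (1 / K) *\<^sub>R P v + (1 / K) *\<^sub>R y)
          \<le> q * dist u v"
          using contr[of "u - v"] by (simp add: dist_norm)
      qed
    qed auto
    then obtain x where "x - (1 / K) *\<^sub>R P x + (1 / K) *\<^sub>R y = x" by blast
    then have "(1 / K) *\<^sub>R P x = (1 / K) *\<^sub>R y" by (auto simp: diff_add_eq diff_eq_eq)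
    then have "P x = y" using K by (metis scaleR_cancel_left divide_eq_0_iff less_irrefl zero_neq_one)
    then show "P (SOME x. P x = y) = y" by (rule someI)
  qed
qed

text \<open>
  With \<open>Q = 1 - P / K\<close>, the operator \<open>1 - Y\<close> squares to \<open>1 - Q\<close> as soon as \<open>Y = (Q + Y\<^sup>2) / 2\<close>.
  If \<open>\<parallel>Q\<parallel> \<le> q < 1\<close>, the right-hand side is a strict contraction of the ball of radius
  \<open>1 - sqrt (1 - q)\<close>, the smaller root of \<open>r = (q + r\<^sup>2) / 2\<close>; it preserves the closed set of
  symmetric complex-linear operators.
\<close>

theorem positive_definite_square_root:
  assumes P: "positive_definite (P :: 'a::complex_hilbert \<Rightarrow> 'a)"
  obtains L where "bounded_op_on UNIV L" "\<And>x y. cinner (L x) y = cinner x (L y)"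
    "\<And>x. L (L x) = P x"
proof -
  have Pb: "bounded_op_on UNIV P" and Psym: "\<And>x y. cinner (P x) y = cinner x (P y)"
    using P by (auto simp: positive_definite_def)
  interpret P: bounded_linear P by (rule bounded_op_on_UNIV_bounded_linear[OF Pb])
  obtain K q where K: "K > 0" and q: "0 \<le> q" "q < 1"
    and contr: "\<And>x. norm (x - (1 / K) *\<^sub>R P x) \<le> q * norm x"
    using positive_definite_contraction[OF P] by blast
  define r where "r = 1 - sqrt (1 - q)"
  have r: "0 \<le> r" "r < 1" "(q + r\<^sup>2) / 2 = r"
    using q by (auto simp: r_def power2_eq_square field_simps)
  define Q where "Q = Blinfun (\<lambda>x. x - (1 / K) *\<^sub>R P x)"
  have Q: "blinfun_apply Q x = x - (1 / K) *\<^sub>R P x" for x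
    unfolding Q_def
    by (subst bounded_linear_Blinfun_apply)
      (auto intro!: bounded_linear_sub bounded_linear_ident bounded_linear_const_scaleR
        P.bounded_linear_axioms)
  have Qnorm: "norm Q \<le> q"
    using contr q by (intro norm_blinfun_bound) (auto simp: Q)
  define \<S> :: "('a \<Rightarrow>\<^sub>L 'a) set" where
    "\<S> = cball 0 r \<inter> (\<Inter>x. \<Inter>y. {Y. cinner (blinfun_apply Y x) y = cinner x (blinfun_apply Y y)})
       \<inter> (\<Inter>a. \<Inter>x. {Y. blinfun_apply Y (a *\<^sub>C x) = a *\<^sub>C blinfun_apply Y x})"
  define \<Phi> where "\<Phi> Y = (1/2) *\<^sub>R (Q + (Y o\<^sub>L Y))" for Y
  have "closed \<S>"
    unfolding \<S>_def
    by (intro closed_Int closed_INT ballI closed_cball closed_Collect_eq continuous_intros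
        scaleC.continuous_on cinner.continuous_on)
  then have "complete \<S>" by (simp add: complete_eq_closed)
  moreover have "\<S> \<noteq> {}"
  proof -
    have "0 \<in> \<S>" using r by (simp add: \<S>_def cinner.zero_left cinner.zero_right scaleC.zero_right)
    then show ?thesis by blast
  qed
  moreover have "\<Phi> ` \<S> \<subseteq> \<S>"
  proof (rule image_subsetI)
    fix Y assume Y: "Y \<in> \<S>"
    then have "norm Y \<le> r" by (simp add: \<S>_def)
    then have "norm (Y o\<^sub>L Y) \<le> r\<^sup>2"
      using norm_blinfun_compose[of Y Y] mult_mono[of "norm Y" r "norm Y" r] r
      by (simp add: power2_eq_square)
    then have "norm (\<Phi> Y) \<le> r"
      using r(3) Qnorm norm_triangle_ineq[of Q "Y o\<^sub>L Y"] by (simp add: \<Phi>_def)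
    moreover have "cinner (blinfun_apply (\<Phi> Y) x) y = cinner x (blinfun_apply (\<Phi> Y) y)" for x y
      using Y Psym[of x y]
      by (simp add: \<S>_def \<Phi>_def Q blinfun.scaleR_left blinfun.add_left cinner.scaleR_left
          cinner.scaleR_right cinner.add_left cinner.add_right cinner.diff_left cinner.diff_right)
    moreover have "blinfun_apply (\<Phi> Y) (a *\<^sub>C x) = a *\<^sub>C blinfun_apply (\<Phi> Y) x" for a x
      using Y bounded_op_onD(2)[OF Pb, of x a]
      by (simp add: \<S>_def \<Phi>_def Q blinfun.scaleR_left blinfun.add_left scaleC.scaleR_right
          scaleC.add_right scaleC.diff_right)
    ultimately show "\<Phi> Y \<in> \<S>" by (simp add: \<S>_def)
  qed
  moreover have "dist (\<Phi> Y) (\<Phi> Z) \<le> r * dist Y Z" if "Y \<in> \<S>" "Z \<in> \<S>" for Y Z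
  proof -
    have YZ: "norm Y \<le> r" "norm Z \<le> r" using that by (auto simp: \<S>_def)
    have "\<Phi> Y - \<Phi> Z = (1/2) *\<^sub>R ((Y o\<^sub>L (Y - Z)) + ((Y - Z) o\<^sub>L Z))"
      by (rule blinfun_eqI)
        (simp add: \<Phi>_def blinfun.add_left blinfun.diff_left blinfun.scaleR_left blinfun.diff_right
          algebra_simps)
    then have "norm (\<Phi> Y - \<Phi> Z) \<le> (norm (Y o\<^sub>L (Y - Z)) + norm ((Y - Z) o\<^sub>L Z)) / 2"
      using norm_triangle_ineq[of "Y o\<^sub>L (Y - Z)" "(Y - Z) o\<^sub>L Z"] by simp
    also have "\<dots> \<le> (norm Y * norm (Y - Z) + norm (Y - Z) * norm Z) / 2"
      by (intro divide_right_mono add_mono norm_blinfun_compose) auto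
    also have "\<dots> \<le> (r * norm (Y - Z) + norm (Y - Z) * r) / 2"
      using YZ by (intro divide_right_mono add_mono mult_right_mono mult_left_mono) auto
    finally show "dist (\<Phi> Y) (\<Phi> Z) \<le> r * dist Y Z"
      by (simp add: dist_norm algebra_simps)
  qed
  ultimately have "\<exists>!Y\<in>\<S>. \<Phi> Y = Y"
    by (intro Banach_fix[OF _ _ r(1,2)]) auto
  then obtain Y where Y: "Y \<in> \<S>" and fixpoint: "\<Phi> Y = Y" by blast
  have Ysym: "cinner (blinfun_apply Y x) y = cinner x (blinfun_apply Y y)" 
    and Ylin: "blinfun_apply Y (a *\<^sub>C x) = a *\<^sub>C blinfun_apply Y x" for x y a
    using Y by (auto simp: \<S>_def)
  have YY: "Q x + Y (Y x) = 2 *\<^sub>R Y x" for x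
    using arg_cong[OF fixpoint, of "\<lambda>Z. 2 *\<^sub>R blinfun_apply Z x"]
    by (simp add: \<Phi>_def blinfun.add_left blinfun.scaleR_left)
  define L where "L x = sqrt K *\<^sub>R (x - Y x)" for x
  have "norm (L x) \<le> (sqrt K * (1 + norm Y)) * norm x" for x
  proof -
    have "norm (x - Y x) \<le> norm x + norm Y * norm x"
      using norm_triangle_ineq4[of x "Y x"] norm_blinfun[of Y x] by linarith
    then have "sqrt K * norm (x - Y x) \<le> sqrt K * (norm x + norm Y * norm x)"
      using K by (intro mult_left_mono) auto
    then show ?thesis
      using K by (simp add: L_def distrib_left distrib_right mult.assoc)
  qed
  moreover have "L (x + y) = L x + L y" "L (a *\<^sub>C x) = a *\<^sub>C L x" for x y a
    by (simp_all add: L_def blinfun.add_right Ylin scaleC.scaleR_right scaleC.diff_right scaleR_right_diff_distrib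
        scaleR_right_distrib)
  ultimately have "bounded_op_on UNIV L"
    unfolding bounded_op_on_def by blast
  moreover have "cinner (L x) y = cinner x (L y)" for x y
    by (simp add: L_def cinner.scaleR_left cinner.scaleR_right cinner.diff_left cinner.diff_right Ysym)
  moreover have "L (L x) = P x" for x
  proof -
    have "L (L x) = K *\<^sub>R (x - (2 *\<^sub>R Y x - Y (Y x)))"
      using K by (simp add: L_def blinfun.scaleR_right blinfun.diff_right scaleR_2
          flip: scaleR_right_diff_distrib)
    also have "\<dots> = K *\<^sub>R (x - Q x)"
      by (metis YY add_diff_cancel_right')
    also have "\<dots> = P x"
      using K by (simp add: Q)
    finally show ?thesis .
  qed
  ultimately show ?thesis by (rule that)
qed

section \<open>Weighted square-summable sequences\<close>

lemma complex_power_series_eq_zero: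
  fixes a :: "nat \<Rightarrow> complex"
  assumes "\<And>z. norm z < 1 \<Longrightarrow> (\<lambda>j. a j * z ^ j) sums 0"
  shows "a j = 0"
proof -
  have "summable (\<lambda>j. a j * (1/2) ^ j)"
    using assms[of "1/2"] by (simp add: sums_iff)
  then have "conv_radius a \<ge> ereal (1/2)"
    using conv_radius_geI[of a "1/2"] by simp
  then have rad: "fps_conv_radius (Abs_fps a) > 0"
    using less_le_trans[of 0 "ereal (1/2)" "conv_radius a"] by (simp add: fps_conv_radius_def)
  have "eventually (\<lambda>z. eval_fps (Abs_fps a) z = eval_fps 0 z) (nhds 0)"
    unfolding eventually_nhds_metric
    using assms by (intro exI[of _ 1]) (auto simp: eval_fps_def sums_iff)
  then have "Abs_fps a = 0"
    using rad by (intro eval_fps_eqD) auto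
  then show ?thesis
    by (metis fps_nth_Abs_fps fps_zero_nth)
qed

text \<open>Pairing with a fixed vector reduces the uniqueness of coefficients to scalar power series.\<close>

lemma taylor_eqI:
  assumes "\<And>z. norm z < 1 \<Longrightarrow> (\<lambda>j. z ^ j *\<^sub>C a j) sums f z"
  shows "taylor f = a"
  unfolding taylor_def
proof (rule the_equality)
  fix b assume b: "\<forall>z. norm z < 1 \<longrightarrow> (\<lambda>j. z ^ j *\<^sub>C b j) sums f z"
  show "b = a"
  proof
    fix j
    have "cinner (b j - a j) y = 0" for y
    proof (rule complex_power_series_eq_zero[of "\<lambda>j. cinner (b j - a j) y"])
      fix z :: complex assume z: "norm z < 1"
      have "(\<lambda>j. z ^ j *\<^sub>C b j - z ^ j *\<^sub>C a j) sums (f z - f z)"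
        using assms[OF z] b z by (intro sums_diff) auto
      then have "(\<lambda>j. cinner (z ^ j *\<^sub>C b j - z ^ j *\<^sub>C a j) y) sums cinner 0 y"
        using bounded_linear.sums[OF cinner.bounded_linear_left] by fastforce
      then show "(\<lambda>j. cinner (b j - a j) y * z ^ j) sums 0"
        by (simp add: scaleC.diff_right[symmetric] cinner_scaleC_left cinner.zero_left mult.commute)
    qed
    then have "b j - a j = 0"
      by (metis cinner.zero_left cinner_extensionality)
    then show "b j = a j" by simp
  qed
qed (use assms in auto)

lemma cauchy_schwarz_series:
  fixes p q :: "nat \<Rightarrow> real"
  assumes p: "summable (\<lambda>j. (p j)\<^sup>2)" and q: "summable (\<lambda>j. (q j)\<^sup>2)"
  shows "summable (\<lambda>j. \<bar>p j\<bar> * \<bar>q j\<bar>)"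
    and "(\<Sum>j. \<bar>p j\<bar> * \<bar>q j\<bar>) \<le> sqrt (\<Sum>j. (p j)\<^sup>2) * sqrt (\<Sum>j. (q j)\<^sup>2)"
proof -
  have *: "(\<Sum>j<N. \<bar>p j\<bar> * \<bar>q j\<bar>) \<le> sqrt (\<Sum>j. (p j)\<^sup>2) * sqrt (\<Sum>j. (q j)\<^sup>2)" for N
  proof -
    have "(\<Sum>j<N. \<bar>p j\<bar> * \<bar>q j\<bar>) \<le> L2_set p {..<N} * L2_set q {..<N}"
      by (rule L2_set_mult_ineq)
    also have "\<dots> \<le> sqrt (\<Sum>j. (p j)\<^sup>2) * sqrt (\<Sum>j. (q j)\<^sup>2)"
      unfolding L2_set_def
      by (intro mult_mono real_sqrt_le_mono sum_le_suminf p q) (auto intro!: suminf_nonneg p sum_nonneg)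
    finally show ?thesis .
  qed
  show "summable (\<lambda>j. \<bar>p j\<bar> * \<bar>q j\<bar>)"
    by (rule summableI_nonneg_bounded[OF _ *]) simp
  then show "(\<Sum>j. \<bar>p j\<bar> * \<bar>q j\<bar>) \<le> sqrt (\<Sum>j. (p j)\<^sup>2) * sqrt (\<Sum>j. (q j)\<^sup>2)"
    using * by (rule suminf_le_const)
qed

text \<open>The coefficient of \<open>t\<^sup>j\<close> in \<open>(1 - t)\<^sup>-\<^sup>n\<close>.\<close>

definition binom :: "nat \<Rightarrow> nat \<Rightarrow> nat" where
  "binom n j = (n + j - 1) choose j"

lemma weight_eq: "weight n j = 1 / real (binom n j)"
  by (simp add: weight_def binom_def)

lemma binom_0_right [simp]: "binom n 0 = 1"
  by (simp add: binom_def)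

lemma binom_Suc_right: "binom n (Suc j) = (n + j) choose (j + 1)"
  by (simp add: binom_def)

lemma binom_1 [simp]: "binom (Suc 0) j = 1"
  by (simp add: binom_def)

lemma binom_0_left: "binom 0 j = (if j = 0 then 1 else 0)"
  by (auto simp: binom_def binomial_eq_0)

lemma binom_pascal: "binom (Suc n) (Suc j) = binom (Suc n) j + binom n (Suc j)"
  by (simp add: binom_def)

lemma sum_binom_upper: "(\<Sum>i\<le>j. binom n i) = binom (Suc n) j"
  by (induction j) (simp_all add: binom_pascal)

text \<open>
  The coefficients of \<open>(1 - t)\<^sup>-\<^sup>1 + \<cdots> + (1 - t)\<^sup>-\<^sup>n = ((1 - t)\<^sup>-\<^sup>n - 1) / t\<close>. This is what links the sum of
  resolvent powers in the transfer function to the shifted gramian.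
\<close>

lemma sum_binom_lower: "(\<Sum>k=1..n. binom k j) = binom n (Suc j)"
proof (induction n)
  case 0
  then show ?case by (simp add: binom_0_left)
next
  case (Suc n)
  then show ?case by (simp add: binom_pascal)
qed

text \<open>The series of \<open>(1 - r)\<^sup>-\<^sup>n\<^sup>-\<^sup>1\<close> is the Cauchy product of that of \<open>(1 - r)\<^sup>-\<^sup>n\<close> with the geometric series.\<close>

lemma summable_binom_power:
  fixes r :: real
  assumes "0 \<le> r" "r < 1"
  shows "summable (\<lambda>j. real (binom n j) * r ^ j)"
proof (induction n)
  case 0
  then show ?case
    by (intro summable_finite[of "{0}"]) (auto simp: binom_0_left)
next
  case (Suc n)
  have "summable (\<lambda>k. \<Sum>i\<le>k. (real (binom n i) * r ^ i) * r ^ (k - i))"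
    using Suc assms by (intro summable_Cauchy_product) (auto simp: abs_mult summable_geometric)
  moreover have "(\<Sum>i\<le>k. (real (binom n i) * r ^ i) * r ^ (k - i)) = real (binom (Suc n) k) * r ^ k" for k
    by (simp add: sum_binom_upper[symmetric] sum_distrib_right mult.assoc flip: power_add)
  ultimately show ?case by simp
qed

definition sq_summable :: "nat \<Rightarrow> (nat \<Rightarrow> 'y::complex_hilbert) \<Rightarrow> bool" where
  "sq_summable n a \<longleftrightarrow> summable (\<lambda>j. weight n j * (norm (a j))\<^sup>2)"

definition seq_norm :: "nat \<Rightarrow> (nat \<Rightarrow> 'y::complex_hilbert) \<Rightarrow> real" where
  "seq_norm n a = sqrt (\<Sum>j. weight n j * (norm (a j))\<^sup>2)"

definition seq_inner :: "nat \<Rightarrow> (nat \<Rightarrow> 'y::complex_hilbert) \<Rightarrow> (nat \<Rightarrow> 'y) \<Rightarrow> complex" where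
  "seq_inner n a b = (\<Sum>j. complex_of_real (weight n j) * cinner (a j) (b j))"

abbreviation seq_shift :: "(nat \<Rightarrow> 'y::complex_hilbert) \<Rightarrow> nat \<Rightarrow> 'y" where
  "seq_shift a \<equiv> case_nat 0 a"

locale bergman_index =
  fixes n :: nat
  assumes n_ge_1: "n \<ge> 1"
begin

lemma binom_pos [simp]: "binom n j > 0"
  using n_ge_1 by (simp add: binom_def)

lemma weight_pos [simp]: "weight n j > 0" "weight n j \<ge> 0" "weight n j \<noteq> 0"
  using binom_pos[of j] by (simp_all add: weight_eq del: binom_pos)

lemma weight_binom [simp]: "weight n j * real (binom n j) = 1"
  using binom_pos[of j] by (simp add: weight_eq del: binom_pos)

lemma binom_Suc_le: "binom n (Suc j) \<le> n * binom n j"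
proof -
  have "Suc (n + j - 1) * ((n + j - 1) choose j) = (Suc (n + j - 1) choose Suc j) * Suc j"
    by (rule Suc_times_binomial_eq)
  then have "Suc j * binom n (Suc j) = (n + j) * binom n j"
    using n_ge_1 by (simp add: binom_def mult.commute)
  also have "\<dots> \<le> (n * Suc j) * binom n j"
    using n_ge_1 by (intro mult_right_mono) auto
  finally have "Suc j * binom n (Suc j) \<le> Suc j * (n * binom n j)"
    by (simp add: algebra_simps)
  then show ?thesis by (metis Suc_mult_le_cancel1)
qed

lemma binom_le_Suc: "binom n j \<le> binom n (Suc j)"
  using binom_pascal[of "n - 1" j] n_ge_1 by simp

lemma weight_Suc_le: "weight n (Suc j) \<le> weight n j"
  unfolding weight_eq using binom_le_Suc[of j] by (intro divide_left_mono) auto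

lemma sq_summable_add:
  assumes "sq_summable n a" "sq_summable n b"
  shows "sq_summable n (\<lambda>j. a j + b j)"
  unfolding sq_summable_def
proof (rule summable_comparison_test')
  show "summable (\<lambda>j. 2 * (weight n j * (norm (a j))\<^sup>2) + 2 * (weight n j * (norm (b j))\<^sup>2))"
    using assms unfolding sq_summable_def by (intro summable_add summable_mult)
  fix j
  have "(norm (a j + b j))\<^sup>2 \<le> (norm (a j) + norm (b j))\<^sup>2"
    by (intro power_mono norm_triangle_ineq) simp
  also have "\<dots> \<le> 2 * (norm (a j))\<^sup>2 + 2 * (norm (b j))\<^sup>2"
    using zero_le_power2[of "norm (a j) - norm (b j)"] by (simp add: power2_eq_square algebra_simps)
  finally have "weight n j * (norm (a j + b j))\<^sup>2 \<le> weight n j * (2 * (norm (a j))\<^sup>2 + 2 * (norm (b j))\<^sup>2)"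
    by (intro mult_left_mono) auto
  then show "norm (weight n j * (norm (a j + b j))\<^sup>2)
      \<le> 2 * (weight n j * (norm (a j))\<^sup>2) + 2 * (weight n j * (norm (b j))\<^sup>2)"
    by (simp add: algebra_simps)
qed

lemma sq_summable_scaleC:
  assumes "sq_summable n a"
  shows "sq_summable n (\<lambda>j. c *\<^sub>C a j)"
  using summable_mult[OF assms[unfolded sq_summable_def], of "(norm c)\<^sup>2"]
  by (simp add: sq_summable_def norm_scaleC power_mult_distrib mult.left_commute)

lemma sq_summable_diff:
  assumes "sq_summable n a" "sq_summable n b"
  shows "sq_summable n (\<lambda>j. a j - b j)"
proof -
  have "(-1) *\<^sub>C y = - y" for y :: 'a
    using scaleC.minus_left[of 1 y] by (simp add: scaleC_one)
  then show ?thesis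
    using sq_summable_add[OF assms(1) sq_summable_scaleC[OF assms(2), of "-1"]] by simp
qed

lemma sq_summable_shift:
  assumes "sq_summable n a"
  shows "sq_summable n (seq_shift a)"
  unfolding sq_summable_def
proof (subst summable_Suc_iff[symmetric], rule summable_comparison_test')
  show "summable (\<lambda>j. weight n j * (norm (a j))\<^sup>2)"
    using assms by (simp add: sq_summable_def)
  show "norm (weight n (Suc j) * (norm (seq_shift a (Suc j)))\<^sup>2) \<le> weight n j * (norm (a j))\<^sup>2" for j
    using weight_Suc_le[of j] by (simp add: mult_right_mono)
qed

lemma
  assumes "sq_summable n a" "sq_summable n b"
  shows summable_seq_inner: "summable (\<lambda>j. complex_of_real (weight n j) * cinner (a j) (b j))"
    and norm_seq_inner_le: "norm (seq_inner n a b) \<le> seq_norm n a * seq_norm n b"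
proof -
  define p q where "p j = sqrt (weight n j) * norm (a j)" and "q j = sqrt (weight n j) * norm (b j)" for j
  have p2: "(p j)\<^sup>2 = weight n j * (norm (a j))\<^sup>2" and q2: "(q j)\<^sup>2 = weight n j * (norm (b j))\<^sup>2" for j
    by (simp_all add: p_def q_def power_mult_distrib)
  have pq: "norm (complex_of_real (weight n j) * cinner (a j) (b j)) \<le> \<bar>p j\<bar> * \<bar>q j\<bar>" for j
    using norm_cinner_le[of "a j" "b j"]
    by (simp add: p_def q_def norm_mult abs_mult mult_left_mono algebra_simps)
  have sp: "summable (\<lambda>j. (p j)\<^sup>2)" "summable (\<lambda>j. (q j)\<^sup>2)"
    using assms by (simp_all add: p2 q2 sq_summable_def)
  have s: "summable (\<lambda>j. norm (complex_of_real (weight n j) * cinner (a j) (b j)))"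
    by (rule summable_comparison_test'[OF cauchy_schwarz_series(1)[OF sp]]) (use pq in simp)
  then show "summable (\<lambda>j. complex_of_real (weight n j) * cinner (a j) (b j))"
    by (rule summable_norm_cancel)
  have "norm (seq_inner n a b) \<le> (\<Sum>j. norm (complex_of_real (weight n j) * cinner (a j) (b j)))"
    unfolding seq_inner_def by (rule summable_norm[OF s])
  also have "\<dots> \<le> (\<Sum>j. \<bar>p j\<bar> * \<bar>q j\<bar>)"
    by (intro suminf_le pq s cauchy_schwarz_series(1)[OF sp])
  also have "\<dots> \<le> seq_norm n a * seq_norm n b"
    using cauchy_schwarz_series(2)[OF sp] by (simp add: p2 q2 seq_norm_def)
  finally show "norm (seq_inner n a b) \<le> seq_norm n a * seq_norm n b" .
qed

lemma seq_norm_nonneg: "sq_summable n a \<Longrightarrow> seq_norm n a \<ge> 0"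
  by (auto simp: seq_norm_def sq_summable_def intro!: suminf_nonneg)

lemma seq_norm_square:
  assumes "sq_summable n a"
  shows "(seq_norm n a)\<^sup>2 = (\<Sum>j. weight n j * (norm (a j))\<^sup>2)"
  using assms by (auto simp: seq_norm_def sq_summable_def intro!: suminf_nonneg)

lemma seq_inner_self:
  assumes "sq_summable n a"
  shows "seq_inner n a a = complex_of_real ((seq_norm n a)\<^sup>2)"
  using suminf_of_real[OF assms[unfolded sq_summable_def], where 'a=complex]
  by (simp add: seq_norm_square[OF assms] seq_inner_def cinner_self)

lemma seq_inner_commute:
  assumes "sq_summable n a" "sq_summable n b"
  shows "seq_inner n a b = cnj (seq_inner n b a)"
proof -
  have "(\<lambda>j. cnj (complex_of_real (weight n j) * cinner (b j) (a j))) sums cnj (seq_inner n b a)"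
    unfolding seq_inner_def sums_cnj using summable_seq_inner[OF assms(2,1)] by (rule summable_sums)
  then have "(\<lambda>j. complex_of_real (weight n j) * cinner (a j) (b j)) sums cnj (seq_inner n b a)"
    by (simp flip: cinner_commute)
  then show ?thesis
    by (simp add: seq_inner_def sums_iff)
qed

lemma seq_inner_add_left:
  assumes "sq_summable n a" "sq_summable n b" "sq_summable n c"
  shows "seq_inner n (\<lambda>j. a j + b j) c = seq_inner n a c + seq_inner n b c"
  using suminf_add[OF summable_seq_inner[OF assms(1,3)] summable_seq_inner[OF assms(2,3)]]
  by (simp add: seq_inner_def cinner_add_left algebra_simps)

lemma seq_inner_diff_left:
  assumes "sq_summable n a" "sq_summable n b" "sq_summable n c"
  shows "seq_inner n (\<lambda>j. a j - b j) c = seq_inner n a c - seq_inner n b c"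
  using suminf_diff[OF summable_seq_inner[OF assms(1,3)] summable_seq_inner[OF assms(2,3)]]
  by (simp add: seq_inner_def cinner.diff_left algebra_simps)

lemma seq_inner_scaleC_left:
  assumes "sq_summable n a" "sq_summable n c"
  shows "seq_inner n (\<lambda>j. t *\<^sub>C a j) c = t * seq_inner n a c"
  using suminf_mult[OF summable_seq_inner[OF assms], of t]
  by (simp add: seq_inner_def cinner_scaleC_left algebra_simps)

lemma seq_inner_add_right:
  assumes "sq_summable n a" "sq_summable n b" "sq_summable n c"
  shows "seq_inner n c (\<lambda>j. a j + b j) = seq_inner n c a + seq_inner n c b"
  using suminf_add[OF summable_seq_inner[OF assms(3,1)] summable_seq_inner[OF assms(3,2)]]
  by (simp add: seq_inner_def cinner_add_right algebra_simps)

lemma seq_inner_diff_right: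
  assumes "sq_summable n a" "sq_summable n b" "sq_summable n c"
  shows "seq_inner n c (\<lambda>j. a j - b j) = seq_inner n c a - seq_inner n c b"
  using suminf_diff[OF summable_seq_inner[OF assms(3,1)] summable_seq_inner[OF assms(3,2)]]
  by (simp add: seq_inner_def cinner.diff_right algebra_simps)

lemma seq_norm_add_orthogonal:
  assumes a: "sq_summable n a" and b: "sq_summable n b" and orth: "seq_inner n a b = 0"
  shows "(seq_norm n (\<lambda>j. a j + b j))\<^sup>2 = (seq_norm n a)\<^sup>2 + (seq_norm n b)\<^sup>2"
proof -
  have "seq_inner n b a = 0"
    using orth seq_inner_commute[OF b a] by simp
  then have "seq_inner n (\<lambda>j. a j + b j) (\<lambda>j. a j + b j) = seq_inner n a a + seq_inner n b b"
    by (simp add: seq_inner_add_left seq_inner_add_right sq_summable_add a b orth)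
  then show ?thesis
    unfolding seq_inner_self[OF a] seq_inner_self[OF b] seq_inner_self[OF sq_summable_add[OF a b]]
    by (simp only: of_real_eq_iff flip: of_real_add)
qed

lemma seq_norm_eq_0_iff:
  assumes "sq_summable n a"
  shows "seq_norm n a = 0 \<longleftrightarrow> a = (\<lambda>j. 0)"
proof
  assume "seq_norm n a = 0"
  then have "(\<Sum>j. weight n j * (norm (a j))\<^sup>2) = 0"
    by (simp add: seq_norm_def)
  then show "a = (\<lambda>j. 0)"
    using assms by (subst (asm) suminf_eq_zero_iff) (auto simp: sq_summable_def)
qed (simp add: seq_norm_def)

lemma sq_summable_zero: "sq_summable n (\<lambda>j. 0)"
  by (simp add: sq_summable_def)

lemma seq_norm_shift_le:
  assumes "sq_summable n a"
  shows "seq_norm n (seq_shift a) \<le> seq_norm n a"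
proof -
  have "(\<Sum>j. weight n j * (norm (seq_shift a j))\<^sup>2) = (\<Sum>j. weight n (Suc j) * (norm (a j))\<^sup>2)"
    using suminf_split_head[OF sq_summable_shift[OF assms, unfolded sq_summable_def]] by simp
  also have "\<dots> \<le> (\<Sum>j. weight n j * (norm (a j))\<^sup>2)"
    using sq_summable_shift[OF assms] assms
    by (intro suminf_le) (auto simp: sq_summable_def weight_Suc_le mult_right_mono
        summable_Suc_iff[of "\<lambda>j. weight n j * (norm (seq_shift a j))\<^sup>2", simplified])
  finally show ?thesis by (simp add: seq_norm_def)
qed

text \<open>
  Point evaluations are bounded: pair \<open>sqrt (weight n j) * \<parallel>a\<^sub>j\<parallel>\<close> with \<open>sqrt (binom n j) * \<bar>z\<bar>\<^sup>j\<close>.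
\<close>

lemma
  assumes a: "sq_summable n a" and z: "norm z < 1"
  shows summable_power_series: "summable (\<lambda>j. norm (z ^ j *\<^sub>C a j))"
    and norm_power_series_le:
      "norm (power_series a z) \<le> sqrt (\<Sum>j. real (binom n j) * (norm z ^ j)\<^sup>2) * seq_norm n a"
proof -
  define p q where "p j = sqrt (real (binom n j)) * norm z ^ j" and "q j = sqrt (weight n j) * norm (a j)" for j
  have p2: "(p j)\<^sup>2 = real (binom n j) * (norm z ^ j)\<^sup>2" and q2: "(q j)\<^sup>2 = weight n j * (norm (a j))\<^sup>2" for j
    by (simp_all add: p_def q_def power_mult_distrib)
  have sq: "summable (\<lambda>j. (q j)\<^sup>2)"
    using a by (simp add: q2 sq_summable_def)
  have "(norm z)\<^sup>2 < 1"
    using z by (simp add: power_less_one_iff abs_square_less_1)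
  then have sp: "summable (\<lambda>j. (p j)\<^sup>2)"
    using summable_binom_power[of "(norm z)\<^sup>2" n] by (simp add: p2 flip: power_mult) (simp add: mult.commute)
  have "norm (z ^ j *\<^sub>C a j) = \<bar>p j\<bar> * \<bar>q j\<bar>" for j
  proof -
    have "sqrt (real (binom n j)) * sqrt (weight n j) = 1"
      by (simp flip: real_sqrt_mult add: mult.commute)
    moreover have "\<bar>p j\<bar> * \<bar>q j\<bar> = (sqrt (real (binom n j)) * sqrt (weight n j)) * (norm z ^ j * norm (a j))"
      by (simp add: p_def q_def abs_mult)
    ultimately show ?thesis by (simp add: norm_scaleC norm_power)
  qed
  then have eq: "(\<lambda>j. norm (z ^ j *\<^sub>C a j)) = (\<lambda>j. \<bar>p j\<bar> * \<bar>q j\<bar>)" by blast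
  show s: "summable (\<lambda>j. norm (z ^ j *\<^sub>C a j))"
    unfolding eq by (rule cauchy_schwarz_series(1)[OF sp sq])
  have "norm (power_series a z) \<le> (\<Sum>j. norm (z ^ j *\<^sub>C a j))"
    using z summable_norm[OF s] by (simp add: power_series_def)
  also have "\<dots> \<le> sqrt (\<Sum>j. real (binom n j) * (norm z ^ j)\<^sup>2) * seq_norm n a"
    unfolding eq using cauchy_schwarz_series(2)[OF sp sq] by (simp add: p2 q2 seq_norm_def)
  finally show "norm (power_series a z) \<le> \<dots>" .
qed

lemma power_series_sums:
  assumes "sq_summable n a" "norm z < 1"
  shows "(\<lambda>j. z ^ j *\<^sub>C a j) sums power_series a z"
  using summable_norm_cancel[OF summable_power_series[OF assms]] assms(2)
  by (simp add: power_series_def summable_sums)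

lemma taylor_power_series:
  assumes "sq_summable n a"
  shows "taylor (power_series a) = a"
  using power_series_sums[OF assms] by (rule taylor_eqI)

lemma power_series_add:
  assumes "sq_summable n a" "sq_summable n b"
  shows "power_series (\<lambda>j. a j + b j) = (\<lambda>z. power_series a z + power_series b z)"
proof
  fix z :: complex
  show "power_series (\<lambda>j. a j + b j) z = power_series a z + power_series b z"
  proof (cases "norm z < 1")
    case True
    have "(\<lambda>j. z ^ j *\<^sub>C (a j + b j)) sums (power_series a z + power_series b z)"
      using sums_add[OF power_series_sums[OF assms(1) True] power_series_sums[OF assms(2) True]]
      by (simp add: scaleC_add_right)
    then show ?thesis
      using sums_unique2[OF power_series_sums[OF sq_summable_add[OF assms] True]] by simp
  qed (simp add: power_series_def)
qed

lemma power_series_scaleC: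
  assumes "sq_summable n a"
  shows "power_series (\<lambda>j. c *\<^sub>C a j) = (\<lambda>z. c *\<^sub>C power_series a z)"
proof
  fix z :: complex
  show "power_series (\<lambda>j. c *\<^sub>C a j) z = c *\<^sub>C power_series a z"
  proof (cases "norm z < 1")
    case True
    have "(\<lambda>j. c *\<^sub>C (z ^ j *\<^sub>C a j)) sums (c *\<^sub>C power_series a z)"
      using power_series_sums[OF assms True]
      by (rule bounded_linear.sums[OF scaleC.bounded_linear_right])
    then have "(\<lambda>j. z ^ j *\<^sub>C c *\<^sub>C a j) sums (c *\<^sub>C power_series a z)"
      by (simp add: scaleC_scaleC mult.commute)
    then show ?thesis
      using sums_unique2[OF power_series_sums[OF sq_summable_scaleC[OF assms] True]] by simp
  qed (simp add: power_series_def scaleC.zero_right)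
qed

lemma power_series_diff:
  assumes "sq_summable n a" "sq_summable n b"
  shows "power_series (\<lambda>j. a j - b j) = (\<lambda>z. power_series a z - power_series b z)"
proof
  fix z
  show "power_series (\<lambda>j. a j - b j) z = power_series a z - power_series b z"
    using fun_cong[OF power_series_add[OF sq_summable_diff[OF assms] assms(2)], of z]
    by simp
qed

lemma power_series_shift:
  assumes "sq_summable n a"
  shows "power_series (seq_shift a) = shift (power_series a)"
proof
  fix z :: complex
  show "power_series (seq_shift a) z = shift (power_series a) z"
  proof (cases "norm z < 1")
    case True
    have "(\<lambda>j. z *\<^sub>C (z ^ j *\<^sub>C a j)) sums (z *\<^sub>C power_series a z)"
      using power_series_sums[OF assms True]
      by (rule bounded_linear.sums[OF scaleC.bounded_linear_right])
    then have "(\<lambda>j. z ^ Suc j *\<^sub>C seq_shift a (Suc j)) sums (z *\<^sub>C power_series a z)"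
      by (simp add: scaleC_scaleC)
    then have "(\<lambda>j. z ^ j *\<^sub>C seq_shift a j) sums (z *\<^sub>C power_series a z)"
      by (subst (asm) sums_Suc_iff) (simp add: scaleC.zero_right)
    then show ?thesis
      using sums_unique2[OF power_series_sums[OF sq_summable_shift[OF assms] True]]
      by (simp add: shift_def)
  qed (simp add: power_series_def shift_def scaleC.zero_right)
qed

lemma bergmanD:
  assumes "f \<in> bergman n V"
  shows "sq_summable n (taylor f)" "\<And>j. taylor f j \<in> V" "f = power_series (taylor f)"
proof -
  obtain a where a: "f = power_series a" "sq_summable n a" "\<forall>j. a j \<in> V"
    using assms unfolding bergman_def sq_summable_def by blast
  then have "taylor f = a" by (simp add: taylor_power_series)
  then show "sq_summable n (taylor f)" "\<And>j. taylor f j \<in> V" "f = power_series (taylor f)"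
    using a by simp_all
qed

lemma bergmanI: "sq_summable n a \<Longrightarrow> (\<And>j. a j \<in> V) \<Longrightarrow> power_series a \<in> bergman n V"
  unfolding bergman_def sq_summable_def by blast

lemma bergman_UNIV: "bergman n UNIV = power_series ` {a. sq_summable n a}"
  unfolding bergman_def sq_summable_def by auto

lemma bergman_inner_power_series:
  assumes "sq_summable n a" "sq_summable n b"
  shows "bergman_inner n (power_series a) (power_series b) = seq_inner n a b"
  by (simp add: bergman_inner_def seq_inner_def taylor_power_series[OF assms(1)]
      taylor_power_series[OF assms(2)])

lemma bergman_norm_power_series:
  assumes "sq_summable n a"
  shows "bergman_norm n (power_series a) = seq_norm n a"
  by (simp add: bergman_norm_def seq_norm_def taylor_power_series[OF assms])

lemma bergman_norm_power_series_diff: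
  assumes "sq_summable n a" "sq_summable n b"
  shows "bergman_norm n (\<lambda>z. power_series a z - power_series b z) = seq_norm n (\<lambda>j. a j - b j)"
  using bergman_norm_power_series[OF sq_summable_diff[OF assms]] power_series_diff[OF assms] by simp

text \<open>The adjoint of the shift on weighted sequences.\<close>

definition backward_shift :: "(nat \<Rightarrow> 'y::complex_hilbert) \<Rightarrow> nat \<Rightarrow> 'y" where
  "backward_shift a j = complex_of_real (weight n (Suc j) / weight n j) *\<^sub>C a (Suc j)"

lemma sq_summable_backward_shift:
  assumes "sq_summable n a"
  shows "sq_summable n (backward_shift a)"
  unfolding sq_summable_def
proof (rule summable_comparison_test')
  show "summable (\<lambda>j. weight n (Suc j) * (norm (a (Suc j)))\<^sup>2)"
    using assms unfolding sq_summable_def by (subst summable_Suc_iff)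
  fix j
  define p where "p = weight n (Suc j) / weight n j"
  have p: "0 \<le> p" "p \<le> 1" "weight n j * p = weight n (Suc j)"
    using weight_Suc_le[of j] by (auto simp: p_def)
  have "weight n j * (norm (backward_shift a j))\<^sup>2 = p * (weight n (Suc j) * (norm (a (Suc j)))\<^sup>2)"
    using p(1) by (simp add: backward_shift_def p_def[symmetric] norm_scaleC power_mult_distrib
        power2_eq_square flip: p(3))
  also have "\<dots> \<le> 1 * (weight n (Suc j) * (norm (a (Suc j)))\<^sup>2)"
    using p by (intro mult_right_mono) auto
  finally show "norm (weight n j * (norm (backward_shift a j))\<^sup>2) \<le> weight n (Suc j) * (norm (a (Suc j)))\<^sup>2"
    by simp
qed

lemma seq_inner_shift_right:
  assumes "sq_summable n a" "sq_summable n b"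
  shows "seq_inner n a (seq_shift b) = seq_inner n (backward_shift a) b"
proof -
  have "seq_inner n a (seq_shift b) = (\<Sum>j. complex_of_real (weight n (Suc j)) * cinner (a (Suc j)) (b j))"
    using suminf_split_head[OF summable_seq_inner[OF assms(1) sq_summable_shift[OF assms(2)]]]
    by (simp add: seq_inner_def cinner.zero_right)
  also have "\<dots> = seq_inner n (backward_shift a) b"
    by (simp add: seq_inner_def backward_shift_def cinner_scaleC_left)
  finally show ?thesis .
qed

end

section \<open>Gramians of an exactly observable pair\<close>

locale exactly_observable_pair = bergman_index n for n :: nat +
  fixes A :: "'x::complex_hilbert \<Rightarrow> 'x" and C :: "'x \<Rightarrow> 'y::complex_hilbert"
  assumes A_bounded: "bounded_op_on UNIV A" and C_bounded: "bounded_op_on UNIV C"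
    and exact: "exactly_observable n C A"
begin

abbreviation "G \<equiv> gramian n C A"
abbreviation "H \<equiv> shifted_gramian n C A"

definition output_at :: "nat \<Rightarrow> 'x \<Rightarrow> 'y" where
  "output_at j x = C ((A ^^ j) x)"

lemma output_at_bounded: "bounded_op_on UNIV (output_at j)"
  unfolding output_at_def by (rule bounded_op_on_compose[OF bounded_op_on_funpow[OF A_bounded] C_bounded])

lemmas output_at_add = bounded_op_onD(1)[OF output_at_bounded UNIV_I UNIV_I]
lemmas output_at_scaleC = bounded_op_onD(2)[OF output_at_bounded UNIV_I]

lemma output_at_Suc: "output_at (Suc j) x = output_at j (A x)"
  by (simp add: output_at_def funpow_swap1)

lemma output_at_0: "output_at 0 x = C x"
  by (simp add: output_at_def)

lemma cinner_gramian_term: "cinner (gramian_term C A j x) y = cinner (output_at j x) (output_at j y)"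
proof -
  have "cinner ((adj A ^^ j) v) y = cinner v ((A ^^ j) y)" for v y
    by (induction j arbitrary: y) (simp_all add: cinner_adj_left[OF A_bounded] funpow_swap1[of A])
  then show ?thesis
    by (simp add: gramian_term_def output_at_def cinner_adj_left[OF C_bounded])
qed

lemma gramian_sums:
  "(\<lambda>j. of_nat (binom n j) * cinner (output_at j x) (output_at j y)) sums cinner (G x) y"
proof -
  have "summable (\<lambda>j. of_nat (binom n j) *\<^sub>C gramian_term C A j x)"
    using exact by (simp add: exactly_observable_def binom_def)
  then have "(\<lambda>j. of_nat (binom n j) *\<^sub>C gramian_term C A j x) sums G x"
    by (simp add: gramian_def binom_def summable_sums)
  then have "(\<lambda>j. cinner (of_nat (binom n j) *\<^sub>C gramian_term C A j x) y) sums cinner (G x) y"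
    by (rule bounded_linear.sums[OF cinner.bounded_linear_left])
  then show ?thesis by (simp add: cinner_scaleC_left cinner_gramian_term)
qed

lemma gramian_quadratic_sums:
  "(\<lambda>j. real (binom n j) * (norm (output_at j x))\<^sup>2) sums inner (G x) x"
  using sums_Re[OF gramian_sums[of x x]] by (simp add: cinner_self inner_eq_Re_cinner)

lemma gramian_sym: "cinner (G x) y = cinner x (G y)"
proof -
  have "(\<lambda>j. cnj (of_nat (binom n j) * cinner (output_at j y) (output_at j x))) sums cnj (cinner (G y) x)"
    using gramian_sums unfolding sums_cnj .
  then have "(\<lambda>j. of_nat (binom n j) * cinner (output_at j x) (output_at j y)) sums cinner x (G y)"
    by (simp flip: cinner_commute)
  then show ?thesis
    using gramian_sums sums_unique2 by blast
qed

lemma gramian_upper: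
  obtains K where "K > 0" "\<And>x. inner (G x) x \<le> K * (norm x)\<^sup>2"
proof -
  obtain K where K: "K > 0" "\<And>x. norm (G x) \<le> K * norm x"
    using exact bounded_op_on_bound[of UNIV G] by (auto simp: exactly_observable_def)
  have "inner (G x) x \<le> K * (norm x)\<^sup>2" for x
  proof -
    have "inner (G x) x \<le> norm (G x) * norm x" by (rule norm_cauchy_schwarz)
    also have "\<dots> \<le> (K * norm x) * norm x" by (intro mult_right_mono K) simp
    finally show ?thesis by (simp add: power2_eq_square mult.assoc)
  qed
  with K(1) that show ?thesis by blast
qed

text \<open>
  A positive operator that is bounded below in norm is bounded below as a form, because
  \<open>\<parallel>G x\<parallel>\<^sup>2 \<le> K * \<langle>G x, x\<rangle>\<close>.
\<close>

lemma gramian_positive_definite: "positive_definite G"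
proof -
  have Gb: "bounded_op_on UNIV G"
    using exact by (simp add: exactly_observable_def)
  obtain \<epsilon> where \<epsilon>: "\<epsilon> > 0" "\<And>x. \<epsilon> * norm x \<le> norm (G x)"
    using exact by (auto simp: exactly_observable_def)
  obtain K where K: "K > 0" "\<And>x. inner (G x) x \<le> K * (norm x)\<^sup>2"
    using gramian_upper by blast
  have pos: "0 \<le> inner (G x) x" for x
    using gramian_quadratic_sums[of x] by (rule sums_le[OF _ sums_zero, rotated]) simp
  have "(\<epsilon>\<^sup>2 / K) * (norm x)\<^sup>2 \<le> inner (G x) x" for x
  proof -
    have "(\<epsilon> * norm x)\<^sup>2 \<le> (norm (G x))\<^sup>2"
      using \<epsilon> by (intro power_mono) auto
    also have "\<dots> \<le> K * inner (G x) x"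
      using bounded_linear.linear[OF bounded_op_on_UNIV_bounded_linear[OF Gb]] gramian_sym pos K(2)
      by (intro positive_operator_norm_square_le) (simp_all add: inner_eq_Re_cinner)
    finally show ?thesis
      using K by (simp add: field_simps power_mult_distrib)
  qed
  then show ?thesis
    using Gb gramian_sym \<epsilon>(1) K(1) unfolding positive_definite_def
    by (auto simp: inner_eq_Re_cinner intro!: exI[of _ "\<epsilon>\<^sup>2 / K"])
qed

lemma sqrt_gramian_block_le:
  assumes K: "\<And>x. inner (G x) x \<le> K * (norm x)\<^sup>2"
  shows "sqrt (\<Sum>j\<in>{p..<q}. real (binom n j) * (norm (output_at j y))\<^sup>2) \<le> sqrt K * norm y"
proof -
  have "(\<Sum>j\<in>{p..<q}. real (binom n j) * (norm (output_at j y))\<^sup>2)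
      \<le> (\<Sum>j. real (binom n j) * (norm (output_at j y))\<^sup>2)"
    using sums_summable[OF gramian_quadratic_sums] by (rule sum_le_suminf) auto
  also have "\<dots> = inner (G y) y"
    by (rule sums_unique[OF gramian_quadratic_sums, symmetric])
  also have "\<dots> \<le> K * (norm y)\<^sup>2" by (rule K)
  finally have "sqrt (\<Sum>j\<in>{p..<q}. real (binom n j) * (norm (output_at j y))\<^sup>2) \<le> sqrt (K * (norm y)\<^sup>2)"
    by (rule real_sqrt_le_mono)
  then show ?thesis by (simp add: real_sqrt_mult)
qed

text \<open>
  Since \<open>binom n (j + 1) \<le> n * binom n j\<close>, pairing a block of the series with itself and
  applying Cauchy--Schwarz bounds the block by the corresponding block of the quadratic form of
  the gramian. This gives both convergence and boundedness of the shifted gramian.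
\<close>

lemma shifted_gramian_block_bound:
  assumes K: "K > 0" "\<And>x. inner (G x) x \<le> K * (norm x)\<^sup>2"
  shows "norm (\<Sum>j\<in>{p..<q}. of_nat (binom n (Suc j)) *\<^sub>C gramian_term C A j x)
    \<le> real n * sqrt K * sqrt (\<Sum>j\<in>{p..<q}. real (binom n j) * (norm (output_at j x))\<^sup>2)"
    (is "norm ?v \<le> _ * sqrt ?S")
proof -
  define f where "f y j = sqrt (real (binom n j)) * norm (output_at j y)" for y j
  have L2: "L2_set (f y) {p..<q} = sqrt (\<Sum>j\<in>{p..<q}. real (binom n j) * (norm (output_at j y))\<^sup>2)" for y
    by (simp add: L2_set_def f_def power_mult_distrib)
  have L2v: "L2_set (f y) {p..<q} \<le> sqrt K * norm y" for y
    unfolding L2 by (rule sqrt_gramian_block_le[OF K(2)])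
  have "(norm ?v)\<^sup>2 = Re (cinner ?v ?v)"
    by (simp add: cinner_self)
  also have "\<dots> = Re (\<Sum>j\<in>{p..<q}. of_nat (binom n (Suc j)) * cinner (output_at j x) (output_at j ?v))"
    by (subst (1) cinner.sum_left) (simp add: cinner_scaleC_left cinner_gramian_term)
  also have "\<dots> \<le> norm (\<Sum>j\<in>{p..<q}. of_nat (binom n (Suc j)) * cinner (output_at j x) (output_at j ?v))"
    by (rule complex_Re_le_cmod)
  also have "\<dots> \<le> (\<Sum>j\<in>{p..<q}. real n * (\<bar>f x j\<bar> * \<bar>f ?v j\<bar>))"
  proof (rule sum_norm_le)
    fix j
    have "norm (of_nat (binom n (Suc j)) * cinner (output_at j x) (output_at j ?v))
      \<le> real (binom n (Suc j)) * (norm (output_at j x) * norm (output_at j ?v))"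
      by (simp add: norm_mult norm_cinner_le mult_left_mono)
    also have "\<dots> \<le> real (n * binom n j) * (norm (output_at j x) * norm (output_at j ?v))"
      using binom_Suc_le[of j] by (intro mult_right_mono of_nat_mono) auto
    also have "\<dots> = real n * (\<bar>f x j\<bar> * \<bar>f ?v j\<bar>)"
      by (simp add: f_def abs_mult)
    finally show "norm (of_nat (binom n (Suc j)) * cinner (output_at j x) (output_at j ?v))
      \<le> real n * (\<bar>f x j\<bar> * \<bar>f ?v j\<bar>)" .
  qed
  also have "\<dots> \<le> real n * (L2_set (f x) {p..<q} * L2_set (f ?v) {p..<q})"
    unfolding sum_distrib_left[symmetric] by (intro mult_left_mono L2_set_mult_ineq) simp
  also have "\<dots> \<le> real n * (L2_set (f x) {p..<q} * (sqrt K * norm ?v))"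
    by (intro mult_left_mono L2v) auto
  finally have "norm ?v * norm ?v \<le> (real n * sqrt K * sqrt ?S) * norm ?v"
    by (simp add: power2_eq_square L2 algebra_simps)
  then show ?thesis
    using K(1) by (cases "?v = 0") (auto intro!: mult_nonneg_nonneg sum_nonneg)
qed

lemma shifted_gramian_summable:
  "summable (\<lambda>j. of_nat (binom n (Suc j)) *\<^sub>C gramian_term C A j x)"
  unfolding summable_Cauchy
proof (intro allI impI)
  fix e :: real assume "e > 0"
  obtain K where K: "K > 0" "\<And>x. inner (G x) x \<le> K * (norm x)\<^sup>2"
    using gramian_upper by blast
  define c where "c = real n * sqrt K"
  have "c > 0" using K n_ge_1 by (simp add: c_def)
  have "(e / c)\<^sup>2 > 0" using \<open>e > 0\<close> \<open>c > 0\<close> by simp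
  then obtain N where N: "\<And>p q. p \<ge> N \<Longrightarrow>
      norm (\<Sum>j\<in>{p..<q}. real (binom n j) * (norm (output_at j x))\<^sup>2) < (e / c)\<^sup>2"
    using gramian_quadratic_sums[of x] unfolding sums_iff summable_Cauchy by meson
  have "norm (\<Sum>j\<in>{p..<q}. of_nat (binom n (Suc j)) *\<^sub>C gramian_term C A j x) < e" if "p \<ge> N" for p q
  proof -
    have "sqrt (\<Sum>j\<in>{p..<q}. real (binom n j) * (norm (output_at j x))\<^sup>2) < e / c"
      using N[OF that, of q] \<open>e > 0\<close> \<open>c > 0\<close> by (intro real_less_lsqrt) auto
    then have "c * sqrt (\<Sum>j\<in>{p..<q}. real (binom n j) * (norm (output_at j x))\<^sup>2) < e"
      using \<open>c > 0\<close> by (simp add: field_simps)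
    then show ?thesis
      using shifted_gramian_block_bound[OF K, of x p q] by (simp add: c_def)
  qed
  then show "\<exists>N. \<forall>p\<ge>N. \<forall>q. norm (\<Sum>j\<in>{p..<q}. of_nat (binom n (Suc j)) *\<^sub>C gramian_term C A j x) < e"
    by blast
qed

lemma shifted_gramian_sums_op:
  "(\<lambda>j. of_nat (binom n (Suc j)) *\<^sub>C gramian_term C A j x) sums H x"
  using summable_sums[OF shifted_gramian_summable[of x]]
  by (simp add: shifted_gramian_def binom_Suc_right)

lemma shifted_gramian_sums:
  "(\<lambda>j. of_nat (binom n (Suc j)) * cinner (output_at j x) (output_at j y)) sums cinner (H x) y"
  using bounded_linear.sums[OF cinner.bounded_linear_left shifted_gramian_sums_op, of x y]
  by (simp add: cinner_scaleC_left cinner_gramian_term)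

lemma shifted_gramian_quadratic_sums:
  "(\<lambda>j. real (binom n (Suc j)) * (norm (output_at j x))\<^sup>2) sums inner (H x) x"
  using sums_Re[OF shifted_gramian_sums[of x x]] by (simp add: cinner_self inner_eq_Re_cinner)

lemma shifted_gramian_sym: "cinner (H x) y = cinner x (H y)"
proof -
  have "(\<lambda>j. cnj (of_nat (binom n (Suc j)) * cinner (output_at j y) (output_at j x))) sums cnj (cinner (H y) x)"
    using shifted_gramian_sums unfolding sums_cnj .
  then have "(\<lambda>j. of_nat (binom n (Suc j)) * cinner (output_at j x) (output_at j y)) sums cinner x (H y)"
    by (simp flip: cinner_commute)
  then show ?thesis
    using shifted_gramian_sums sums_unique2 by blast
qed

lemma gramian_le_shifted: "inner (G x) x \<le> inner (H x) x"
  using gramian_quadratic_sums shifted_gramian_quadratic_sums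
  by (rule sums_le[rotated]) (simp add: mult_right_mono binom_le_Suc)

lemma shifted_gramian_bounded: "bounded_op_on UNIV H"
  unfolding bounded_op_on_def
proof (intro conjI ballI allI)
  fix x y a
  show "H (x + y) = H x + H y"
  proof (rule cinner_extensionality)
    fix z
    have "(\<lambda>j. of_nat (binom n (Suc j)) * cinner (output_at j (x + y)) (output_at j z)) sums (cinner (H x) z + cinner (H y) z)"
      using sums_add[OF shifted_gramian_sums[of x z] shifted_gramian_sums[of y z]]
      by (simp add: output_at_add cinner_add_left algebra_simps)
    then show "cinner (H (x + y)) z = cinner (H x + H y) z"
      using sums_unique2[OF shifted_gramian_sums] by (simp add: cinner_add_left)
  qed
  show "H (a *\<^sub>C x) = a *\<^sub>C H x"
  proof (rule cinner_extensionality)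
    fix z
    have "(\<lambda>j. of_nat (binom n (Suc j)) * cinner (output_at j (a *\<^sub>C x)) (output_at j z)) sums (a * cinner (H x) z)"
      using sums_mult[OF shifted_gramian_sums[of x z], of a]
      by (simp add: output_at_scaleC cinner_scaleC_left algebra_simps)
    then show "cinner (H (a *\<^sub>C x)) z = cinner (a *\<^sub>C H x) z"
      using sums_unique2[OF shifted_gramian_sums] by (simp add: cinner_scaleC_left)
  qed
  obtain K where K: "K > 0" "\<And>x. inner (G x) x \<le> K * (norm x)\<^sup>2"
    using gramian_upper by blast
  have "norm (H x) \<le> (real n * sqrt K * sqrt K) * norm x" for x
  proof (rule LIMSEQ_le_const2)
    show "(\<lambda>q. norm (\<Sum>j\<in>{0..<q}. of_nat (binom n (Suc j)) *\<^sub>C gramian_term C A j x)) \<longlonglongrightarrow> norm (H x)"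
      using shifted_gramian_sums_op[of x] by (intro tendsto_norm) (simp add: sums_def atLeast0LessThan)
    have "norm (\<Sum>j\<in>{0..<q}. of_nat (binom n (Suc j)) *\<^sub>C gramian_term C A j x)
        \<le> (real n * sqrt K * sqrt K) * norm x" for q
    proof -
      have "(real n * sqrt K) * sqrt (\<Sum>j\<in>{0..<q}. real (binom n j) * (norm (output_at j x))\<^sup>2)
          \<le> (real n * sqrt K) * (sqrt K * norm x)"
        using K(1) by (intro mult_left_mono sqrt_gramian_block_le[OF K(2)]) auto
      from shifted_gramian_block_bound[OF K, of x 0 q] this show ?thesis
        unfolding mult.assoc by (rule order_trans)
    qed
    then show "\<exists>N. \<forall>q\<ge>N. norm (\<Sum>j\<in>{0..<q}. of_nat (binom n (Suc j)) *\<^sub>C gramian_term C A j x)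
        \<le> (real n * sqrt K * sqrt K) * norm x" by blast
  qed
  then show "\<exists>K. \<forall>x\<in>UNIV. norm (H x) \<le> K * norm x" by blast
qed

lemma shifted_gramian_positive_definite: "positive_definite H"
proof -
  obtain \<epsilon> where "\<epsilon> > 0" "\<And>x. \<epsilon> * (norm x)\<^sup>2 \<le> inner (G x) x"
    using gramian_positive_definite by (auto simp: positive_definite_def inner_eq_Re_cinner)
  then have "\<epsilon> * (norm x)\<^sup>2 \<le> inner (H x) x" for x
    using gramian_le_shifted order_trans by blast
  then show ?thesis
    using \<open>\<epsilon> > 0\<close> shifted_gramian_bounded shifted_gramian_sym
    by (auto simp: positive_definite_def inner_eq_Re_cinner)
qed

lemma G_inv: "G (inv G x) = x" and inv_G: "inv G (G x) = x"
  using positive_definite_bij[OF gramian_positive_definite]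
  by (simp_all add: bij_is_surj surj_f_inv_f bij_is_inj inv_f_f)

lemma H_inv: "H (inv H x) = x" and inv_H: "inv H (H x) = x"
  using positive_definite_bij[OF shifted_gramian_positive_definite]
  by (simp_all add: bij_is_surj surj_f_inv_f bij_is_inj inv_f_f)

text \<open>The identity \<open>G = C\<^sup>* C + A\<^sup>* H A\<close>: split off the first term of the series.\<close>

lemma stein_identity: "cinner (G x) y = cinner (C x) (C y) + cinner (H (A x)) (A y)"
proof -
  have "(\<lambda>j. of_nat (binom n (Suc j)) * cinner (output_at (Suc j) x) (output_at (Suc j) y)) sums
      cinner (H (A x)) (A y)"
    using shifted_gramian_sums[of "A x" "A y"] by (simp add: output_at_Suc)
  then have "(\<lambda>j. of_nat (binom n j) * cinner (output_at j x) (output_at j y)) sums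
      (cinner (H (A x)) (A y) + of_nat (binom n 0) * cinner (output_at 0 x) (output_at 0 y))"
    by (rule sums_Suc)
  then show ?thesis
    using sums_unique2[OF gramian_sums] by (simp add: output_at_0)
qed

text \<open>
  By the Stein identity and \<open>G \<le> H\<close>, the operator \<open>A\<close> is a contraction in the norm of \<open>G\<close>, which is
  equivalent to the given norm. Hence the power series of \<open>(I - z A)\<^sup>-\<^sup>1\<close> converges in the whole disk.
\<close>

lemma power_bounded:
  obtains K where "K > 0" "\<And>k x. norm ((A ^^ k) x) \<le> K * norm x"
proof -
  obtain K where K: "K > 0" "\<And>x. inner (G x) x \<le> K * (norm x)\<^sup>2"
    using gramian_upper by blast
  obtain \<epsilon> where \<epsilon>: "\<epsilon> > 0" "\<And>x. \<epsilon> * (norm x)\<^sup>2 \<le> inner (G x) x"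
    using gramian_positive_definite by (auto simp: positive_definite_def inner_eq_Re_cinner)
  have "inner (G (A x)) (A x) \<le> inner (G x) x" for x
  proof -
    have "inner (G x) x = (norm (C x))\<^sup>2 + inner (H (A x)) (A x)"
      using stein_identity[of x x] by (simp add: inner_eq_Re_cinner cinner_self)
    then show ?thesis
      using gramian_le_shifted[of "A x"] by (simp add: add_increasing)
  qed
  then have le: "inner (G ((A ^^ k) x)) ((A ^^ k) x) \<le> inner (G x) x" for k x
    by (induction k) (auto intro: order_trans)
  have "norm ((A ^^ k) x) \<le> sqrt (K / \<epsilon>) * norm x" for k x
  proof (rule power2_le_imp_le)
    have "\<epsilon> * (norm ((A ^^ k) x))\<^sup>2 \<le> K * (norm x)\<^sup>2"
      using \<epsilon>(2)[of "(A ^^ k) x"] le[of k x] K(2)[of x] by linarith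
    then show "(norm ((A ^^ k) x))\<^sup>2 \<le> (sqrt (K / \<epsilon>) * norm x)\<^sup>2"
      using K \<epsilon> by (simp add: power_mult_distrib field_simps)
  qed (use K \<epsilon> in simp)
  then show ?thesis
    using K \<epsilon> by (intro that[of "sqrt (K / \<epsilon>)"]) auto
qed

section \<open>Powers of the resolvent\<close>

text \<open>The binomial series of \<open>(I - z A)\<^sup>-\<^sup>k\<close>.\<close>

definition resolvent_series :: "complex \<Rightarrow> nat \<Rightarrow> 'x \<Rightarrow> 'x" where
  "resolvent_series z k x = (\<Sum>j. (of_nat (binom k j) * z ^ j) *\<^sub>C (A ^^ j) x)"

lemma resolvent_series_sums:
  assumes "norm z < 1"
  shows "(\<lambda>j. (of_nat (binom k j) * z ^ j) *\<^sub>C (A ^^ j) x) sums resolvent_series z k x"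
proof -
  obtain K where K: "K > 0" "\<And>k x. norm ((A ^^ k) x) \<le> K * norm x"
    using power_bounded by blast
  have "summable (\<lambda>j. (of_nat (binom k j) * z ^ j) *\<^sub>C (A ^^ j) x)"
  proof (rule summable_comparison_test')
    show "summable (\<lambda>j. real (binom k j) * norm z ^ j * (K * norm x))"
      using assms by (intro summable_mult2 summable_binom_power) auto
    show "norm ((of_nat (binom k j) * z ^ j) *\<^sub>C (A ^^ j) x) \<le> real (binom k j) * norm z ^ j * (K * norm x)" for j
      using K(2)[of j x] by (simp add: norm_scaleC norm_mult norm_power mult_left_mono)
  qed
  then show ?thesis
    by (simp add: resolvent_series_def summable_sums)
qed

lemma resolvent_series_0:
  assumes "norm z < 1"
  shows "resolvent_series z 0 x = x"
proof -
  have "(\<lambda>j. (of_nat (binom 0 j) * z ^ j) *\<^sub>C (A ^^ j) x) sums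
      (\<Sum>j\<in>{0}. (of_nat (binom 0 j) * z ^ j) *\<^sub>C (A ^^ j) x)"
    by (rule sums_finite) (auto simp: binom_0_left scaleC.zero_left)
  then show ?thesis
    using sums_unique2[OF resolvent_series_sums[OF assms]] by (simp add: scaleC_one)
qed

text \<open>By Pascal's rule, multiplying the series by \<open>I - z A\<close> lowers the exponent by one.\<close>

lemma resolvent_series_Suc:
  assumes "norm z < 1"
  shows "resolvent_series z (Suc k) x - z *\<^sub>C A (resolvent_series z (Suc k) x) = resolvent_series z k x"
proof -
  have "(\<lambda>j. z *\<^sub>C A ((of_nat (binom (Suc k) j) * z ^ j) *\<^sub>C (A ^^ j) x)) sums
      (z *\<^sub>C A (resolvent_series z (Suc k) x))"
    by (intro bounded_linear.sums[OF scaleC.bounded_linear_right]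
        bounded_linear.sums[OF bounded_op_on_UNIV_bounded_linear[OF A_bounded]]
        resolvent_series_sums assms)
  then have 1: "(\<lambda>j. (of_nat (binom (Suc k) j) * z ^ Suc j) *\<^sub>C (A ^^ Suc j) x) sums
      (z *\<^sub>C A (resolvent_series z (Suc k) x))"
    using bounded_op_onD(2)[OF A_bounded] by (simp add: scaleC_scaleC mult.left_commute)
  have tail: "(\<lambda>j. (of_nat (binom m (Suc j)) * z ^ Suc j) *\<^sub>C (A ^^ Suc j) x) sums (resolvent_series z m x - x)" for m
    using resolvent_series_sums[OF assms, of m x] by (subst sums_Suc_iff) (simp add: scaleC_one)
  have "(\<lambda>j. (of_nat (binom (Suc k) (Suc j)) * z ^ Suc j) *\<^sub>C (A ^^ Suc j) x
        - (of_nat (binom (Suc k) j) * z ^ Suc j) *\<^sub>C (A ^^ Suc j) x) sums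
      (resolvent_series z (Suc k) x - x - z *\<^sub>C A (resolvent_series z (Suc k) x))"
    by (rule sums_diff[OF tail 1])
  then have "(\<lambda>j. (of_nat (binom k (Suc j)) * z ^ Suc j) *\<^sub>C (A ^^ Suc j) x) sums
      (resolvent_series z (Suc k) x - x - z *\<^sub>C A (resolvent_series z (Suc k) x))"
    by (simp add: binom_pascal algebra_simps flip: scaleC.diff_left)
  then have "resolvent_series z (Suc k) x - x - z *\<^sub>C A (resolvent_series z (Suc k) x) = resolvent_series z k x - x"
    using tail sums_unique2 by blast
  then show ?thesis by (simp add: algebra_simps)
qed

text \<open>A vector with \<open>d = z A d\<close> satisfies \<open>d = z\<^sup>k A\<^sup>k d\<close>, which tends to \<open>0\<close> since the powers of \<open>A\<close> are bounded.\<close>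

lemma inj_id_minus_zA:
  assumes "norm z < 1"
  shows "inj (\<lambda>x. x - z *\<^sub>C A x)"
proof (rule injI)
  fix x y assume eq: "x - z *\<^sub>C A x = y - z *\<^sub>C A y"
  define d where "d = x - y"
  have A_diff: "A (x - y) = A x - A y"
    by (rule bounded_linear.linear[OF bounded_op_on_UNIV_bounded_linear[OF A_bounded], THEN linear_diff])
  have d: "d = z *\<^sub>C A d"
    using eq by (simp add: d_def A_diff scaleC.diff_right algebra_simps)
  have pow: "d = z ^ k *\<^sub>C (A ^^ k) d" for k
  proof (induction k)
    case (Suc k)
    have "z *\<^sub>C A d = z *\<^sub>C A (z ^ k *\<^sub>C (A ^^ k) d)" using Suc by simp
    then show ?case
      using d bounded_op_onD(2)[OF A_bounded] by (simp add: scaleC_scaleC)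
  qed (simp add: scaleC_one)
  obtain K where K: "K > 0" "\<And>k x. norm ((A ^^ k) x) \<le> K * norm x"
    using power_bounded by blast
  have le: "norm d \<le> norm z ^ k * (K * norm d)" for k
  proof -
    have "norm d = norm z ^ k * norm ((A ^^ k) d)"
      by (metis pow norm_scaleC norm_power)
    then show ?thesis using K(2)[of k d] by (metis mult_left_mono norm_ge_zero zero_le_power)
  qed
  have "(\<lambda>k. norm z ^ k * (K * norm d)) \<longlonglongrightarrow> 0"
    using assms by (intro tendsto_mult_left_zero LIMSEQ_power_zero) auto
  then have "norm d \<le> 0"
    by (rule LIMSEQ_le_const) (use le in blast)
  then show "x = y" by (simp add: d_def)
qed

lemma resolvent_power:
  assumes "norm z < 1"
  shows "(resolvent A z ^^ k) x = resolvent_series z k x"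
proof (induction k)
  case 0
  then show ?case by (simp add: resolvent_series_0[OF assms])
next
  case (Suc k)
  have "resolvent A z (resolvent_series z k x) = resolvent_series z (Suc k) x"
    unfolding resolvent_def
    by (rule inv_f_eq[OF inj_id_minus_zA[OF assms] resolvent_series_Suc[OF assms]])
  then show ?case using Suc by simp
qed

section \<open>The orthogonal complement of the observable functions\<close>

definition obs_seq :: "'x \<Rightarrow> nat \<Rightarrow> 'y" where
  "obs_seq x j = of_nat (binom n j) *\<^sub>C output_at j x"

text \<open>The coefficients of \<open>y + z C ((I - z A)\<^sup>-\<^sup>1 + \<cdots> + (I - z A)\<^sup>-\<^sup>n) x\<close>.\<close>

definition char_seq :: "'x \<Rightarrow> 'y \<Rightarrow> nat \<Rightarrow> 'y" where
  "char_seq x y = case_nat y (\<lambda>j. of_nat (binom n (Suc j)) *\<^sub>C output_at j x)"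

lemma observability_eq: "observability n C A x = power_series (obs_seq x)"
  by (simp add: observability_def obs_seq_def[abs_def] binom_def output_at_def)

lemma weight_0: "weight n 0 = 1"
  by (simp add: weight_eq)

lemma power_series_zero: "power_series (\<lambda>j. 0 :: 'y) = (\<lambda>z. 0)"
  by (rule ext) (simp add: power_series_def scaleC.zero_right)

lemma weight_binom_complex [simp]: "complex_of_real (weight n j) * of_nat (binom n j) = 1"
  using weight_binom[of j] by (metis of_real_1 of_real_mult of_real_of_nat_eq)

lemma weight_binom_square: "weight n j * (real (binom n j) * r)\<^sup>2 = real (binom n j) * r\<^sup>2"
  using weight_binom[of j] by (simp add: power2_eq_square algebra_simps)

lemma sq_summable_obs_seq: "sq_summable n (obs_seq x)"
  using gramian_quadratic_sums[of x]
  by (simp add: sq_summable_def obs_seq_def norm_scaleC weight_binom_square sums_iff)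

lemma sq_summable_char_seq: "sq_summable n (char_seq x y)"
proof -
  have "summable (\<lambda>j. weight n (Suc j) * (norm (char_seq x y (Suc j)))\<^sup>2)"
    using shifted_gramian_quadratic_sums[of x]
    by (simp add: char_seq_def norm_scaleC weight_binom_square sums_iff)
  then show ?thesis
    unfolding sq_summable_def by (subst (asm) summable_Suc_iff)
qed

lemma seq_inner_obs_seq_left: "seq_inner n (obs_seq x) a = (\<Sum>j. cinner (output_at j x) (a j))"
  by (simp add: seq_inner_def obs_seq_def cinner_scaleC_left flip: mult.assoc)

lemma seq_inner_obs_seq_right: "seq_inner n a (obs_seq x) = (\<Sum>j. cinner (a j) (output_at j x))"
  by (simp add: seq_inner_def obs_seq_def cinner_scaleC_right flip: mult.assoc)

lemma seq_inner_obs_obs: "seq_inner n (obs_seq x) (obs_seq y) = cinner (G x) y"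
  using gramian_sums[of x y]
  by (simp add: seq_inner_obs_seq_right sums_iff) (simp add: obs_seq_def cinner_scaleC_left)

lemma seq_inner_char_seq:
  assumes "sq_summable n a"
  shows "seq_inner n (char_seq x y) a = cinner y (a 0) + (\<Sum>j. cinner (output_at j x) (a (Suc j)))"
proof -
  have "seq_inner n (char_seq x y) a = complex_of_real (weight n 0) * cinner (char_seq x y 0) (a 0)
      + (\<Sum>j. complex_of_real (weight n (Suc j)) * cinner (char_seq x y (Suc j)) (a (Suc j)))"
    using suminf_split_head[OF summable_seq_inner[OF sq_summable_char_seq assms], of x y]
    unfolding seq_inner_def by simp
  also have "\<dots> = cinner y (a 0) + (\<Sum>j. cinner (output_at j x) (a (Suc j)))"
    by (simp add: char_seq_def cinner_scaleC_left weight_0 flip: mult.assoc)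
  finally show ?thesis .
qed

lemma seq_inner_char_char:
  "seq_inner n (char_seq x y) (char_seq x' y') = cinner y y' + cinner (H x) x'"
  unfolding seq_inner_char_seq[OF sq_summable_char_seq]
  using shifted_gramian_sums[of x x'] by (simp add: char_seq_def cinner_scaleC_right sums_iff)

lemma seq_inner_char_obs:
  "seq_inner n (char_seq x y) (obs_seq x') = cinner y (C x') + cinner (H x) (A x')"
  using shifted_gramian_sums[of x "A x'"]
  by (simp add: seq_inner_char_seq[OF sq_summable_obs_seq] obs_seq_def cinner_scaleC_right
      scaleC_one output_at_0 output_at_Suc sums_iff)

lemma seq_inner_char_shift:
  "sq_summable n a \<Longrightarrow> seq_inner n (char_seq x y) (seq_shift a) = seq_inner n (obs_seq x) a"
  by (simp add: seq_inner_char_seq[OF sq_summable_shift] seq_inner_obs_seq_left cinner.zero_right)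

text \<open>In operator terms \<open>S\<^sup>* O = O A\<close>; hence the complement of the range of \<open>O\<close> is shift invariant.\<close>

lemma seq_inner_shift_obs:
  assumes "sq_summable n a"
  shows "seq_inner n (seq_shift a) (obs_seq x) = seq_inner n a (obs_seq (A x))"
proof -
  have "summable (\<lambda>j. cinner (seq_shift a j) (output_at j x))"
    using summable_seq_inner[OF sq_summable_shift[OF assms] sq_summable_obs_seq[of x]]
    by (simp add: obs_seq_def cinner_scaleC_right flip: mult.assoc)
  then show ?thesis
    using suminf_split_head[of "\<lambda>j. cinner (seq_shift a j) (output_at j x)"]
    by (simp add: seq_inner_obs_seq_right output_at_Suc cinner.zero_left)
qed

definition complement_seq :: "(nat \<Rightarrow> 'y) set" where
  "complement_seq = {a. sq_summable n a \<and> (\<forall>x. seq_inner n a (obs_seq x) = 0)}"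

abbreviation "M \<equiv> observability_complement n C A"
abbreviation "E \<equiv> wandering n M"

lemma complement_eq: "M = power_series ` complement_seq"
  by (auto simp: observability_complement_def bergman_UNIV complement_seq_def observability_eq
      bergman_inner_power_series sq_summable_obs_seq)

lemma complementE:
  assumes "f \<in> M"
  obtains a where "f = power_series a" "a \<in> complement_seq" "sq_summable n a"
  using assms unfolding complement_eq by (auto simp: complement_seq_def)

lemma complementI: "a \<in> complement_seq \<Longrightarrow> power_series a \<in> M"
  by (simp add: complement_eq)

lemma complement_seq_add:
  "a \<in> complement_seq \<Longrightarrow> b \<in> complement_seq \<Longrightarrow> (\<lambda>j. a j + b j) \<in> complement_seq"
  by (simp add: complement_seq_def sq_summable_add seq_inner_add_left sq_summable_obs_seq)

lemma complement_seq_scaleC: "a \<in> complement_seq \<Longrightarrow> (\<lambda>j. c *\<^sub>C a j) \<in> complement_seq"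
  by (simp add: complement_seq_def sq_summable_scaleC seq_inner_scaleC_left sq_summable_obs_seq)

lemma complement_seq_shift: "a \<in> complement_seq \<Longrightarrow> seq_shift a \<in> complement_seq"
  by (simp add: complement_seq_def sq_summable_shift seq_inner_shift_obs)

lemma complement_seq_closed:
  assumes a: "sq_summable n a"
    and approx: "\<And>e. e > 0 \<Longrightarrow> \<exists>b\<in>complement_seq. seq_norm n (\<lambda>j. a j - b j) < e"
  shows "a \<in> complement_seq"
proof -
  have "seq_inner n a (obs_seq x) = 0" for x
  proof (rule ccontr)
    assume ne: "seq_inner n a (obs_seq x) \<noteq> 0"
    define s where "s = seq_norm n (obs_seq x) + 1"
    have s: "s > 0" using seq_norm_nonneg[OF sq_summable_obs_seq[of x]] by (simp add: s_def)
    then obtain b where b: "b \<in> complement_seq"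
      and lt: "seq_norm n (\<lambda>j. a j - b j) < norm (seq_inner n a (obs_seq x)) / s"
      using approx[of "norm (seq_inner n a (obs_seq x)) / s"] ne by auto
    have bs: "sq_summable n b" "seq_inner n b (obs_seq x) = 0"
      using b by (auto simp: complement_seq_def)
    have "norm (seq_inner n a (obs_seq x)) = norm (seq_inner n (\<lambda>j. a j - b j) (obs_seq x))"
      by (simp add: seq_inner_diff_left a bs sq_summable_obs_seq)
    also have "\<dots> \<le> seq_norm n (\<lambda>j. a j - b j) * seq_norm n (obs_seq x)"
      by (intro norm_seq_inner_le sq_summable_diff a bs sq_summable_obs_seq)
    also have "\<dots> \<le> seq_norm n (\<lambda>j. a j - b j) * s"
      by (intro mult_left_mono seq_norm_nonneg sq_summable_diff a bs) (simp add: s_def)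
    also have "\<dots> < norm (seq_inner n a (obs_seq x))"
      using lt s by (simp add: field_simps)
    finally show False by simp
  qed
  with a show ?thesis by (simp add: complement_seq_def)
qed

lemma complement_closure: "bergman_closure n M = M"
proof
  show "M \<subseteq> bergman_closure n M"
  proof
    fix f assume f: "f \<in> M"
    have "bergman_norm n (\<lambda>z. f z - f z) = 0"
      using bergman_norm_power_series[OF sq_summable_zero, where 'a='y]
      by (simp add: power_series_zero seq_norm_def)
    with f show "f \<in> bergman_closure n M"
      unfolding bergman_closure_def by (auto simp: observability_complement_def)
  qed
  show "bergman_closure n M \<subseteq> M"
  proof
    fix f assume f: "f \<in> bergman_closure n M"
    then obtain a where a: "f = power_series a" "sq_summable n a"
      by (auto simp: bergman_closure_def bergman_UNIV)
    have "\<exists>b\<in>complement_seq. seq_norm n (\<lambda>j. a j - b j) < e" if "e > 0" for e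
    proof -
      obtain g where g: "g \<in> M" "bergman_norm n (\<lambda>z. f z - g z) < e"
        using f \<open>e > 0\<close> unfolding bergman_closure_def by blast
      obtain b where "b \<in> complement_seq" "bergman_norm n (\<lambda>z. f z - power_series b z) < e"
        using complementE[OF g(1)] g(2) by blast
      then show ?thesis
        using a by (auto simp: bergman_norm_power_series_diff complement_seq_def)
    qed
    then show "f \<in> M"
      using complement_seq_closed[OF a(2)] a(1) by (auto simp: complement_eq)
  qed
qed

lemma complement_closed_invariant: "closed_invariant_subspace n M"
  unfolding closed_invariant_subspace_def
proof (intro conjI ballI allI)
  show "M \<subseteq> bergman n UNIV"
    by (auto simp: observability_complement_def)
  have "(\<lambda>j. 0) \<in> complement_seq"
    by (simp add: complement_seq_def sq_summable_zero seq_inner_def cinner.zero_left)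
  with power_series_zero show "(\<lambda>z. 0) \<in> M"
    unfolding complement_eq by (metis image_eqI)
  show "(\<lambda>z. f z + g z) \<in> M" if fg: "f \<in> M" "g \<in> M" for f g
  proof -
    obtain a b where ab: "f = power_series a" "g = power_series b" "a \<in> complement_seq" "b \<in> complement_seq"
      using complementE[OF fg(1)] complementE[OF fg(2)] by metis
    then have "(\<lambda>z. f z + g z) = power_series (\<lambda>j. a j + b j)"
      by (simp add: power_series_add complement_seq_def)
    then show ?thesis
      using complement_seq_add[OF ab(3,4)] by (simp add: complement_eq)
  qed
  show "(\<lambda>z. c *\<^sub>C f z) \<in> M" if f: "f \<in> M" for f c
  proof -
    obtain a where a: "f = power_series a" "a \<in> complement_seq"
      using complementE[OF f] by blast
    then have "(\<lambda>z. c *\<^sub>C f z) = power_series (\<lambda>j. c *\<^sub>C a j)"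
      by (simp add: power_series_scaleC complement_seq_def)
    then show ?thesis
      using complement_seq_scaleC[OF a(2)] by (simp add: complement_eq)
  qed
  show "bergman_closure n M = M" by (rule complement_closure)
  show "shift ` M \<subseteq> M"
  proof (rule image_subsetI)
    fix f assume f: "f \<in> M"
    obtain a where a: "f = power_series a" "a \<in> complement_seq"
      using complementE[OF f] by blast
    then have "shift f = power_series (seq_shift a)"
      by (simp add: power_series_shift complement_seq_def)
    then show "shift f \<in> M"
      using complement_seq_shift[OF a(2)] by (simp add: complement_eq)
  qed
qed

text \<open>
  The range of the observability operator is closed because the gramian is invertible: the
  projection of \<open>s\<close> onto it is \<open>O G\<^sup>-\<^sup>1 O\<^sup>* s\<close>, so a sequence orthogonal to the complement is its own
  projection.
\<close>

lemma orthogonal_to_complement: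
  assumes s: "sq_summable n s" and orth: "\<And>b. b \<in> complement_seq \<Longrightarrow> seq_inner n s b = 0"
  obtains x where "s = obs_seq x"
proof -
  obtain K where K: "K > 0" "\<And>x. inner (G x) x \<le> K * (norm x)\<^sup>2"
    using gramian_upper by blast
  have norm_obs: "seq_norm n (obs_seq x) \<le> sqrt K * norm x" for x
  proof -
    have "(seq_norm n (obs_seq x))\<^sup>2 = inner (G x) x"
      using arg_cong[OF seq_inner_self[OF sq_summable_obs_seq[of x]], of Re]
      by (simp add: seq_inner_obs_obs inner_eq_Re_cinner del: of_real_power)
    also have "\<dots> \<le> (sqrt K * norm x)\<^sup>2"
      using K(1) K(2)[of x] by (simp add: power_mult_distrib)
    finally show ?thesis
      by (rule power2_le_imp_le) (use K(1) in simp)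
  qed
  have "bounded_op_on UNIV (\<lambda>x. seq_inner n (obs_seq x) s)"
    unfolding bounded_op_on_def
  proof (intro conjI ballI allI exI)
    fix x y a
    have "obs_seq (x + y) = (\<lambda>j. obs_seq x j + obs_seq y j)"
      by (simp add: obs_seq_def fun_eq_iff output_at_add scaleC_add_right)
    then show "seq_inner n (obs_seq (x + y)) s = seq_inner n (obs_seq x) s + seq_inner n (obs_seq y) s"
      by (simp add: seq_inner_add_left sq_summable_obs_seq s)
    have "obs_seq (a *\<^sub>C x) = (\<lambda>j. a *\<^sub>C obs_seq x j)"
      by (simp add: obs_seq_def fun_eq_iff output_at_scaleC scaleC_scaleC mult.commute)
    then show "seq_inner n (obs_seq (a *\<^sub>C x)) s = a *\<^sub>C seq_inner n (obs_seq x) s"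
      by (simp add: seq_inner_scaleC_left sq_summable_obs_seq s scaleC_complex_def)
    show "norm (seq_inner n (obs_seq x) s) \<le> (sqrt K * seq_norm n s) * norm x"
    proof -
      have "norm (seq_inner n (obs_seq x) s) \<le> seq_norm n (obs_seq x) * seq_norm n s"
        by (rule norm_seq_inner_le[OF sq_summable_obs_seq s])
      also have "\<dots> \<le> (sqrt K * norm x) * seq_norm n s"
        by (intro mult_right_mono norm_obs seq_norm_nonneg s)
      finally show ?thesis by (simp add: algebra_simps)
    qed
  qed
  then obtain v where v: "\<And>x. seq_inner n (obs_seq x) s = cinner x v"
    using riesz_representation[OF hilbert_subspace_UNIV] by (metis UNIV_I)
  define x0 where "x0 = inv G v"
  define b where "b = (\<lambda>j. s j - obs_seq x0 j)"
  have b: "sq_summable n b"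
    unfolding b_def by (intro sq_summable_diff s sq_summable_obs_seq)
  have ob: "seq_inner n (obs_seq x) b = 0" for x
    unfolding b_def
    by (simp add: seq_inner_diff_right s sq_summable_obs_seq v seq_inner_obs_obs gramian_sym x0_def G_inv)
  have "b \<in> complement_seq"
    using b ob seq_inner_commute[OF b sq_summable_obs_seq] by (simp add: complement_seq_def)
  then have "seq_inner n s b = 0" by (rule orth)
  then have "seq_inner n b b = 0"
    using seq_inner_diff_left[OF s sq_summable_obs_seq b, of x0] ob by (simp add: b_def)
  then have "b = (\<lambda>j. 0)"
    using seq_inner_self[OF b] seq_norm_eq_0_iff[OF b] by simp
  then have "s = obs_seq x0"
    unfolding b_def by (metis eq_iff_diff_eq_0 ext)
  then show ?thesis by (rule that)
qed

text \<open>
  A sequence of the complement is wandering iff its backward shift is orthogonal to the complement,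
  that is, observable; this determines all coefficients but the first.
\<close>

lemma wandering_eq:
  "E = {power_series (char_seq x y) | x y. \<forall>x'. cinner y (C x') + cinner (H x) (A x') = 0}"
proof (intro set_eqI iffI)
  fix f assume f: "f \<in> E"
  then obtain a where a: "f = power_series a" "a \<in> complement_seq"
    by (auto simp: wandering_def complement_eq)
  have as: "sq_summable n a" using a by (simp add: complement_seq_def)
  have "seq_inner n (backward_shift a) b = 0" if b: "b \<in> complement_seq" for b
  proof -
    have bs: "sq_summable n b" using b by (simp add: complement_seq_def)
    have "bergman_inner n f (shift (power_series b)) = 0"
      using f b by (auto simp: wandering_def complement_eq)
    then have "seq_inner n a (seq_shift b) = 0"
      by (simp add: a(1) power_series_shift[OF bs, symmetric] bergman_inner_power_series as
          sq_summable_shift bs)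
    then show ?thesis by (simp add: seq_inner_shift_right as bs)
  qed
  then obtain x where x: "backward_shift a = obs_seq x"
    using orthogonal_to_complement[OF sq_summable_backward_shift[OF as]] by blast
  have "a (Suc j) = of_nat (binom n (Suc j)) *\<^sub>C output_at j x" for j
  proof -
    have "complex_of_real (weight n (Suc j)) *\<^sub>C a (Suc j)
        = complex_of_real (weight n j) *\<^sub>C backward_shift a j"
      by (simp add: backward_shift_def scaleC_scaleC)
    also have "\<dots> = output_at j x"
      by (simp add: x obs_seq_def scaleC_scaleC scaleC_one)
    finally have "of_nat (binom n (Suc j)) *\<^sub>C output_at j x
        = (complex_of_real (weight n (Suc j)) * of_nat (binom n (Suc j))) *\<^sub>C a (Suc j)"
      by (metis scaleC_scaleC mult.commute)
    then show ?thesis by (simp add: scaleC_one)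
  qed
  then have "a = char_seq x (a 0)"
    by (auto simp: char_seq_def fun_eq_iff split: nat.split)
  then obtain y where "a = char_seq x y" by blast
  with a show "f \<in> {power_series (char_seq x y) | x y. \<forall>x'. cinner y (C x') + cinner (H x) (A x') = 0}"
    by (auto simp: complement_seq_def seq_inner_char_obs)
next
  fix f assume "f \<in> {power_series (char_seq x y) | x y. \<forall>x'. cinner y (C x') + cinner (H x) (A x') = 0}"
  then obtain x y where f: "f = power_series (char_seq x y)"
    and xy: "\<And>x'. cinner y (C x') + cinner (H x) (A x') = 0" by blast
  have "char_seq x y \<in> complement_seq"
    by (simp add: complement_seq_def sq_summable_char_seq seq_inner_char_obs xy)
  moreover have "bergman_inner n f (shift (power_series b)) = 0" if b: "b \<in> complement_seq" for b
  proof -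
    have bs: "sq_summable n b" using b by (simp add: complement_seq_def)
    have "bergman_inner n f (shift (power_series b)) = seq_inner n (obs_seq x) b"
      by (simp add: f power_series_shift[OF bs, symmetric] bergman_inner_power_series
          sq_summable_char_seq sq_summable_shift bs seq_inner_char_shift)
    also have "\<dots> = 0"
      using b seq_inner_commute[OF sq_summable_obs_seq bs, of x] by (simp add: complement_seq_def)
    finally show ?thesis .
  qed
  ultimately show "f \<in> E"
    by (auto simp: wandering_def complement_eq f)
qed

section \<open>The Cholesky factorization problem\<close>

lemma gramian_adj: "adj A (H (A x)) + adj C (C x) = G x"
  by (rule cinner_extensionality)
    (simp add: cinner_add_left cinner_adj_left[OF A_bounded] cinner_adj_left[OF C_bounded] stein_identity)

text \<open>The sum of the resolvent powers collapses to a single series by \<open>sum_binom_lower\<close>.\<close>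

lemma theta_sums:
  assumes "norm z < 1"
  shows "(\<lambda>j. z ^ j *\<^sub>C char_seq (B u) (D u) j) sums theta n C A B D z u"
proof -
  have eq: "(\<Sum>k=1..n. (of_nat (binom k j) * z ^ j) *\<^sub>C (A ^^ j) (B u))
      = (of_nat (binom n (Suc j)) * z ^ j) *\<^sub>C (A ^^ j) (B u)" for j
    by (simp flip: sum_binom_lower scaleC.sum_left sum_distrib_right add: of_nat_sum)
  have "(\<lambda>j. \<Sum>k=1..n. (of_nat (binom k j) * z ^ j) *\<^sub>C (A ^^ j) (B u)) sums
      (\<Sum>k=1..n. resolvent_series z k (B u))"
    by (intro sums_sum resolvent_series_sums assms)
  then have "(\<lambda>j. (of_nat (binom n (Suc j)) * z ^ j) *\<^sub>C (A ^^ j) (B u)) sums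
      (\<Sum>k=1..n. (resolvent A z ^^ k) (B u))"
    by (simp only: eq resolvent_power[OF assms])
  then have "(\<lambda>j. z *\<^sub>C C ((of_nat (binom n (Suc j)) * z ^ j) *\<^sub>C (A ^^ j) (B u))) sums
      (z *\<^sub>C C (\<Sum>k=1..n. (resolvent A z ^^ k) (B u)))"
    by (intro bounded_linear.sums[OF scaleC.bounded_linear_right]
        bounded_linear.sums[OF bounded_op_on_UNIV_bounded_linear[OF C_bounded]])
  then have "(\<lambda>j. z ^ Suc j *\<^sub>C char_seq (B u) (D u) (Suc j)) sums
      (z *\<^sub>C C (\<Sum>k=1..n. (resolvent A z ^^ k) (B u)))"
    using bounded_op_onD(2)[OF C_bounded]
    by (simp add: char_seq_def output_at_def scaleC_scaleC mult_ac)
  from sums_Suc[OF this] show ?thesis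
    by (simp add: theta_def char_seq_def scaleC_one add.commute)
qed

lemma mult_op_theta_const:
  "mult_op (theta n C A B D) (\<lambda>z. u) = power_series (char_seq (B u) (D u))"
  using theta_sums[of _ B u D] power_series_sums[OF sq_summable_char_seq]
  by (auto simp: mult_op_def fun_eq_iff power_series_def sums_iff)

text \<open>
  With \<open>L\<close> a symmetric square root of \<open>H\<close>, the operator \<open>(x, y) \<mapsto> (L\<^sup>-\<^sup>1 x, y)\<close> is unitary from the
  standard inner product to the inner product \<open>\<langle>H x, x'\<rangle> + \<langle>y, y'\<rangle>\<close>. The right-hand side of the
  factorization problem is the orthogonal projection, for the latter inner product, onto the
  complement of \<open>{(A w, C w)}\<close>, multiplied by \<open>diag (H\<^sup>-\<^sup>1, 1)\<close>; hence restricting that unitary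
  to the preimage of this complement solves the problem.
\<close>

theorem cholesky_solution_exists:
  "\<exists>(U :: ('x \<times> 'y) set) B D. hilbert_subspace U \<and> cholesky_solution n C A U B D"
proof -
  obtain L where Lb: "bounded_op_on UNIV L" and Lsym: "\<And>x y. cinner (L x) y = cinner x (L y)"
    and LL: "\<And>x. L (L x) = H x"
    using positive_definite_square_root[OF shifted_gramian_positive_definite] by blast
  \<comment> \<open>The inverse of \<open>L\<close>.\<close>
  define J where "J x = L (inv H x)" for x
  have LJ: "L (J x) = x" for x by (simp add: J_def LL H_inv)
  have HL: "H (L x) = L (H x)" for x by (metis LL)
  have JL: "J (L x) = x" for x
    by (metis HL LL LJ J_def H_inv inv_H)
  have JJ: "J (J x) = inv H x" for x
    by (metis JL LJ LL inv_H)
  have Jsym: "cinner (J x) y = cinner x (J y)" for x y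
    by (metis LJ Lsym)
  have J_add: "J (x + y) = J x + J y" for x y
    by (metis JL LJ bounded_op_onD(1)[OF Lb] UNIV_I)
  have J_scale: "J (a *\<^sub>C x) = a *\<^sub>C J x" for a x
    by (metis JL LJ bounded_op_onD(2)[OF Lb] UNIV_I)
  have J_diff: "J (x - y) = J x - J y" for x y
    using J_add[of "x - y" y] by simp
  obtain \<epsilon> where \<epsilon>: "\<epsilon> > 0" "\<And>x. \<epsilon> * (norm x)\<^sup>2 \<le> Re (cinner (H x) x)"
    using shifted_gramian_positive_definite by (auto simp: positive_definite_def)
  have J_norm: "norm (J x) \<le> (1 / sqrt \<epsilon>) * norm x" for x
  proof (rule power2_le_imp_le)
    have "cinner (H (J x)) (J x) = cinner x x"
      by (metis LL LJ Lsym)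
    then have "\<epsilon> * (norm (J x))\<^sup>2 \<le> (norm x)\<^sup>2"
      using \<epsilon>(2)[of "J x"] by (simp add: cinner_self)
    then show "(norm (J x))\<^sup>2 \<le> ((1 / sqrt \<epsilon>) * norm x)\<^sup>2"
      using \<epsilon>(1) by (simp add: power_mult_distrib power_divide field_simps)
  qed (use \<epsilon>(1) in simp)
  define U :: "('x \<times> 'y) set" where
    "U = (\<Inter>x'. {p. cinner (snd p) (C x') + cinner (fst p) (L (A x')) = 0})"
  define B :: "'x \<times> 'y \<Rightarrow> 'x" where "B p = J (fst p)" for p
  define D :: "'x \<times> 'y \<Rightarrow> 'y" where "D p = snd p" for p
  have UD: "cinner (snd p) (C x') + cinner (fst p) (L (A x')) = 0" if "p \<in> U" for p x'
    using that by (auto simp: U_def)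
  have "closed U"
    unfolding U_def
    by (intro closed_INT ballI closed_Collect_eq continuous_intros cinner.continuous_on)
  then have U: "hilbert_subspace U"
    unfolding hilbert_subspace_def
    by (auto simp: U_def cinner.zero_left cinner_add_left scaleC_prod_def cinner_scaleC_left
        add_ac simp flip: distrib_left)
  have Bb: "bounded_op_on U B"
    unfolding bounded_op_on_def
  proof (intro conjI ballI allI exI)
    show "norm (B p) \<le> (1 / sqrt \<epsilon>) * norm p" for p
    proof -
      have "norm (B p) \<le> (1 / sqrt \<epsilon>) * norm (fst p)" unfolding B_def by (rule J_norm)
      also have "\<dots> \<le> (1 / sqrt \<epsilon>) * norm p"
        using \<epsilon>(1) norm_fst_le[of "fst p" "snd p"] by (intro mult_left_mono) auto
      finally show ?thesis .
    qed
  qed (simp_all add: B_def J_add J_scale scaleC_prod_def)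
  have "norm (D p) \<le> 1 * norm p" for p
    using norm_snd_le[of "snd p" "fst p"] by (simp add: D_def)
  then have Db: "bounded_op_on U D"
    unfolding bounded_op_on_def
    by (intro conjI ballI allI exI[of _ 1]) (simp_all only: D_def scaleC_prod_def snd_add snd_conv)
  have "inj_on (\<lambda>u. (B u, D u)) U"
    by (intro inj_onI) (metis B_def D_def LJ prod.inject prod.collapse)
  moreover have "(B u, D u) = (inv H x, y) - (A w, C w)"
    if u_def: "u = adj_on U B x + adj_on U D y" and w_def: "w = inv G (adj A x + adj C y)" for x y u w
  proof -
    \<comment> \<open>The orthogonal projection of \<open>(J x, y)\<close> onto \<open>U\<close>.\<close>
    define v where "v = (J x - L (A w), y - C w)"
    have Gw: "cinner x (A x') + cinner y (C x') = cinner (C w) (C x') + cinner (H (A w)) (A x')" for x'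
      using stein_identity[of w x']
      by (simp add: w_def G_inv cinner_add_left cinner_adj_left[OF A_bounded] cinner_adj_left[OF C_bounded])
    have "v \<in> U"
      using Gw by (auto simp: U_def v_def cinner.diff_left Jsym LL[symmetric] Lsym LJ JL)
        (simp add: algebra_simps)
    moreover have "cinner p v = cinner (B p) x + cinner (D p) y" if "p \<in> U" for p
      using UD[OF that, of w]
      by (simp add: v_def cinner_prod_def B_def D_def cinner.diff_right Jsym algebra_simps)
    ultimately have "cinner (u - v) (u - v) = 0"
      using hilbert_subspaceD(6)[OF U, of u v] hilbert_subspaceD(3)[OF U] adj_on_in[OF U Bb] adj_on_in[OF U Db]
        cinner_adj_on[OF U Bb] cinner_adj_on[OF U Db]
      by (simp add: u_def cinner.diff_right cinner_add_right)
    then have "u = v" by (simp add: cinner_self)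
    then show ?thesis
      by (simp add: v_def B_def D_def J_diff JJ JL)
  qed
  ultimately have "cholesky_solution n C A U B D"
    using Bb Db by (simp add: cholesky_solution_def Let_def)
  with U show ?thesis by blast
qed

end

locale cholesky_factor = exactly_observable_pair n A C
  for n :: nat and A :: "'x::complex_hilbert \<Rightarrow> 'x" and C :: "'x \<Rightarrow> 'y::complex_hilbert" +
  fixes U :: "'u::complex_hilbert set" and B :: "'u \<Rightarrow> 'x" and D :: "'u \<Rightarrow> 'y"
  assumes U: "hilbert_subspace U" and cholesky: "cholesky_solution n C A U B D"
begin

abbreviation "\<Theta> \<equiv> theta n C A B D"

lemma B_bounded: "bounded_op_on U B" and D_bounded: "bounded_op_on U D"
  using cholesky by (auto simp: cholesky_solution_def)

lemma U_zero: "0 \<in> U" and U_add: "u \<in> U \<Longrightarrow> v \<in> U \<Longrightarrow> u + v \<in> U"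
  and U_scaleC: "u \<in> U \<Longrightarrow> c *\<^sub>C u \<in> U" and U_diff: "u \<in> U \<Longrightarrow> v \<in> U \<Longrightarrow> u - v \<in> U"
  using hilbert_subspaceD[OF U] by auto

text \<open>The adjoint of the column operator \<open>u \<mapsto> (B u, D u)\<close>.\<close>

definition T_adj :: "'x \<Rightarrow> 'y \<Rightarrow> 'u" where
  "T_adj x y = adj_on U B x + adj_on U D y"

lemma T_adj_in: "T_adj x y \<in> U"
  by (simp add: T_adj_def U_add adj_on_in[OF U B_bounded] adj_on_in[OF U D_bounded])

lemma cinner_T_adj: "u \<in> U \<Longrightarrow> cinner u (T_adj x y) = cinner (B u) x + cinner (D u) y"
  by (simp add: T_adj_def cinner_add_right cinner_adj_on[OF U B_bounded] cinner_adj_on[OF U D_bounded])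

lemma T_T_adj:
  assumes "w = inv G (adj A x + adj C y)"
  shows "B (T_adj x y) = inv H x - A w" "D (T_adj x y) = y - C w"
  using cholesky assms by (simp_all add: cholesky_solution_def T_adj_def Let_def)

lemma T_inj: "u \<in> U \<Longrightarrow> v \<in> U \<Longrightarrow> B u = B v \<Longrightarrow> D u = D v \<Longrightarrow> u = v"
  using cholesky by (auto simp: cholesky_solution_def inj_on_def)

text \<open>
  By the Stein identity the right-hand side of the factorization annihilates \<open>(H A x, C x)\<close>. Since
  the left factor is injective, the right factor annihilates it already.
\<close>

lemma T_orthogonal:
  assumes "u \<in> U"
  shows "cinner (D u) (C x) + cinner (H (B u)) (A x) = 0"
proof -
  have w: "x = inv G (adj A (H (A x)) + adj C (C x))"
    by (simp add: gramian_adj inv_G)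
  have "B 0 = 0" "D 0 = 0"
    using bounded_op_onD(2)[OF B_bounded U_zero, of 0] bounded_op_onD(2)[OF D_bounded U_zero, of 0]
    by (simp_all add: scaleC.zero_left)
  then have "T_adj (H (A x)) (C x) = 0"
    using T_T_adj[OF w] by (intro T_inj T_adj_in U_zero) (simp_all add: inv_H)
  then show ?thesis
    using cinner_T_adj[OF assms, of "H (A x)" "C x"]
    by (simp add: cinner.zero_right shifted_gramian_sym add.commute)
qed

text \<open>
  Under the hypothesis the correction term \<open>G\<^sup>-\<^sup>1 (A\<^sup>* H x + C\<^sup>* y)\<close> vanishes, so the factorized operator
  sends \<open>(H x, y)\<close> to \<open>(x, y)\<close>.
\<close>

lemma T_onto:
  assumes "\<And>x'. cinner y (C x') + cinner (H x) (A x') = 0"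
  shows "B (T_adj (H x) y) = x" "D (T_adj (H x) y) = y"
proof -
  have "adj A (H x) + adj C y = 0"
    by (rule cinner_extensionality)
      (use assms in \<open>simp add: cinner_add_left cinner_adj_left[OF A_bounded]
        cinner_adj_left[OF C_bounded] cinner.zero_left add.commute\<close>)
  moreover have "G 0 = 0"
    by (rule cinner_extensionality) (simp add: gramian_sym cinner.zero_left)
  then have "inv G 0 = 0"
    by (metis inv_G)
  ultimately have w: "0 = inv G (adj A (H x) + adj C y)"
    by simp
  have "A 0 = 0" "C 0 = 0"
    using bounded_op_onD(2)[OF A_bounded UNIV_I, of 0 0] bounded_op_onD(2)[OF C_bounded UNIV_I, of 0 0]
    by (simp_all add: scaleC.zero_left)
  then show "B (T_adj (H x) y) = x" "D (T_adj (H x) y) = y"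
    using T_T_adj[OF w] by (simp_all add: inv_H)
qed

text \<open>
  The two preceding facts combine to \<open>T T\<^sup>* W T = T\<close> for \<open>T u = (B u, D u)\<close> and \<open>W = diag (H, 1)\<close>;
  cancelling the injective \<open>T\<close> leaves \<open>T\<^sup>* W T = 1\<close>.
\<close>

lemma T_isometry:
  assumes "u \<in> U" "v \<in> U"
  shows "cinner (D u) (D v) + cinner (H (B u)) (B v) = cinner u v"
proof -
  have "T_adj (H (B v)) (D v) = v"
    using T_onto[OF T_orthogonal[OF assms(2)]] by (intro T_inj T_adj_in assms) simp_all
  then show ?thesis
    using cinner_T_adj[OF assms(1), of "H (B v)" "D v"] by (simp add: shifted_gramian_sym)
qed

section \<open>The wandering subspace and its kernel\<close>

abbreviation theta_seq :: "'u \<Rightarrow> nat \<Rightarrow> 'y" where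
  "theta_seq u \<equiv> char_seq (B u) (D u)"

lemma theta_eq: "norm z < 1 \<Longrightarrow> \<Theta> z u = power_series (theta_seq u) z"
  by (rule sums_unique2[OF theta_sums power_series_sums[OF sq_summable_char_seq]])

lemma theta_seq_add:
  assumes "u \<in> U" "v \<in> U"
  shows "theta_seq (u + v) = (\<lambda>j. theta_seq u j + theta_seq v j)"
  using bounded_op_onD(1)[OF B_bounded assms] bounded_op_onD(1)[OF D_bounded assms]
  by (auto simp: char_seq_def fun_eq_iff output_at_add scaleC_add_right split: nat.split)

lemma theta_seq_scaleC:
  assumes "u \<in> U"
  shows "theta_seq (c *\<^sub>C u) = (\<lambda>j. c *\<^sub>C theta_seq u j)"
  using bounded_op_onD(2)[OF B_bounded assms] bounded_op_onD(2)[OF D_bounded assms]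
  by (auto simp: char_seq_def fun_eq_iff output_at_scaleC scaleC_scaleC mult.commute split: nat.split)

lemma theta_seq_inner: "u \<in> U \<Longrightarrow> v \<in> U \<Longrightarrow> seq_inner n (theta_seq u) (theta_seq v) = cinner u v"
  by (simp add: seq_inner_char_char T_isometry)

lemma theta_seq_norm:
  assumes "u \<in> U"
  shows "seq_norm n (theta_seq u) = norm u"
proof -
  have "(seq_norm n (theta_seq u))\<^sup>2 = (norm u)\<^sup>2"
    using seq_inner_self[OF sq_summable_char_seq, of "B u" "D u"] theta_seq_inner[OF assms assms]
    by (metis cinner_self of_real_eq_iff)
  then show ?thesis
    using seq_norm_nonneg[OF sq_summable_char_seq] by (simp add: power2_eq_iff_nonneg)
qed

lemma theta_seq_complement: "u \<in> U \<Longrightarrow> theta_seq u \<in> complement_seq"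
  by (simp add: complement_seq_def sq_summable_char_seq seq_inner_char_obs T_orthogonal)

lemma theta_bounded:
  assumes "norm z < 1"
  shows "bounded_op_on U (\<Theta> z)"
  unfolding bounded_op_on_def
proof (intro conjI ballI allI exI)
  fix u v c assume u: "u \<in> U" and v: "v \<in> U"
  show "\<Theta> z (u + v) = \<Theta> z u + \<Theta> z v"
    by (simp add: theta_eq[OF assms] theta_seq_add u v power_series_add sq_summable_char_seq)
next
  fix u c assume u: "u \<in> U"
  show "\<Theta> z (c *\<^sub>C u) = c *\<^sub>C \<Theta> z u"
    by (simp add: theta_eq[OF assms] theta_seq_scaleC u power_series_scaleC sq_summable_char_seq)
next
  fix u assume u: "u \<in> U"
  show "norm (\<Theta> z u) \<le> sqrt (\<Sum>j. real (binom n j) * (norm z ^ j)\<^sup>2) * norm u"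
    using norm_power_series_le[OF sq_summable_char_seq assms, of "B u" "D u"]
    by (simp add: theta_eq[OF assms] theta_seq_norm u)
qed

lemma wandering_eq_theta: "E = (\<lambda>u. mult_op \<Theta> (\<lambda>z. u)) ` U"
  unfolding wandering_eq mult_op_theta_const
  using T_orthogonal T_onto T_adj_in by (auto simp: image_iff) metis

lemma inner_theta:
  "u \<in> U \<Longrightarrow> v \<in> U \<Longrightarrow> bergman_inner n (mult_op \<Theta> (\<lambda>z. u)) (mult_op \<Theta> (\<lambda>z. v)) = cinner u v"
  by (simp add: mult_op_theta_const bergman_inner_power_series sq_summable_char_seq theta_seq_inner)

text \<open>
  Since \<open>u \<mapsto> \<Theta>(\<cdot>) u\<close> is unitary onto \<open>E\<close>, evaluation at \<open>\<zeta>\<close> followed by pairing with \<open>y\<close> is represented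
  by the image of \<open>\<Theta>(\<zeta>)\<^sup>* y\<close>.
\<close>

lemma kernel_of_wandering:
  assumes \<zeta>: "norm \<zeta> < 1"
  shows "(\<lambda>z. kernel_of n E z \<zeta> y) = mult_op \<Theta> (\<lambda>z. adj_on U (\<Theta> \<zeta>) y)" (is "_ = ?h")
    and "\<forall>f\<in>E. bergman_inner n f (mult_op \<Theta> (\<lambda>z. adj_on U (\<Theta> \<zeta>) y)) = cinner (f \<zeta>) y"
proof -
  define u where "u = adj_on U (\<Theta> \<zeta>) y"
  have u: "u \<in> U" "\<And>v. v \<in> U \<Longrightarrow> cinner v u = cinner (\<Theta> \<zeta> v) y"
    using adj_on_in[OF U theta_bounded[OF \<zeta>]] cinner_adj_on[OF U theta_bounded[OF \<zeta>]]
    by (auto simp: u_def)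
  show repr: "\<forall>f\<in>E. bergman_inner n f (mult_op \<Theta> (\<lambda>z. adj_on U (\<Theta> \<zeta>) y)) = cinner (f \<zeta>) y"
    using u \<zeta> by (auto simp: wandering_eq_theta inner_theta u_def[symmetric] mult_op_def[of _ _ \<zeta>])
  have "(THE h. h \<in> E \<and> (\<forall>f\<in>E. bergman_inner n f h = cinner (f \<zeta>) y)) = ?h"
  proof (rule the_equality)
    show "?h \<in> E \<and> (\<forall>f\<in>E. bergman_inner n f ?h = cinner (f \<zeta>) y)"
      using repr u(1) by (auto simp: wandering_eq_theta u_def)
    fix h assume h: "h \<in> E \<and> (\<forall>f\<in>E. bergman_inner n f h = cinner (f \<zeta>) y)"
    then obtain v where v: "v \<in> U" "h = mult_op \<Theta> (\<lambda>z. v)"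
      by (auto simp: wandering_eq_theta)
    have "cinner p v = cinner p u" if "p \<in> U" for p
    proof -
      have "mult_op \<Theta> (\<lambda>z. p) \<in> E"
        using that by (auto simp: wandering_eq_theta)
      then have "bergman_inner n (mult_op \<Theta> (\<lambda>z. p)) h = bergman_inner n (mult_op \<Theta> (\<lambda>z. p)) ?h"
        using h repr by simp
      then show ?thesis
        using that u(1) v by (simp add: inner_theta flip: u_def)
    qed
    then have "cinner (v - u) (v - u) = 0"
      using u v by (simp add: cinner.diff_right U_diff)
    then show "h = ?h"
      using v by (simp add: cinner_self u_def)
  qed
  then show "(\<lambda>z. kernel_of n E z \<zeta> y) = ?h"
    by (simp add: kernel_of_def[abs_def])
qed

lemma reproducing_kernel_wandering: "reproducing_kernel n E (kernel_of n E)"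
  unfolding reproducing_kernel_def
proof (intro allI impI)
  fix \<zeta> :: complex and y :: 'y assume \<zeta>: "norm \<zeta> < 1"
  have "mult_op \<Theta> (\<lambda>z. adj_on U (\<Theta> \<zeta>) y) \<in> E"
    using adj_on_in[OF U theta_bounded[OF \<zeta>]] by (auto simp: wandering_eq_theta)
  then show "(\<lambda>z. kernel_of n E z \<zeta> y) \<in> E \<and>
      (\<forall>f\<in>E. bergman_inner n f (\<lambda>z. kernel_of n E z \<zeta> y) = cinner (f \<zeta>) y)"
    using kernel_of_wandering[OF \<zeta>] by simp
qed

lemma kernel_of_eq:
  assumes "norm z < 1" "norm \<zeta> < 1"
  shows "kernel_of n E z \<zeta> y = \<Theta> z (adj_on U (\<Theta> \<zeta>) y)"
  using fun_cong[OF kernel_of_wandering(1)[OF assms(2)], of z y] assms(1) by (simp add: mult_op_def)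

end

section \<open>The multiplier on the Hardy space\<close>

lemma power_series_in_subspace:
  assumes V: "hilbert_subspace V" and "\<And>j. a j \<in> V" "(\<lambda>j. z ^ j *\<^sub>C a j) sums s"
  shows "s \<in> V"
proof (rule closed_sequentially[OF hilbert_subspaceD(1)[OF V]])
  show "(\<Sum>j<N. z ^ j *\<^sub>C a j) \<in> V" for N
    by (intro hilbert_subspace_sum[OF V] hilbert_subspaceD(4)[OF V] assms(2))
  show "(\<lambda>N. \<Sum>j<N. z ^ j *\<^sub>C a j) \<longlonglongrightarrow> s"
    using assms(3) unfolding sums_def .
qed

interpretation hardy: bergman_index 1
  by standard simp

context cholesky_factor
begin

text \<open>The coefficients of \<open>\<Theta> h\<close> when \<open>h\<^sub>j\<close> are the coefficients of \<open>h\<close>.\<close>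

definition conv :: "(nat \<Rightarrow> 'u) \<Rightarrow> nat \<Rightarrow> 'y" where
  "conv h m = (\<Sum>j\<le>m. theta_seq (h j) (m - j))"

lemma conv_split_head:
  "conv h = (\<lambda>m. theta_seq (h 0) m + seq_shift (conv (\<lambda>j. h (Suc j))) m)"
proof
  fix m show "conv h m = theta_seq (h 0) m + seq_shift (conv (\<lambda>j. h (Suc j))) m"
    by (cases m) (simp_all add: conv_def sum.atMost_Suc_shift del: sum.atMost_Suc)
qed

lemma theta_seq_0: "theta_seq 0 = (\<lambda>j. 0)"
  using theta_seq_scaleC[OF U_zero, of 0] by (simp add: scaleC.zero_left)

text \<open>
  Splitting off the constant coefficient writes the product as an element of \<open>E\<close> plus the shift of
  an element of \<open>M\<close>. These are orthogonal, and the shift is a contraction.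
\<close>

lemma conv_finite:
  assumes "\<And>j. h j \<in> U" "\<And>j. N \<le> j \<Longrightarrow> h j = 0"
  shows "conv h \<in> complement_seq \<and> (seq_norm n (conv h))\<^sup>2 \<le> (\<Sum>j<N. (norm (h j))\<^sup>2) \<and>
    (\<forall>z. norm z < 1 \<longrightarrow> power_series (conv h) z = \<Theta> z (\<Sum>j<N. z ^ j *\<^sub>C h j))"
  using assms
proof (induction N arbitrary: h)
  case 0
  then have "conv h = (\<lambda>m. 0)"
    by (simp add: conv_def fun_eq_iff theta_seq_0)
  moreover have "(\<lambda>m. 0) \<in> complement_seq"
    using theta_seq_complement[OF U_zero] by (simp add: theta_seq_0)
  ultimately show ?case
    by (simp add: seq_norm_def theta_eq theta_seq_0)
next
  case (Suc N)
  define k where "k = conv (\<lambda>j. h (Suc j))"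
  define a where "a = theta_seq (h 0)"
  have k: "k \<in> complement_seq" "(seq_norm n k)\<^sup>2 \<le> (\<Sum>j<N. (norm (h (Suc j)))\<^sup>2)"
    "\<And>z. norm z < 1 \<Longrightarrow> power_series k z = \<Theta> z (\<Sum>j<N. z ^ j *\<^sub>C h (Suc j))"
    using Suc.IH[of "\<lambda>j. h (Suc j)"] Suc.prems by (simp_all add: k_def)
  have ks: "sq_summable n k" "\<And>x. seq_inner n k (obs_seq x) = 0"
    using k(1) by (simp_all add: complement_seq_def)
  have as: "sq_summable n a" and a: "a \<in> complement_seq" "seq_norm n a = norm (h 0)"
    using Suc.prems(1) by (simp_all add: a_def sq_summable_char_seq theta_seq_complement theta_seq_norm)
  have eq: "conv h = (\<lambda>m. a m + seq_shift k m)"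
    unfolding a_def k_def by (rule conv_split_head)
  have "seq_inner n a (seq_shift k) = 0"
    using seq_inner_commute[OF sq_summable_obs_seq ks(1)]
    by (simp add: a_def seq_inner_char_shift ks)
  then have "(seq_norm n (conv h))\<^sup>2 = (norm (h 0))\<^sup>2 + (seq_norm n (seq_shift k))\<^sup>2"
    unfolding eq by (simp add: seq_norm_add_orthogonal as sq_summable_shift ks a)
  also have "\<dots> \<le> (norm (h 0))\<^sup>2 + (seq_norm n k)\<^sup>2"
    by (intro add_left_mono power_mono seq_norm_shift_le ks seq_norm_nonneg sq_summable_shift)
  also have "\<dots> \<le> (\<Sum>j<Suc N. (norm (h j))\<^sup>2)"
    using k(2) by (simp add: sum.lessThan_Suc_shift del: sum.lessThan_Suc)
  finally have 1: "(seq_norm n (conv h))\<^sup>2 \<le> (\<Sum>j<Suc N. (norm (h j))\<^sup>2)" .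
  have 2: "conv h \<in> complement_seq"
    unfolding eq by (intro complement_seq_add complement_seq_shift a k)
  have "power_series (conv h) z = \<Theta> z (\<Sum>j<Suc N. z ^ j *\<^sub>C h j)" if z: "norm z < 1" for z
  proof -
    have S: "(\<Sum>j<N. z ^ j *\<^sub>C h (Suc j)) \<in> U"
      by (intro hilbert_subspace_sum[OF U] U_scaleC Suc.prems)
    have "(\<Sum>j<Suc N. z ^ j *\<^sub>C h j) = h 0 + z *\<^sub>C (\<Sum>j<N. z ^ j *\<^sub>C h (Suc j))"
      by (simp add: sum.lessThan_Suc_shift scaleC_one scaleC.sum_right scaleC_scaleC del: sum.lessThan_Suc)
    then have "\<Theta> z (\<Sum>j<Suc N. z ^ j *\<^sub>C h j) = \<Theta> z (h 0) + z *\<^sub>C \<Theta> z (\<Sum>j<N. z ^ j *\<^sub>C h (Suc j))"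
      using bounded_op_onD(1)[OF theta_bounded[OF z] Suc.prems(1) U_scaleC[OF S]]
        bounded_op_onD(2)[OF theta_bounded[OF z] S] by simp
    also have "\<dots> = power_series a z + shift (power_series k) z"
      using z by (simp add: theta_eq a_def[symmetric] k(3) shift_def)
    also have "\<dots> = power_series (conv h) z"
      unfolding eq by (simp add: power_series_add as sq_summable_shift ks power_series_shift)
    finally show ?thesis by simp
  qed
  with 1 2 show ?case by blast
qed

text \<open>The coefficients below \<open>N\<close> of the product depend only on those of \<open>h\<close> below \<open>N\<close>.\<close>

lemma conv_norm_le:
  assumes h: "\<And>j. h j \<in> U" and s: "summable (\<lambda>j. (norm (h j))\<^sup>2)"
  shows "sq_summable n (conv h)" "(seq_norm n (conv h))\<^sup>2 \<le> (\<Sum>j. (norm (h j))\<^sup>2)"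
proof -
  have le: "(\<Sum>m<N. weight n m * (norm (conv h m))\<^sup>2) \<le> (\<Sum>j. (norm (h j))\<^sup>2)" for N
  proof -
    define h' where "h' j = (if j < N then h j else 0)" for j
    have h': "\<And>j. h' j \<in> U" "\<And>j. N \<le> j \<Longrightarrow> h' j = 0"
      using h U_zero by (auto simp: h'_def)
    have cs: "sq_summable n (conv h')" and cn: "(seq_norm n (conv h'))\<^sup>2 \<le> (\<Sum>j<N. (norm (h' j))\<^sup>2)"
      using conv_finite[of h' N] h' by (auto simp: complement_seq_def)
    have "(\<Sum>m<N. weight n m * (norm (conv h m))\<^sup>2) = (\<Sum>m<N. weight n m * (norm (conv h' m))\<^sup>2)"
      by (intro sum.cong refl) (simp add: conv_def h'_def)
    also have "\<dots> \<le> (\<Sum>m. weight n m * (norm (conv h' m))\<^sup>2)"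
      using cs unfolding sq_summable_def by (rule sum_le_suminf) auto
    also have "\<dots> \<le> (\<Sum>j<N. (norm (h' j))\<^sup>2)"
      using cn by (simp add: seq_norm_square[OF cs])
    also have "\<dots> = (\<Sum>j<N. (norm (h j))\<^sup>2)"
      by (intro sum.cong) (simp_all add: h'_def)
    also have "\<dots> \<le> (\<Sum>j. (norm (h j))\<^sup>2)"
      using s by (rule sum_le_suminf) auto
    finally show ?thesis .
  qed
  then show cs: "sq_summable n (conv h)"
    unfolding sq_summable_def by (intro summableI_nonneg_bounded) auto
  show "(seq_norm n (conv h))\<^sup>2 \<le> (\<Sum>j. (norm (h j))\<^sup>2)"
    unfolding seq_norm_square[OF cs] using cs[unfolded sq_summable_def] le by (rule suminf_le_const)
qed

text \<open>By linearity the error is the product with the tail of \<open>h\<close>, to which the norm bound applies.\<close>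

lemma conv_approx:
  assumes h: "\<And>j. h j \<in> U" and s: "summable (\<lambda>j. (norm (h j))\<^sup>2)"
  shows "(\<lambda>N. seq_norm n (\<lambda>m. conv h m - conv (\<lambda>j. if j < N then h j else 0) m)) \<longlonglongrightarrow> 0"
proof -
  define tail where "tail N j = (if j < N then 0 else h j)" for N j
  have tU: "tail N j \<in> U" for N j
    using h U_zero by (simp add: tail_def)
  have "(\<lambda>j. (norm (tail N (j + N)))\<^sup>2) = (\<lambda>j. (norm (h (j + N)))\<^sup>2)" for N
    by (simp add: tail_def)
  then have ts: "summable (\<lambda>j. (norm (tail N j))\<^sup>2)" for N
    using s by (metis summable_iff_shift[of "\<lambda>j. (norm (tail N j))\<^sup>2" N]
        summable_iff_shift[of "\<lambda>j. (norm (h j))\<^sup>2" N])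
  have tsum: "(\<Sum>j. (norm (tail N j))\<^sup>2) = (\<Sum>j. (norm (h (j + N)))\<^sup>2)" for N
    using suminf_split_initial_segment[OF ts, of N N] by (simp add: tail_def)
  have eq: "(\<lambda>m. conv h m - conv (\<lambda>j. if j < N then h j else 0) m) = conv (tail N)" for N
  proof
    fix m
    have "theta_seq (h j) i - theta_seq (if j < N then h j else 0) i = theta_seq (tail N j) i" for i j
      by (simp add: tail_def theta_seq_0)
    then show "conv h m - conv (\<lambda>j. if j < N then h j else 0) m = conv (tail N) m"
      by (simp add: conv_def flip: sum_subtractf)
  qed
  have "(\<lambda>N. sqrt (\<Sum>j. (norm (h (j + N)))\<^sup>2)) \<longlonglongrightarrow> sqrt 0"
    by (intro tendsto_real_sqrt suminf_exist_split2 s)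
  then have lim: "(\<lambda>N. sqrt (\<Sum>j. (norm (h (j + N)))\<^sup>2)) \<longlonglongrightarrow> 0" by simp
  show ?thesis
    unfolding eq
  proof (rule Lim_null_comparison[OF _ lim], rule always_eventually, rule allI)
    fix N
    have "seq_norm n (conv (tail N)) \<le> sqrt (\<Sum>j. (norm (h (j + N)))\<^sup>2)"
      using conv_norm_le(2)[of "tail N", OF tU ts] by (intro real_le_rsqrt) (simp add: tsum)
    then show "norm (seq_norm n (conv (tail N))) \<le> sqrt (\<Sum>j. (norm (h (j + N)))\<^sup>2)"
      using seq_norm_nonneg[OF conv_norm_le(1)[of "tail N", OF tU ts]] by simp
  qed
qed

text \<open>
  The truncations converge in norm, hence pointwise by the boundedness of evaluations, to the function
  with coefficients \<open>conv h\<close>; they also converge pointwise to \<open>\<Theta> h\<close> by the continuity of each \<open>\<Theta>(z)\<close>.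
  Membership in the closed subspace \<open>M\<close> passes to the norm limit.
\<close>

lemma
  assumes h: "\<And>j. h j \<in> U" and s: "summable (\<lambda>j. (norm (h j))\<^sup>2)"
  shows conv_complement: "conv h \<in> complement_seq"
    and mult_op_power_series: "mult_op \<Theta> (power_series h) = power_series (conv h)"
proof -
  define t where "t N j = (if j < N then h j else 0)" for N j
  have cs: "sq_summable n (conv h)"
    by (rule conv_norm_le(1)[of h, OF h s])
  have lim: "(\<lambda>N. seq_norm n (\<lambda>m. conv h m - conv (t N) m)) \<longlonglongrightarrow> 0"
    unfolding t_def by (rule conv_approx[of h, OF h s])
  have "(\<Sum>j<N. z ^ j *\<^sub>C t N j) = (\<Sum>j<N. z ^ j *\<^sub>C h j)" for N z
    by (intro sum.cong) (simp_all add: t_def)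
  moreover have "t N j \<in> U" "N \<le> j \<Longrightarrow> t N j = 0" for N j
    using h U_zero by (simp_all add: t_def)
  ultimately have t: "conv (t N) \<in> complement_seq"
    "\<And>z. norm z < 1 \<Longrightarrow> power_series (conv (t N)) z = \<Theta> z (\<Sum>j<N. z ^ j *\<^sub>C h j)" for N
    using conv_finite[of "t N" N] by simp_all
  have ts: "sq_summable n (conv (t N))" for N
    using t(1) by (auto simp: complement_seq_def)
  show "conv h \<in> complement_seq"
  proof (rule complement_seq_closed[OF cs])
    fix e :: real assume "e > 0"
    then have "\<forall>\<^sub>F N in sequentially. seq_norm n (\<lambda>m. conv h m - conv (t N) m) < e"
      by (rule order_tendstoD(2)[OF lim])
    then obtain N where "seq_norm n (\<lambda>m. conv h m - conv (t N) m) < e"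
      unfolding eventually_sequentially by blast
    with t(1) show "\<exists>b\<in>complement_seq. seq_norm n (\<lambda>j. conv h j - b j) < e" by blast
  qed
  have hs: "sq_summable 1 h"
    using s by (simp add: sq_summable_def weight_def)
  have "\<Theta> z (power_series h z) = power_series (conv h) z" if z: "norm z < 1" for z
  proof (rule LIMSEQ_unique)
    have sums: "(\<lambda>j. z ^ j *\<^sub>C h j) sums power_series h z"
      by (rule hardy.power_series_sums[OF hs z])
    have hz: "power_series h z \<in> U"
      by (rule power_series_in_subspace[OF U h sums])
    have pU: "(\<Sum>j<N. z ^ j *\<^sub>C h j) \<in> U" for N
      by (intro hilbert_subspace_sum[OF U] U_scaleC h)
    obtain K where K: "K > 0" "\<And>u. u \<in> U \<Longrightarrow> norm (\<Theta> z u) \<le> K * norm u"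
      using bounded_op_on_bound[OF theta_bounded[OF z]] by blast
    have diff: "\<Theta> z u - \<Theta> z v = \<Theta> z (u - v)" if "u \<in> U" "v \<in> U" for u v
      using bounded_op_onD(1)[OF theta_bounded[OF z] U_diff[OF that] that(2)] by simp
    show "(\<lambda>N. \<Theta> z (\<Sum>j<N. z ^ j *\<^sub>C h j)) \<longlonglongrightarrow> \<Theta> z (power_series h z)"
    proof (rule LIM_zero_cancel, rule Lim_null_comparison)
      show "\<forall>\<^sub>F N in sequentially. norm (\<Theta> z (\<Sum>j<N. z ^ j *\<^sub>C h j) - \<Theta> z (power_series h z))
          \<le> K * norm ((\<Sum>j<N. z ^ j *\<^sub>C h j) - power_series h z)"
        using K(2)[OF U_diff[OF pU hz]] by (simp add: diff pU hz)
      show "(\<lambda>N. K * norm ((\<Sum>j<N. z ^ j *\<^sub>C h j) - power_series h z)) \<longlonglongrightarrow> 0"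
        using sums unfolding sums_def
        by (intro tendsto_mult_right_zero tendsto_norm_zero LIM_zero)
    qed
    define K' where "K' = sqrt (\<Sum>j. real (binom n j) * (norm z ^ j)\<^sup>2)"
    show "(\<lambda>N. \<Theta> z (\<Sum>j<N. z ^ j *\<^sub>C h j)) \<longlonglongrightarrow> power_series (conv h) z"
    proof (rule LIM_zero_cancel, rule Lim_null_comparison)
      have "norm (\<Theta> z (\<Sum>j<N. z ^ j *\<^sub>C h j) - power_series (conv h) z)
          \<le> K' * seq_norm n (\<lambda>m. conv h m - conv (t N) m)" for N
        using norm_power_series_le[OF sq_summable_diff[OF cs ts] z, of N]
        by (simp add: K'_def power_series_diff[OF cs ts] t(2)[OF z] norm_minus_commute)
      then show "\<forall>\<^sub>F N in sequentially. norm (\<Theta> z (\<Sum>j<N. z ^ j *\<^sub>C h j) - power_series (conv h) z)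
          \<le> K' * seq_norm n (\<lambda>m. conv h m - conv (t N) m)"
        by simp
      show "(\<lambda>N. K' * seq_norm n (\<lambda>m. conv h m - conv (t N) m)) \<longlonglongrightarrow> 0"
        by (intro tendsto_mult_right_zero lim)
    qed
  qed
  moreover have "power_series (conv h) z = 0" if "\<not> norm z < 1" for z
    using that by (simp add: power_series_def)
  ultimately show "mult_op \<Theta> (power_series h) = power_series (conv h)"
    unfolding mult_op_def fun_eq_iff by simp
qed

lemma hardyD:
  assumes "f \<in> hardy U"
  shows "\<And>j. taylor f j \<in> U" "summable (\<lambda>j. (norm (taylor f j))\<^sup>2)" "f = power_series (taylor f)"
    "bergman_norm 1 f = sqrt (\<Sum>j. (norm (taylor f j))\<^sup>2)" "\<And>z. norm z < 1 \<Longrightarrow> f z \<in> U"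
proof -
  note h = hardy.bergmanD[OF assms]
  show "taylor f j \<in> U" for j
    by (rule h(2))
  show "summable (\<lambda>j. (norm (taylor f j))\<^sup>2)"
    using h(1) by (simp add: sq_summable_def weight_def)
  show f: "f = power_series (taylor f)"
    by (rule h(3))
  show "bergman_norm 1 f = sqrt (\<Sum>j. (norm (taylor f j))\<^sup>2)"
    by (simp add: bergman_norm_def weight_def)
  show "f z \<in> U" if "norm z < 1" for z
    using power_series_in_subspace[OF U h(2) hardy.power_series_sums[OF h(1) that]] by (simp flip: f)
qed

theorem contractive_multiplier:
  assumes "f \<in> hardy U"
  shows "mult_op \<Theta> f \<in> M" "mult_op \<Theta> f \<in> bergman n UNIV"
    "bergman_norm n (mult_op \<Theta> f) \<le> bergman_norm 1 f"
proof -
  define h where "h = taylor f"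
  have h: "\<And>j. h j \<in> U" "summable (\<lambda>j. (norm (h j))\<^sup>2)" "f = power_series h"
    "bergman_norm 1 f = sqrt (\<Sum>j. (norm (h j))\<^sup>2)"
    unfolding h_def by (fact hardyD[OF assms])+
  have eq: "mult_op \<Theta> f = power_series (conv h)"
    unfolding h(3) by (rule mult_op_power_series[of h, OF h(1,2)])
  show "mult_op \<Theta> f \<in> M"
    unfolding eq by (rule complementI[OF conv_complement[of h, OF h(1,2)]])
  then show "mult_op \<Theta> f \<in> bergman n UNIV"
    by (auto simp: observability_complement_def)
  have "seq_norm n (conv h) \<le> sqrt (\<Sum>j. (norm (h j))\<^sup>2)"
    by (rule real_le_rsqrt[OF conv_norm_le(2)[of h, OF h(1,2)]])
  then show "bergman_norm n (mult_op \<Theta> f) \<le> bergman_norm 1 f"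
    unfolding eq h(4) by (simp add: bergman_norm_power_series conv_norm_le(1)[of h, OF h(1,2)])
qed

lemma multiplier_range_subspace:
  shows "(\<lambda>z. 0) \<in> mult_op \<Theta> ` hardy U"
    and "f \<in> mult_op \<Theta> ` hardy U \<Longrightarrow> g \<in> mult_op \<Theta> ` hardy U \<Longrightarrow> (\<lambda>z. f z + g z) \<in> mult_op \<Theta> ` hardy U"
    and "f \<in> mult_op \<Theta> ` hardy U \<Longrightarrow> (\<lambda>z. c *\<^sub>C f z) \<in> mult_op \<Theta> ` hardy U"
    and "f \<in> mult_op \<Theta> ` hardy U \<Longrightarrow> shift f \<in> mult_op \<Theta> ` hardy U"
    and "u \<in> U \<Longrightarrow> mult_op \<Theta> (\<lambda>z. u) \<in> mult_op \<Theta> ` hardy U"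
proof -
  have \<Theta>_add: "\<Theta> z (u + v) = \<Theta> z u + \<Theta> z v" if "norm z < 1" "u \<in> U" "v \<in> U" for z u v
    by (rule bounded_op_onD(1)[OF theta_bounded[OF that(1)] that(2,3)])
  have \<Theta>_scaleC: "\<Theta> z (c *\<^sub>C u) = c *\<^sub>C \<Theta> z u" if "norm z < 1" "u \<in> U" for z u c
    by (rule bounded_op_onD(2)[OF theta_bounded[OF that(1)] that(2)])
  have mem: "mult_op \<Theta> p \<in> mult_op \<Theta> ` hardy U" if "p \<in> hardy U" for p
    using that by blast
  show const: "mult_op \<Theta> (\<lambda>z. u) \<in> mult_op \<Theta> ` hardy U" if u: "u \<in> U" for u
  proof -
    define h where "h = case_nat u (\<lambda>j. 0)"
    have hs: "sq_summable 1 h"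
      unfolding sq_summable_def
      by (rule summable_finite[of "{0}"]) (auto simp: h_def split: nat.split)
    have "power_series h z = u" if "norm z < 1" for z
    proof -
      have "(\<lambda>j. z ^ j *\<^sub>C h j) sums (\<Sum>j\<in>{0}. z ^ j *\<^sub>C h j)"
        by (rule sums_finite) (auto simp: h_def scaleC.zero_right split: nat.split)
      then show ?thesis
        using sums_unique2[OF hardy.power_series_sums[OF hs that]] by (simp add: h_def scaleC_one)
    qed
    then have "mult_op \<Theta> (\<lambda>z. u) = mult_op \<Theta> (power_series h)"
      by (auto simp: mult_op_def)
    moreover have "power_series h \<in> hardy U"
      using u U_zero by (intro hardy.bergmanI hs) (simp add: h_def split: nat.split)
    ultimately show ?thesis using mem by metis
  qed
  show "(\<lambda>z. 0) \<in> mult_op \<Theta> ` hardy U"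
  proof -
    have "mult_op \<Theta> (\<lambda>z. 0) = (\<lambda>z. 0)"
      using mult_op_theta_const[where u = 0 and B = B and D = D] theta_seq_0 power_series_zero by simp
    then show ?thesis using const[OF U_zero] by simp
  qed
  show "(\<lambda>z. f z + g z) \<in> mult_op \<Theta> ` hardy U"
    if fg: "f \<in> mult_op \<Theta> ` hardy U" "g \<in> mult_op \<Theta> ` hardy U" for f g
  proof -
    obtain p q where pq: "f = mult_op \<Theta> p" "p \<in> hardy U" "g = mult_op \<Theta> q" "q \<in> hardy U"
      using fg by blast
    define a where "a = taylor p"
    have a: "sq_summable 1 a" "\<And>j. a j \<in> U" "p = power_series a"
      unfolding a_def by (fact hardy.bergmanD[OF pq(2)])+
    define b where "b = taylor q"
    have b: "sq_summable 1 b" "\<And>j. b j \<in> U" "q = power_series b"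
      unfolding b_def by (fact hardy.bergmanD[OF pq(4)])+
    have "(\<lambda>z. p z + q z) \<in> hardy U"
      using hardy.bergmanI[OF hardy.sq_summable_add[OF a(1) b(1)], of U] a(2) b(2)
      by (simp add: U_add a(3) b(3) hardy.power_series_add[OF a(1) b(1)])
    moreover have "mult_op \<Theta> (\<lambda>z. p z + q z) = (\<lambda>z. f z + g z)"
      using hardyD(5)[OF pq(2)] hardyD(5)[OF pq(4)] \<Theta>_add
      by (auto simp: mult_op_def pq(1,3) fun_eq_iff)
    ultimately show ?thesis using mem by metis
  qed
  show "(\<lambda>z. c *\<^sub>C f z) \<in> mult_op \<Theta> ` hardy U" if f: "f \<in> mult_op \<Theta> ` hardy U" for f c
  proof -
    obtain p where p: "f = mult_op \<Theta> p" "p \<in> hardy U"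
      using f by blast
    define a where "a = taylor p"
    have a: "sq_summable 1 a" "\<And>j. a j \<in> U" "p = power_series a"
      unfolding a_def by (fact hardy.bergmanD[OF p(2)])+
    have "(\<lambda>z. c *\<^sub>C p z) \<in> hardy U"
      using hardy.bergmanI[OF hardy.sq_summable_scaleC[OF a(1)], of c U] a(2)
      by (simp add: U_scaleC a(3) hardy.power_series_scaleC[OF a(1)])
    moreover have "mult_op \<Theta> (\<lambda>z. c *\<^sub>C p z) = (\<lambda>z. c *\<^sub>C f z)"
      using hardyD(5)[OF p(2)] \<Theta>_scaleC
      by (auto simp: mult_op_def p(1) fun_eq_iff scaleC.zero_right)
    ultimately show ?thesis using mem by metis
  qed
  show "shift f \<in> mult_op \<Theta> ` hardy U" if f: "f \<in> mult_op \<Theta> ` hardy U" for f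
  proof -
    obtain p where p: "f = mult_op \<Theta> p" "p \<in> hardy U"
      using f by blast
    define a where "a = taylor p"
    have a: "sq_summable 1 a" "\<And>j. a j \<in> U" "p = power_series a"
      unfolding a_def by (fact hardy.bergmanD[OF p(2)])+
    have "shift p \<in> hardy U"
      using hardy.bergmanI[OF hardy.sq_summable_shift[OF a(1)], of U] a(2) U_zero
      by (simp add: a(3) hardy.power_series_shift[OF a(1)] split: nat.split)
    moreover have "mult_op \<Theta> (shift p) = shift f"
      using hardyD(5)[OF p(2)] \<Theta>_scaleC
      by (auto simp: mult_op_def p(1) fun_eq_iff shift_def scaleC.zero_right)
    ultimately show ?thesis using mem by metis
  qed
qed

text \<open>
  The range of the multiplier lies between the span of the spaces \<open>S\<^sup>k E\<close> and the closed subspace \<open>M\<close>.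
\<close>

lemma multiplier_range_dense:
  assumes "wandering_subspace_property n M"
  shows "M = bergman_closure n (mult_op \<Theta> ` hardy U)"
proof
  define R where "R = mult_op \<Theta> ` hardy U"
  note R = multiplier_range_subspace[folded R_def]
  have mono: "bergman_closure n F \<subseteq> bergman_closure n F'" if "F \<subseteq> F'" for F F' :: "(complex \<Rightarrow> 'y) set"
    using that unfolding bergman_closure_def by blast
  have "(shift ^^ k) f \<in> R" if "f \<in> E" for k f
    using that by (induction k) (auto simp: wandering_eq_theta intro: R)
  then have W: "(\<Union>k. (shift ^^ k) ` E) \<subseteq> R" by blast
  have "fun_span (\<Union>k. (shift ^^ k) ` E) \<subseteq> R"
  proof
    fix f assume "f \<in> fun_span (\<Union>k. (shift ^^ k) ` E)"
    then obtain T c where T: "finite T" "T \<subseteq> (\<Union>k. (shift ^^ k) ` E)" "f = (\<lambda>z. \<Sum>g\<in>T. c g *\<^sub>C g z)"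
      unfolding fun_span_def by blast
    from T(1,2) have "(\<lambda>z. \<Sum>g\<in>T. c g *\<^sub>C g z) \<in> R"
    proof (induction T)
      case (insert g T)
      then have "(\<lambda>z. c g *\<^sub>C g z + (\<Sum>g\<in>T. c g *\<^sub>C g z)) \<in> R"
        using W by (intro R) auto
      then show ?case using insert by simp
    qed (simp add: R)
    then show "f \<in> R" by (simp add: T(3))
  qed
  then show "M \<subseteq> bergman_closure n (mult_op \<Theta> ` hardy U)"
    using mono assms unfolding wandering_subspace_property_def R_def by blast
  have "R \<subseteq> M"
    unfolding R_def using contractive_multiplier(1) by blast
  then have "bergman_closure n R \<subseteq> bergman_closure n M" by (rule mono)
  then show "bergman_closure n (mult_op \<Theta> ` hardy U) \<subseteq> M"
    by (simp add: complement_closure R_def)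
qed

lemma wandering_orthogonal_shift_theta:
  assumes "k \<ge> 1" "f \<in> E" "u \<in> U"
  shows "bergman_inner n f ((shift ^^ k) (mult_op \<Theta> (\<lambda>z. u))) = 0"
proof -
  have M: "(shift ^^ j) (mult_op \<Theta> (\<lambda>z. u)) \<in> M" for j
  proof (induction j)
    case 0
    show ?case using assms(3) wandering_eq_theta by (auto simp: wandering_def)
  next
    case (Suc j)
    then show ?case
      using complement_closed_invariant by (auto simp: closed_invariant_subspace_def)
  qed
  obtain j where "k = Suc j" using assms(1) by (cases k) auto
  then show ?thesis
    using M[of j] assms(2) by (simp add: wandering_def)
qed

end

theorem theorem7p10:
  fixes n :: nat
    and A :: "'x::complex_hilbert \<Rightarrow> 'x"
    and C :: "'x \<Rightarrow> 'y::complex_hilbert"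
    and M E :: "(complex \<Rightarrow> 'y) set"
  assumes "n \<ge> 1"
    and "bounded_op_on UNIV A"
    and "bounded_op_on UNIV C"
    and "output_stable n C A"
    and "exactly_observable n C A"
    and "strongly_stable A"
    and "M = observability_complement n C A"
    and "E = wandering n M"
  shows "closed_invariant_subspace n M
    \<and> reproducing_kernel n E (kernel_of n E)
    \<and> (\<exists>(U :: ('x \<times> 'y) set) B D. hilbert_subspace U \<and> cholesky_solution n C A U B D)
    \<and> (\<forall>(U :: 'u::complex_hilbert set) B D.
         hilbert_subspace U \<and> cholesky_solution n C A U B D \<longrightarrow>
         (let \<Theta> = theta n C A B D in
           ((\<forall>z \<zeta>. norm z < 1 \<longrightarrow> norm \<zeta> < 1 \<longrightarrow>
               (\<forall>y. kernel_of n E z \<zeta> y = \<Theta> z (adj_on U (\<Theta> \<zeta>) y)))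
             \<and> (\<lambda>u. mult_op \<Theta> (\<lambda>z. u)) ` U = E
             \<and> (\<forall>u\<in>U. \<forall>v\<in>U. bergman_inner n (mult_op \<Theta> (\<lambda>z. u)) (mult_op \<Theta> (\<lambda>z. v))
                                = cinner u v))
         \<and> (\<forall>k\<ge>1. \<forall>f\<in>E. \<forall>u\<in>U.
               bergman_inner n f ((shift ^^ k) (mult_op \<Theta> (\<lambda>z. u))) = 0)
         \<and> ((\<forall>h\<in>hardy U. mult_op \<Theta> h \<in> bergman n UNIV
                 \<and> bergman_norm n (mult_op \<Theta> h) \<le> bergman_norm 1 h)
             \<and> (wandering_subspace_property n M \<longrightarrow>
                 M = bergman_closure n (mult_op \<Theta> ` hardy U)))))"
proof -
  interpret exactly_observable_pair n A C
    using assms by unfold_locales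
  have factor: "cholesky_factor n A C V B D"
    if "hilbert_subspace V" "cholesky_solution n C A V B D" for V :: "'v::complex_hilbert set" and B D
    using that by unfold_locales
  obtain U0 :: "('x \<times> 'y) set" and B0 D0
    where 0: "hilbert_subspace U0" "cholesky_solution n C A U0 B0 D0"
    using cholesky_solution_exists by blast
  show ?thesis
    unfolding assms(7,8) Let_def
  proof (intro conjI allI impI)
    show "closed_invariant_subspace n (observability_complement n C A)"
      by (rule complement_closed_invariant)
    show "reproducing_kernel n (wandering n (observability_complement n C A))
        (kernel_of n (wandering n (observability_complement n C A)))"
      by (rule cholesky_factor.reproducing_kernel_wandering[OF factor[OF 0]])
    show "\<exists>(U :: ('x \<times> 'y) set) B D. hilbert_subspace U \<and> cholesky_solution n C A U B D"
      by (rule cholesky_solution_exists)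
  next
    fix U :: "'u set" and B D
    assume "hilbert_subspace U \<and> cholesky_solution n C A U B D"
    then interpret cholesky_factor n A C U B D
      by (intro factor) auto
    show "kernel_of n (wandering n (observability_complement n C A)) z \<zeta> y
        = theta n C A B D z (adj_on U (theta n C A B D \<zeta>) y)"
      if "norm z < 1" "norm \<zeta> < 1" for z \<zeta> y
      by (rule kernel_of_eq[OF that])
    show "(\<lambda>u. mult_op (theta n C A B D) (\<lambda>z. u)) ` U = wandering n (observability_complement n C A)"
      by (rule wandering_eq_theta[symmetric])
    show "\<forall>u\<in>U. \<forall>v\<in>U. bergman_inner n (mult_op (theta n C A B D) (\<lambda>z. u))
        (mult_op (theta n C A B D) (\<lambda>z. v)) = cinner u v"
      by (intro ballI inner_theta)
    show "\<forall>f\<in>wandering n (observability_complement n C A). \<forall>u\<in>U.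
        bergman_inner n f ((shift ^^ k) (mult_op (theta n C A B D) (\<lambda>z. u))) = 0" if "k \<ge> 1" for k
      using wandering_orthogonal_shift_theta[OF that] by blast
    show "\<forall>h\<in>hardy U. mult_op (theta n C A B D) h \<in> bergman n UNIV \<and>
        bergman_norm n (mult_op (theta n C A B D) h) \<le> bergman_norm 1 h"
      using contractive_multiplier(2,3) by blast
    show "observability_complement n C A = bergman_closure n (mult_op (theta n C A B D) ` hardy U)"
      if "wandering_subspace_property n (observability_complement n C A)"
      by (rule multiplier_range_dense[OF that])
  qed
qed

end
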